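(* The Generalized Mimetic, Generalized Hybrid and Modified Mixed methods are identical, in the following sense: for any choice of parameters for one of these three methods, there exists a choice of parameters for each of the other two methods which leads to the same scheme.
   Context: **Problem.** $\Omega\subset\mathbf{R}^d$ ($d\ge 1$) is a bounded (polytopal) open set, $f\in L^2(\Omega)$, and $\Lambda:\Omega\to M_d(\mathbf{R})$ is bounded, measurable, symmetric and uniformly elliptic (there is $\zeta>0$ with $\Lambda(x)\xi\cdot\xi\ge\zeta|\xi|^2$ for a.e. $x\in\Omega$ and all $\xi\in\mathbf{R}^d$). The methods discretize $-\mathrm{div}(\Lambda\nabla p)=f$ in $\Omega$, $p=0$ on $\partial\Omega$. **Mesh.** $\mathcal M$ is a finite partition (up to a null set) of $\Omega$ into open polytopal cells $K$. $\mathcal E_K$ is the set of faces of $K$, each face $\sigma$ being a non-empty relatively open subset of a hyperplane, contained in $\partial K$, the faces being disjoint and the union of their closures being $\partial K$. $\mathcal E$ is the set of all faces; each $\sigma\in\mathcal E$ is either contained in $\partial\Omega$, or interior, i.e. a common face of exactly two cells. $|K|$, $|\sigma|$ are the $d$- and $(d-1)$-dimensional measures, $\mathbf n_{K,\sigma}$ is the unit normal to $\sigma$ outward to $K$, $\bar x_\sigma$ is the center of gravity of $\sigma$, $k_K$ is the number of faces of $K$, and $\Lambda_K$ is the mean value of $\Lambda$ on $K$. **Discrete spaces.** $H_{\mathcal M}$ is the space of families $p=(p_K)_{K\in\mathcal M}$ of reals. $\widetilde H_{\mathcal M,0}$ is the space of families $\widetilde p=((p_K)_{K\in\mathcal M},(p_\sigma)_{\sigma\in\mathcal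 E})$ with $p_\sigma=0$ whenever $\sigma\subset\partial\Omega$. $\widetilde H_K$ is the space of local families $\widetilde p_K=(p_K,(p_\sigma)_{\sigma\in\mathcal E_K})$. $\mathcal F$ is the space of families $F=(F_{K,\sigma})_{K\in\mathcal M,\sigma\in\mathcal E_K}$ such that $F_{K,\sigma}+F_{L,\sigma}=0$ for each interior face $\sigma$ common to $K$ and $L$; $F_K=(F_{K,\sigma})_{\sigma\in\mathcal E_K}$ is the restriction to $K$, an element of $\mathcal F_K=\mathbf{R}^{\mathcal E_K}\cong\mathbf{R}^{k_K}$. **Generalized Mimetic method.** Parameters: a point $x_K\in K$ for each $K$, and for each $K$ a pair $(\mathbb C_K,\mathbb U_K)$, where $\mathbb C_K$ is a $k_K\times(k_K-d)$ matrix with $\mathrm{Im}(\mathbb C_K)=(\mathrm{Im}(\mathbb N_K))^\perp$, $\mathbb N_K$ being the $k_K\times d$ matrix with entries $(\mathbb N_K)_{\sigma,j}=(\Lambda_K)_j\cdot\mathbf n_{K,\sigma}$ ($(\Lambda_K)_j$ is the $j$-th column of $\Lambda_K$), and $\mathbb U_K$ is a symmetric positive definite $(k_K-d)\times(k_K-d)$ matrix. Let $\mathbb R_K$ be the $k_K\times d$ matrix with rows $|\sigma|(\bar x_\sigma-x_K)^T$, $\sigma\in\mathcal E_K$, let $$\mathbb M_K=\frac1{|K|}\mathbb R_K\Lambda_K^{-1}\mathbb R_K^T+\mathbb C_K\mathbb U_K\mathbb C_K^T,$$ and let $[F_K,G_K]_K=F_K^T\mathbb M_KG_K$. For $G\in\mathcal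 F$ set $(\mathcal{DIV}^hG)_K=\frac1{|K|}\sum_{\sigma\in\mathcal E_K}|\sigma|G_{K,\sigma}$. The scheme is: find $(p,F)\in H_{\mathcal M}\times\mathcal F$ such that $$\sum_{K}[F_K,G_K]_K-\sum_K|K|\,p_K(\mathcal{DIV}^hG)_K=0\quad\forall G\in\mathcal F,$$ $$\sum_K|K|\,q_K(\mathcal{DIV}^hF)_K=\sum_Kq_K\int_Kf\quad\forall q\in H_{\mathcal M}.$$ **Generalized Hybrid method.** Parameters: a point $x_K\in K$ and a symmetric positive definite $k_K\times k_K$ matrix $\mathbb B^H_K$ for each $K$. Set $$\nabla_K\widetilde p_K=\frac1{|K|}\sum_{\sigma\in\mathcal E_K}|\sigma|(p_\sigma-p_K)\mathbf n_{K,\sigma},\qquad S_{K,\sigma}(\widetilde p_K)=p_\sigma-p_K-\nabla_K\widetilde p_K\cdot(\bar x_\sigma-x_K),$$ and $S_K(\widetilde p_K)=(S_{K,\sigma}(\widetilde p_K))_{\sigma\in\mathcal E_K}$. The scheme is: find $(\widetilde p,F)\in\widetilde H_{\mathcal M,0}\times\mathcal F$ such that, for all $K\in\mathcal M$, $\sum_{\sigma\in\mathcal E_K}|\sigma|F_{K,\sigma}=\int_Kf$ and $$\forall\widetilde q_K\in\widetilde H_K:\ \sum_{\sigma\in\mathcal E_K}|\sigma|F_{K,\sigma}(q_K-q_\sigma)=|K|\Lambda_K\nabla_K\widetilde p_K\cdot\nabla_K\widetilde q_K+S_K(\widetilde q_K)^T\mathbb B^H_KS_K(\widetilde p_K).$$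 **Modified Mixed method.** Parameters: a point $x_K\in K$ and a symmetric positive definite $k_K\times k_K$ matrix $\mathbb B^M_K$ for each $K$. For $F_K\in\mathcal F_K$ define $\mathbf v_K(F_K)\in\mathbf{R}^d$ by $|K|\Lambda_K\mathbf v_K(F_K)=-\sum_{\sigma\in\mathcal E_K}|\sigma|F_{K,\sigma}(\bar x_\sigma-x_K)$, set $T_{K,\sigma}(F_K)=F_{K,\sigma}+\Lambda_K\mathbf v_K(F_K)\cdot\mathbf n_{K,\sigma}$, $T_K(F_K)=(T_{K,\sigma}(F_K))_{\sigma\in\mathcal E_K}$, and $$\langle F_K,G_K\rangle_K=|K|\,\mathbf v_K(F_K)\cdot\Lambda_K\mathbf v_K(G_K)+T_K(G_K)^T\mathbb B^M_KT_K(F_K).$$ The scheme is: find $(\widetilde p,F)\in\widetilde H_{\mathcal M,0}\times\mathcal F$ such that, for all $K\in\mathcal M$, $\sum_{\sigma\in\mathcal E_K}|\sigma|F_{K,\sigma}=\int_Kf$ and $$\forall G_K\in\mathcal F_K:\ \langle F_K,G_K\rangle_K=\sum_{\sigma\in\mathcal E_K}(p_K-p_\sigma)|\sigma|G_{K,\sigma}.$$ **Same scheme.** A Generalized Hybrid and a Modified Mixed scheme are the same if, for every $f\in L^2(\Omega)$, they have the same solutions $(\widetilde p,F)$. A Generalized Mimetic scheme is the same as one of these if, for every $f\in L^2(\Omega)$, $(p,F)$ is a solution of the Mimetic scheme if and only if there are face values $(p_\sigma)_{\sigma\in\mathcal E}$ such that $\widetilde p=((p_K)_K,(p_\sigma)_\sigma)\in\widetilde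 H_{\mathcal M,0}$ and $(\widetilde p,F)$ is a solution of the other scheme.
   Formalization: Faces are additionally required to be polytopal (relative boundary inside finitely many lower-dimensional affine subspaces); for arbitrary relatively open subsets of hyperplanes, whose relative boundary may have positive measure, the claim fails. *)

theory Defs
  imports "HOL-Analysis.Analysis"
begin

section \<open>Matrices and vectors indexed by finite sets\<close>

text \<open>
  The matrices attached to a cell have sizes depending on its number of faces.  A matrix with rows
  indexed by \<open>I\<close> and columns indexed by \<open>J\<close> is a function of two arguments of which only the values
  on \<open>I \<times> J\<close> matter; elements of \<open>\<real>\<^sup>I\<close> inside a set of vectors are taken extensional on \<open>I\<close>.
\<close>

definition mat_im :: "'a set \<Rightarrow> 'b set \<Rightarrow> ('a \<Rightarrow> 'b \<Rightarrow> real) \<Rightarrow> ('a \<Rightarrow> real) set" where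
  "mat_im I J A = {(\<lambda>i\<in>I. \<Sum>j\<in>J. A i j * w j) | w. True}"

definition vec_orth :: "'a set \<Rightarrow> ('a \<Rightarrow> real) set \<Rightarrow> ('a \<Rightarrow> real) set" where
  "vec_orth I V = {v \<in> extensional I. \<forall>w\<in>V. (\<Sum>i\<in>I. v i * w i) = 0}"

definition sym_posdef :: "'a set \<Rightarrow> ('a \<Rightarrow> 'a \<Rightarrow> real) \<Rightarrow> bool" where
  "sym_posdef I A \<longleftrightarrow>
     (\<forall>i\<in>I. \<forall>j\<in>I. A i j = A j i) \<and>
     (\<forall>w. (\<exists>i\<in>I. w i \<noteq> 0) \<longrightarrow> 0 < (\<Sum>i\<in>I. \<Sum>j\<in>I. w i * A i j * w j))"

section \<open>Polytopal meshes\<close>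

type_synonym 'n pset = "(real^'n) set"

text \<open>
  Not necessarily convex; used both for full-dimensional sets (then the relative notions are the
  absolute ones) and for subsets of hyperplanes.
\<close>

definition polytopal :: "'a::euclidean_space set \<Rightarrow> bool" where
  "polytopal S \<longleftrightarrow>
     bounded S \<and> rel_open S \<and>
     (\<exists>\<A>. finite \<A> \<and> (\<forall>A\<in>\<A>. affine A \<and> aff_dim A < aff_dim S) \<and> rel_frontier S \<subseteq> \<Union>\<A>)"

text \<open>
  The \<open>(d-1)\<close>-dimensional Lebesgue measure on a hyperplane \<open>H\<close>, as a Borel measure on \<open>\<real>\<^sup>d\<close>:
  the image, under the orthogonal projection on \<open>H\<close>, of the Lebesgue measure on the slab of
  thickness 1 around \<open>H\<close>.  For \<open>d = 1\<close> it is the unit mass at the point \<open>H\<close>.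
\<close>

definition hyperplane_measure :: "'n pset \<Rightarrow> (real^'n) measure" where
  "hyperplane_measure H =
     distr (restrict_space lborel {x. infdist x H \<le> 1/2}) borel (closest_point H)"

definition surface_measure :: "'n pset \<Rightarrow> (real^'n) measure" where
  "surface_measure \<sigma> = hyperplane_measure (affine hull \<sigma>)"

definition face_area :: "'n::finite pset \<Rightarrow> real" where
  "face_area \<sigma> = measure (surface_measure \<sigma>) \<sigma>"

definition face_center :: "'n pset \<Rightarrow> real^'n" where
  "face_center \<sigma> = (1 / face_area \<sigma>) *\<^sub>R (LINT x:\<sigma>|surface_measure \<sigma>. x)"

definition volume :: "'n::finite pset \<Rightarrow> real" where
  "volume K = measure lebesgue K"

text \<open>
  Outwardness is required at almost every point of the face only, so that a face may contain
  exceptional points at which another part of the boundary of \<open>K\<close> touches it.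
\<close>

definition is_outward_normal :: "'n pset \<Rightarrow> 'n pset \<Rightarrow> real^'n \<Rightarrow> bool" where
  "is_outward_normal K \<sigma> n \<longleftrightarrow>
     norm n = 1 \<and> (\<forall>x\<in>\<sigma>. \<forall>y\<in>\<sigma>. n \<bullet> (x - y) = 0) \<and>
     (AE x in surface_measure \<sigma>. x \<in> \<sigma> \<longrightarrow>
        (\<exists>\<epsilon>>0. \<forall>t. 0 < t \<and> t < \<epsilon> \<longrightarrow> x - t *\<^sub>R n \<in> K \<and> x + t *\<^sub>R n \<notin> K))"

definition outward_normal :: "'n pset \<Rightarrow> 'n pset \<Rightarrow> real^'n" where
  "outward_normal K \<sigma> = (SOME n. is_outward_normal K \<sigma> n)"

definition is_face :: "'n::finite pset \<Rightarrow> 'n pset \<Rightarrow> bool" where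
  "is_face K \<sigma> \<longleftrightarrow>
     \<sigma> \<noteq> {} \<and> polytopal \<sigma> \<and> \<sigma> \<subseteq> frontier K \<and>
     (\<exists>a c. a \<noteq> 0 \<and> openin (top_of_set {x. a \<bullet> x = c}) \<sigma>) \<and>
     (\<exists>n. is_outward_normal K \<sigma> n)"

text \<open>\<open>E K\<close> is the set of the faces of the cell \<open>K\<close>.\<close>

definition polytopal_mesh ::
  "'n::finite pset \<Rightarrow> 'n pset set \<Rightarrow> ('n pset \<Rightarrow> 'n pset set) \<Rightarrow> bool" where
  "polytopal_mesh \<Omega> M E \<longleftrightarrow>
     finite M \<and>
     (\<forall>K\<in>M. K \<noteq> {} \<and> open K \<and> polytopal K \<and> K \<subseteq> \<Omega>) \<and>
     pairwise disjnt M \<and> negligible (\<Omega> - \<Union>M) \<and>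
     (\<forall>K\<in>M. finite (E K) \<and> (\<forall>\<sigma>\<in>E K. is_face K \<sigma>) \<and> pairwise disjnt (E K) \<and>
        (\<Union>\<sigma>\<in>E K. closure \<sigma>) = frontier K) \<and>
     (\<forall>\<sigma>\<in>\<Union>(E ` M). \<sigma> \<subseteq> frontier \<Omega> \<or> card {K\<in>M. \<sigma> \<in> E K} = 2)"

section \<open>Data of the elliptic problem\<close>

definition diffusion_tensor :: "'n pset \<Rightarrow> (real^'n \<Rightarrow> real^'n^'n) \<Rightarrow> bool" where
  "diffusion_tensor \<Omega> \<Lambda> \<longleftrightarrow>
     bounded (\<Lambda> ` \<Omega>) \<and> \<Lambda> \<in> borel_measurable (lebesgue_on \<Omega>) \<and>
     (\<forall>x\<in>\<Omega>. transpose (\<Lambda> x) = \<Lambda> x) \<and>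
     (\<exists>\<zeta>>0. AE x in lebesgue_on \<Omega>. \<forall>\<xi>. (\<Lambda> x *v \<xi>) \<bullet> \<xi> \<ge> \<zeta> * (norm \<xi>)\<^sup>2)"

definition L2_on :: "'n pset \<Rightarrow> (real^'n \<Rightarrow> real) set" where
  "L2_on \<Omega> = {f. f \<in> borel_measurable (lebesgue_on \<Omega>) \<and> integrable (lebesgue_on \<Omega>) (\<lambda>x. (f x)\<^sup>2)}"

definition cell_mean :: "(real^'n \<Rightarrow> real^'n^'n) \<Rightarrow> 'n pset \<Rightarrow> real^'n^'n" where
  "cell_mean \<Lambda> K = (1 / volume K) *\<^sub>R (LINT x:K|lebesgue. \<Lambda> x)"

section \<open>Discrete spaces\<close>

text \<open>
  Families indexed by cells and faces are total functions; only their values at the cells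
  \<open>K \<in> M\<close>, the faces of the mesh and the pairs \<open>K \<in> M\<close>, \<open>\<sigma> \<in> E K\<close> are relevant.  A pair \<open>(p, ps)\<close>
  consists of the cell values and the face values.  The interior faces are those not contained in
  \<open>frontier \<Omega>\<close>; in a mesh each of them belongs to exactly two cells.
\<close>

type_synonym 'n vals = "'n pset \<Rightarrow> real"
type_synonym 'n hyb = "'n vals \<times> 'n vals"
type_synonym 'n fluxes = "'n pset \<Rightarrow> 'n vals"

definition hybrid_space ::
  "'n::finite pset \<Rightarrow> 'n pset set \<Rightarrow> ('n pset \<Rightarrow> 'n pset set) \<Rightarrow> 'n hyb set" where
  "hybrid_space \<Omega> M E = {(p, ps). \<forall>\<sigma>\<in>\<Union>(E ` M). \<sigma> \<subseteq> frontier \<Omega> \<longrightarrow> ps \<sigma> = 0}"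

definition flux_space ::
  "'n::finite pset \<Rightarrow> 'n pset set \<Rightarrow> ('n pset \<Rightarrow> 'n pset set) \<Rightarrow> 'n fluxes set" where
  "flux_space \<Omega> M E =
     {F. \<forall>K\<in>M. \<forall>L\<in>M. K \<noteq> L \<longrightarrow>
           (\<forall>\<sigma>\<in>E K \<inter> E L. \<not> \<sigma> \<subseteq> frontier \<Omega> \<longrightarrow> F K \<sigma> + F L \<sigma> = 0)}"

section \<open>Generalized Mimetic method\<close>

definition mat_N :: "(real^'n \<Rightarrow> real^'n^'n) \<Rightarrow> 'n pset \<Rightarrow> 'n pset \<Rightarrow> 'n \<Rightarrow> real" where
  "mat_N \<Lambda> K \<sigma> j = column j (cell_mean \<Lambda> K) \<bullet> outward_normal K \<sigma>"

definition mat_R :: "real^'n \<Rightarrow> 'n pset \<Rightarrow> 'n \<Rightarrow> real" where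
  "mat_R xK \<sigma> j = face_area \<sigma> * (face_center \<sigma> - xK) $ j"

definition mimetic_params ::
  "'n pset set \<Rightarrow> ('n pset \<Rightarrow> 'n pset set) \<Rightarrow> (real^'n \<Rightarrow> real^'n^'n) \<Rightarrow>
   ('n pset \<Rightarrow> real^'n) \<Rightarrow> ('n pset \<Rightarrow> 'n pset \<Rightarrow> nat \<Rightarrow> real) \<Rightarrow>
   ('n pset \<Rightarrow> nat \<Rightarrow> nat \<Rightarrow> real) \<Rightarrow> bool" where
  "mimetic_params M E \<Lambda> x C U \<longleftrightarrow>
     (\<forall>K\<in>M. x K \<in> K \<and>
        mat_im (E K) {..<card (E K) - CARD('n)} (C K) =
          vec_orth (E K) (mat_im (E K) UNIV (mat_N \<Lambda> K)) \<and>
        sym_posdef {..<card (E K) - CARD('n)} (U K))"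

definition mat_M ::
  "('n pset \<Rightarrow> 'n pset set) \<Rightarrow> (real^'n \<Rightarrow> real^'n^'n) \<Rightarrow>
   ('n pset \<Rightarrow> real^'n) \<Rightarrow> ('n pset \<Rightarrow> 'n pset \<Rightarrow> nat \<Rightarrow> real) \<Rightarrow>
   ('n pset \<Rightarrow> nat \<Rightarrow> nat \<Rightarrow> real) \<Rightarrow> 'n pset \<Rightarrow> 'n pset \<Rightarrow> 'n pset \<Rightarrow> real" where
  "mat_M E \<Lambda> x C U K \<sigma> \<tau> =
     (1 / volume K) *
       (\<Sum>i\<in>UNIV. \<Sum>j\<in>UNIV. mat_R (x K) \<sigma> i * matrix_inv (cell_mean \<Lambda> K) $ i $ j * mat_R (x K) \<tau> j)
     + (\<Sum>i<card (E K) - CARD('n). \<Sum>j<card (E K) - CARD('n). C K \<sigma> i * U K i j * C K \<tau> j)"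

definition mimetic_form ::
  "('n pset \<Rightarrow> 'n pset set) \<Rightarrow> (real^'n \<Rightarrow> real^'n^'n) \<Rightarrow>
   ('n pset \<Rightarrow> real^'n) \<Rightarrow> ('n pset \<Rightarrow> 'n pset \<Rightarrow> nat \<Rightarrow> real) \<Rightarrow>
   ('n pset \<Rightarrow> nat \<Rightarrow> nat \<Rightarrow> real) \<Rightarrow> 'n pset \<Rightarrow> 'n vals \<Rightarrow> 'n vals \<Rightarrow> real" where
  "mimetic_form E \<Lambda> x C U K FK GK = (\<Sum>\<sigma>\<in>E K. \<Sum>\<tau>\<in>E K. FK \<sigma> * mat_M E \<Lambda> x C U K \<sigma> \<tau> * GK \<tau>)"

definition div_h ::
  "('n::finite pset \<Rightarrow> 'n pset set) \<Rightarrow> 'n fluxes \<Rightarrow> 'n pset \<Rightarrow> real" where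
  "div_h E G K = (1 / volume K) * (\<Sum>\<sigma>\<in>E K. face_area \<sigma> * G K \<sigma>)"

text \<open>A scheme maps a right-hand side \<open>f\<close> to the set of solutions.\<close>

definition mimetic_scheme ::
  "'n pset \<Rightarrow> 'n pset set \<Rightarrow> ('n pset \<Rightarrow> 'n pset set) \<Rightarrow>
   (real^'n \<Rightarrow> real^'n^'n) \<Rightarrow> ('n pset \<Rightarrow> real^'n) \<Rightarrow>
   ('n pset \<Rightarrow> 'n pset \<Rightarrow> nat \<Rightarrow> real) \<Rightarrow> ('n pset \<Rightarrow> nat \<Rightarrow> nat \<Rightarrow> real) \<Rightarrow>
   (real^'n \<Rightarrow> real) \<Rightarrow> ('n vals \<times> 'n fluxes) set" where
  "mimetic_scheme \<Omega> M E \<Lambda> x C U f =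
     {(p, F). F \<in> flux_space \<Omega> M E \<and>
        (\<forall>G\<in>flux_space \<Omega> M E.
           (\<Sum>K\<in>M. mimetic_form E \<Lambda> x C U K (F K) (G K)) - (\<Sum>K\<in>M. volume K * p K * div_h E G K) = 0) \<and>
        (\<forall>q :: 'n vals.
           (\<Sum>K\<in>M. volume K * q K * div_h E F K) = (\<Sum>K\<in>M. q K * (LINT y:K|lebesgue. f y)))}"

section \<open>Generalized Hybrid method\<close>

text \<open>Parameters common in form to the Hybrid and the Mixed methods: points and local matrices.\<close>

definition point_matrix_params ::
  "'n pset set \<Rightarrow> ('n pset \<Rightarrow> 'n pset set) \<Rightarrow> ('n pset \<Rightarrow> real^'n) \<Rightarrow>
   ('n pset \<Rightarrow> 'n pset \<Rightarrow> 'n pset \<Rightarrow> real) \<Rightarrow> bool" where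
  "point_matrix_params M E x B \<longleftrightarrow> (\<forall>K\<in>M. x K \<in> K \<and> sym_posdef (E K) (B K))"

text \<open>In the local operators, \<open>pK\<close> is the value at the cell and \<open>ps\<close> are the values at the faces.\<close>

definition hybrid_grad ::
  "('n pset \<Rightarrow> 'n pset set) \<Rightarrow> 'n pset \<Rightarrow> real \<Rightarrow> 'n vals \<Rightarrow> real^'n" where
  "hybrid_grad E K pK ps =
     (1 / volume K) *\<^sub>R (\<Sum>\<sigma>\<in>E K. (face_area \<sigma> * (ps \<sigma> - pK)) *\<^sub>R outward_normal K \<sigma>)"

definition hybrid_stab ::
  "('n pset \<Rightarrow> 'n pset set) \<Rightarrow> ('n pset \<Rightarrow> real^'n) \<Rightarrow> 'n pset \<Rightarrow>
   real \<Rightarrow> 'n vals \<Rightarrow> 'n vals" where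
  "hybrid_stab E x K pK ps \<sigma> = ps \<sigma> - pK - hybrid_grad E K pK ps \<bullet> (face_center \<sigma> - x K)"

definition hybrid_scheme ::
  "'n pset \<Rightarrow> 'n pset set \<Rightarrow> ('n pset \<Rightarrow> 'n pset set) \<Rightarrow>
   (real^'n \<Rightarrow> real^'n^'n) \<Rightarrow> ('n pset \<Rightarrow> real^'n) \<Rightarrow>
   ('n pset \<Rightarrow> 'n pset \<Rightarrow> 'n pset \<Rightarrow> real) \<Rightarrow>
   (real^'n \<Rightarrow> real) \<Rightarrow> ('n hyb \<times> 'n fluxes) set" where
  "hybrid_scheme \<Omega> M E \<Lambda> x B f =
     {((p, ps), F). (p, ps) \<in> hybrid_space \<Omega> M E \<and> F \<in> flux_space \<Omega> M E \<and>
        (\<forall>K\<in>M.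
           (\<Sum>\<sigma>\<in>E K. face_area \<sigma> * F K \<sigma>) = (LINT y:K|lebesgue. f y) \<and>
           (\<forall>(qK :: real) (qs :: 'n vals).
              (\<Sum>\<sigma>\<in>E K. face_area \<sigma> * F K \<sigma> * (qK - qs \<sigma>)) =
              volume K * ((cell_mean \<Lambda> K *v hybrid_grad E K (p K) ps) \<bullet> hybrid_grad E K qK qs) +
              (\<Sum>\<sigma>\<in>E K. \<Sum>\<tau>\<in>E K.
                 hybrid_stab E x K qK qs \<sigma> * B K \<sigma> \<tau> * hybrid_stab E x K (p K) ps \<tau>)))}"

section \<open>Modified Mixed method\<close>

definition mixed_v ::
  "('n pset \<Rightarrow> 'n pset set) \<Rightarrow> (real^'n \<Rightarrow> real^'n^'n) \<Rightarrow> ('n pset \<Rightarrow> real^'n) \<Rightarrow>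
   'n pset \<Rightarrow> 'n vals \<Rightarrow> real^'n" where
  "mixed_v E \<Lambda> x K FK =
     (THE v. volume K *\<^sub>R (cell_mean \<Lambda> K *v v) =
             - (\<Sum>\<sigma>\<in>E K. (face_area \<sigma> * FK \<sigma>) *\<^sub>R (face_center \<sigma> - x K)))"

definition mixed_T ::
  "('n pset \<Rightarrow> 'n pset set) \<Rightarrow> (real^'n \<Rightarrow> real^'n^'n) \<Rightarrow> ('n pset \<Rightarrow> real^'n) \<Rightarrow>
   'n pset \<Rightarrow> 'n vals \<Rightarrow> 'n vals" where
  "mixed_T E \<Lambda> x K FK \<sigma> = FK \<sigma> + (cell_mean \<Lambda> K *v mixed_v E \<Lambda> x K FK) \<bullet> outward_normal K \<sigma>"

definition mixed_form ::
  "('n pset \<Rightarrow> 'n pset set) \<Rightarrow> (real^'n \<Rightarrow> real^'n^'n) \<Rightarrow> ('n pset \<Rightarrow> real^'n) \<Rightarrow>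
   ('n pset \<Rightarrow> 'n pset \<Rightarrow> 'n pset \<Rightarrow> real) \<Rightarrow>
   'n pset \<Rightarrow> 'n vals \<Rightarrow> 'n vals \<Rightarrow> real" where
  "mixed_form E \<Lambda> x B K FK GK =
     volume K * (mixed_v E \<Lambda> x K FK \<bullet> (cell_mean \<Lambda> K *v mixed_v E \<Lambda> x K GK)) +
     (\<Sum>\<sigma>\<in>E K. \<Sum>\<tau>\<in>E K. mixed_T E \<Lambda> x K GK \<sigma> * B K \<sigma> \<tau> * mixed_T E \<Lambda> x K FK \<tau>)"

definition mixed_scheme ::
  "'n pset \<Rightarrow> 'n pset set \<Rightarrow> ('n pset \<Rightarrow> 'n pset set) \<Rightarrow>
   (real^'n \<Rightarrow> real^'n^'n) \<Rightarrow> ('n pset \<Rightarrow> real^'n) \<Rightarrow>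
   ('n pset \<Rightarrow> 'n pset \<Rightarrow> 'n pset \<Rightarrow> real) \<Rightarrow>
   (real^'n \<Rightarrow> real) \<Rightarrow> ('n hyb \<times> 'n fluxes) set" where
  "mixed_scheme \<Omega> M E \<Lambda> x B f =
     {((p, ps), F). (p, ps) \<in> hybrid_space \<Omega> M E \<and> F \<in> flux_space \<Omega> M E \<and>
        (\<forall>K\<in>M.
           (\<Sum>\<sigma>\<in>E K. face_area \<sigma> * F K \<sigma>) = (LINT y:K|lebesgue. f y) \<and>
           (\<forall>GK :: 'n vals.
              mixed_form E \<Lambda> x B K (F K) GK = (\<Sum>\<sigma>\<in>E K. (p K - ps \<sigma>) * face_area \<sigma> * GK \<sigma>)))}"

section \<open>Identity of schemes\<close>

definition same_scheme ::
  "'n pset \<Rightarrow> ((real^'n \<Rightarrow> real) \<Rightarrow> ('n hyb \<times> 'n fluxes) set) \<Rightarrow>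
   ((real^'n \<Rightarrow> real) \<Rightarrow> ('n hyb \<times> 'n fluxes) set) \<Rightarrow> bool" where
  "same_scheme \<Omega> S S' \<longleftrightarrow> (\<forall>f\<in>L2_on \<Omega>. S f = S' f)"

text \<open>
  Membership of \<open>(p, ps)\<close> in \<^const>\<open>hybrid_space\<close> is part of being a solution of the
  Hybrid or Mixed scheme.
\<close>

definition same_scheme_mimetic ::
  "'n pset \<Rightarrow> ((real^'n \<Rightarrow> real) \<Rightarrow> ('n vals \<times> 'n fluxes) set) \<Rightarrow>
   ((real^'n \<Rightarrow> real) \<Rightarrow> ('n hyb \<times> 'n fluxes) set) \<Rightarrow> bool" where
  "same_scheme_mimetic \<Omega> S S' \<longleftrightarrow>
     (\<forall>f\<in>L2_on \<Omega>. \<forall>p F. (p, F) \<in> S f \<longleftrightarrow> (\<exists>ps. ((p, ps), F) \<in> S' f))"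

end

theory Submission
  imports Defs
begin

text \<open>
  Write \<open>N\<close> for the matrix with rows \<open>n\<^bsub>K,\<sigma>\<^esub>\<close> and \<open>R\<close> for the matrix with rows \<open>|\<sigma>| (x\<^sub>\<sigma> - x\<^sub>K)\<close>.  The
  divergence theorem on the cell, applied to affine functions, gives \<open>R\<^sup>T N = |K| I\<close>.  On every cell
  each of the three methods is of the form \<open>M F = (|\<sigma>| (p\<^sub>K - p\<^sub>\<sigma>))\<^sub>\<sigma>\<close>, where the matrix \<open>M\<close> ranges over
  the symmetric positive definite matrices with \<open>M N \<Lambda> = R\<close>.  In the Mixed method every such \<open>M\<close> is
  obtained from the parameter \<open>B = M\<close>, because \<open>P = I - N R\<^sup>T / |K|\<close> satisfies
  \<open>M = R \<Lambda>\<^sup>-\<^sup>1 R\<^sup>T / |K| + P\<^sup>T M P\<close>.  The Hybrid method is the Mixed method for \<open>M\<^sup>-\<^sup>1\<close>, with \<open>N\<close> and \<open>R\<close>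
  exchanged and \<open>\<Lambda>\<close> inverted, and the Mimetic method factorizes \<open>P\<^sup>T M P\<close> through the kernel of \<open>N\<^sup>T\<close>.
  The face values of the Mimetic method are the multipliers of the flux continuity constraint.

  Since the cells need not be convex, the divergence theorem is proved by ray casting: along almost
  every line in a direction transversal to all faces, the indicator function of the cell jumps by
  \<open>sgn (n \<bullet> e)\<close> at each crossing of a face.  Integrating the difference of two translates of the
  indicator function against affine functions gives the identity for generic directions \<open>e\<close>, hence
  for all of them.
\<close>

section \<open>Linear images of Lebesgue measure\<close>

text \<open>By \<open>R^T N = |K| I\<close> the local flux space is the direct sum of the image of
  \<open>N\<close> and the kernel of \<open>R^T\<close>. The relation
  \<open>M N \<Lambda> = R\<close> expresses exactness for affine pressures: it fixes
  \<open>M\<close> on the first summand and makes the two summands \<open>M\<close>-orthogonal. Only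
  a positive definite block on the kernel of \<open>R^T\<close> stays free, and the parameters of
  the three methods are three descriptions of this block. The points \<open>x K\<close> enter
  through \<open>R\<close> and are kept in every conversion; \<open>f\<close> enters only through
  its cell integrals, so the comparison can be made cell by cell. Ray casting yields volumes,
  whereas the identity to be proved contains face areas. The link is the union of all translates of
  a segment \<open>e\<close> centred on a face: it is a sheared copy of the normal slab that defines
  the surface measure, so its volume is \<open>|n \<bullet> e|\<close> times the area, and the sign
  of the crossing turns \<open>|n \<bullet> e|\<close> into \<open>n \<bullet> e\<close>. Hence the
  effect of shears on Lebesgue measure has to be known. As the test functions are affine,
  translation by a vector \<open>e\<close> of fixed length suffices and no difference quotient
  passes to a limit.\<close>

lemma reflection_invariant_measures_proportional:
  fixes \<mu> :: "'a::euclidean_space measure"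
  assumes sets: "sets \<mu> = sets borel" and sf: "sigma_finite_measure \<mu>"
    and inv: "\<And>y. distr \<mu> borel (\<lambda>z. y - z) = \<mu>"
    and A: "A \<in> sets borel" and B: "B \<in> sets borel"
  shows "emeasure \<mu> A * emeasure lborel B = emeasure \<mu> B * emeasure lborel A"
proof -
  interpret \<mu>: sigma_finite_measure \<mu> by fact
  interpret P: pair_sigma_finite lborel \<mu> ..
  note [measurable_cong] = sets
  note [measurable] = A B
  have inv_lborel: "distr lborel borel (\<lambda>y. y - x) = lborel" for x :: 'a
    proof -
    have "(\<lambda>y. y - x) = (+) (- x)" by auto
    then show ?thesis using lborel_distr_plus[of "-x"] by simp
  qed
  \<comment> \<open>Fubini: for fixed \<open>x\<close>, translation invariance of Lebesgue measure
    turns the integral over \<open>y\<close> into the measure of \<open>T\<close>.\<close>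
  have key: "(\<integral>\<^sup>+y. \<integral>\<^sup>+x. indicator S x * indicator T (y - x) \<partial>\<mu> \<partial>lborel)
      = emeasure \<mu> S * emeasure lborel T"
    if [measurable]: "S \<in> sets borel" "T \<in> sets borel" for S T
  proof -
    have "(\<integral>\<^sup>+y. \<integral>\<^sup>+x. indicator S x * indicator T (y - x) \<partial>\<mu> \<partial>lborel)
        = (\<integral>\<^sup>+x. \<integral>\<^sup>+y. indicator S x * indicator T (y - x) \<partial>lborel \<partial>\<mu>)"
      by (rule P.Fubini'[symmetric]) measurable
    also have "\<dots> = (\<integral>\<^sup>+x. indicator S x * (\<integral>\<^sup>+y. indicator T (y - x) \<partial>lborel) \<partial>\<mu>)"
      by (simp add: nn_integral_cmult)
    also have "\<dots> = (\<integral>\<^sup>+x. indicator S x * emeasure lborel T \<partial>\<mu>)"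
    proof -
      have "(\<integral>\<^sup>+y. indicator T (y - x) \<partial>lborel) = emeasure lborel T" for x
      proof -
        have "(\<integral>\<^sup>+y. indicator T (y - x) \<partial>lborel)
            = (\<integral>\<^sup>+y. indicator T y \<partial>(distr lborel borel (\<lambda>y. y - x)))"
          by (subst nn_integral_distr) auto
        then show ?thesis by (simp add: inv_lborel)
      qed
      then show ?thesis by simp
    qed
    finally show ?thesis by (simp add: nn_integral_multc sets)
  qed
  \<comment> \<open>The substitution of \<open>y - x\<close> for \<open>x\<close> preserves
    \<open>\<mu>\<close> and exchanges the two sets.\<close>
  have "(\<integral>\<^sup>+x. indicator A x * indicator B (y - x) \<partial>\<mu>)
      = (\<integral>\<^sup>+x. indicator B x * indicator A (y - x) \<partial>\<mu>)" for y
    by (subst inv[of y, symmetric], subst nn_integral_distr) (auto simp: mult.commute)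
  then show ?thesis using key[OF A B] key[OF B A] by simp
qed

text \<open>
  The theory of changes of variables in HOL-Analysis needs a wellorder on the index type; hence
  this direct treatment of linear maps.
\<close>

definition lin_modulus :: "('a::euclidean_space \<Rightarrow> 'a) \<Rightarrow> real" where
  "lin_modulus f = measure lborel (f -` ball 0 1) / measure lborel (ball (0::'a) 1)"

lemma unit_ball_lborel:
  "0 < measure lborel (ball (0::'a::euclidean_space) 1)"
  by (metis content_ball_pos zero_less_one)

text \<open>The image of Lebesgue measure under \<open>f\<close> is again invariant under every
  point reflection, hence proportional to Lebesgue measure. The unit ball, of finite positive
  measure, fixes the factor. The factor belongs to preimages, so it is the reciprocal of the usual
  modulus of the determinant.\<close>

lemma
  fixes f :: "'a::euclidean_space \<Rightarrow> 'a"
  assumes f: "linear f" "bij f"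
  shows lin_modulus: "\<And>A. A \<in> sets borel \<Longrightarrow>
      emeasure lborel (f -` A) = ennreal (lin_modulus f) * emeasure lborel A"
    and lin_modulus_pos: "0 < lin_modulus f"
proof -
  let ?B = "ball (0::'a) 1"
  obtain g where g: "linear g" "g \<circ> f = id" "f \<circ> g = id"
    using f by (metis bij_def linear_injective_isomorphism inj_iff linear_inj_imp_surj o_def linear_injective_left_inverse linear_inverse_left)
  have gf: "g (f x) = x" "f (g x) = x" for x using g by (metis comp_apply id_apply)+
  have vim: "f -` A = g ` A" for A using gf by (metis vimage_eq image_iff subsetI subset_antisym)
  have cont: "continuous_on UNIV f" "continuous_on UNIV g"
    using f g by (auto simp: linear_continuous_on linear_conv_bounded_linear)
  have [measurable]: "f \<in> borel_measurable borel" by (simp add: cont borel_measurable_continuous_onI)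
  have fin: "emeasure lborel (f -` S) < \<infinity>" if "bounded S" for S
    unfolding vim using that g by (intro emeasure_bounded_finite bounded_linear_image) (auto simp: linear_conv_bounded_linear)
  define \<mu> where "\<mu> = distr lborel borel f"
  have em: "emeasure \<mu> S = emeasure lborel (f -` S)" if "S \<in> sets borel" for S
    using that by (simp add: \<mu>_def emeasure_distr)
  have cross: "emeasure \<mu> S * emeasure lborel T = emeasure \<mu> T * emeasure lborel S"
    if "S \<in> sets borel" "T \<in> sets borel" for S T
  proof (rule reflection_invariant_measures_proportional)
    show "sets \<mu> = sets borel" by (simp add: \<mu>_def)
    show "sigma_finite_measure \<mu>"
    proof
      show "\<exists>A. countable A \<and> A \<subseteq> sets \<mu> \<and> \<Union> A = space \<mu> \<and> (\<forall>a\<in>A. emeasure \<mu> a \<noteq> \<infinity>)"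
      proof (intro exI[of _ "range (\<lambda>k::nat. ball 0 (real k))"] conjI ballI)
        show "\<Union> (range (\<lambda>k::nat. ball 0 (real k))) = space \<mu>"
          using reals_Archimedean2 by (fastforce simp: \<mu>_def)
        fix a assume "a \<in> range (\<lambda>k::nat. ball (0::'a) (real k))"
        then show "emeasure \<mu> a \<noteq> \<infinity>" using fin[of a] by (auto simp: em)
      qed (auto simp: \<mu>_def)
    qed
    show "distr \<mu> borel (\<lambda>z. y - z) = \<mu>" for y
    proof -
      have "distr \<mu> borel (\<lambda>z. y - z) = distr lborel borel (\<lambda>x. y - f x)"
        by (simp add: \<mu>_def distr_distr o_def)
      \<comment> \<open>Linearity moves the reflection to the source side of \<open>f\<close>, where
        it preserves Lebesgue measure.\<close>
      also have "(\<lambda>x. y - f x) = f \<circ> (\<lambda>x. g y - x)"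
        by (auto simp: linear_diff[OF f(1)] gf)
      also have "distr lborel borel \<dots> = distr (distr lborel borel (\<lambda>x. g y - x)) borel f"
        by (simp add: distr_distr)
      also have "distr lborel borel (\<lambda>x. g y - x) = lborel"
      proof -
        have "lborel = density (distr lborel borel (\<lambda>x. g y + (-1) *\<^sub>R x)) (\<lambda>_. ennreal (\<bar>-1\<bar>^DIM('a)))"
          by (rule lborel_affine) simp
        then show ?thesis by (simp add: density_1)
      qed
      finally show ?thesis by (simp add: \<mu>_def)
    qed
  qed fact+
  have B: "emeasure lborel ?B = ennreal (measure lborel ?B)"
    by (rule emeasure_eq_ennreal_measure) (metis emeasure_lborel_ball_finite less_irrefl infinity_ennreal_def)
  have fB: "emeasure lborel (f -` ?B) = ennreal (measure lborel (f -` ?B))"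
    using fin[of ?B] by (simp add: emeasure_eq_ennreal_measure)
  have b0: "0 < measure lborel ?B" by (rule unit_ball_lborel)
  show "emeasure lborel (f -` A) = ennreal (lin_modulus f) * emeasure lborel A"
    if A: "A \<in> sets borel" for A
  proof -
    have m: "emeasure lborel (f -` A) * ennreal (measure lborel ?B)
        = ennreal (measure lborel (f -` ?B)) * emeasure lborel A"
      using cross[OF A, of ?B] A by (simp add: em B fB)
    have i: "ennreal (measure lborel ?B) * ennreal (1 / measure lborel ?B) = 1"
      using b0 by (simp add: ennreal_mult'[symmetric])
    have c: "ennreal (lin_modulus f) = ennreal (measure lborel (f -` ?B)) * ennreal (1 / measure lborel ?B)"
      by (simp add: lin_modulus_def ennreal_mult'[symmetric])
    have "emeasure lborel (f -` A) = emeasure lborel (f -` A) * ennreal (measure lborel ?B) * ennreal (1 / measure lborel ?B)"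
      by (simp add: i mult.assoc)
    also have "\<dots> = ennreal (measure lborel (f -` ?B)) * emeasure lborel A * ennreal (1 / measure lborel ?B)"
      by (simp add: m)
    finally show ?thesis by (simp add: c ac_simps)
  qed
  have fBo: "open (f -` ?B)" using cont by (simp add: open_vimage)
  have "0 \<in> f -` ?B" using f by (simp add: linear_0)
  then have "\<not> negligible (f -` ?B)" using open_not_negligible[OF fBo] by blast
  then have "f -` ?B \<notin> null_sets lborel"
    using null_sets_completionI negligible_iff_null_sets by blast
  then have "emeasure lborel (f -` ?B) \<noteq> 0" using fBo by (auto simp: null_sets_def)
  then have "measure lborel (f -` ?B) \<noteq> 0" using fB by auto
  then show "0 < lin_modulus f" using b0 by (simp add: lin_modulus_def zero_less_measure_iff)
qed

lemma lin_modulus_comp: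
  fixes f g :: "'a::euclidean_space \<Rightarrow> 'a"
  assumes f: "linear f" "bij f" and g: "linear g" "bij g"
  shows "lin_modulus (f \<circ> g) = lin_modulus f * lin_modulus g"
proof -
  let ?B = "ball (0::'a) 1"
  have [measurable]: "f \<in> borel_measurable borel"
    using f by (simp add: linear_continuous_on linear_conv_bounded_linear borel_measurable_continuous_onI)
  have fB: "f -` ?B \<in> sets borel" using measurable_sets[of f borel borel ?B] by simp
  have "emeasure lborel ((f \<circ> g) -` ?B) = emeasure lborel (g -` (f -` ?B))"
    by (simp add: vimage_comp)
  then have "emeasure lborel ((f \<circ> g) -` ?B)
    = ennreal (lin_modulus g) * (ennreal (lin_modulus f) * emeasure lborel ?B)"
    using fB by (simp add: lin_modulus f g)
  then have "measure lborel ((f \<circ> g) -` ?B) = lin_modulus g * lin_modulus f * measure lborel ?B"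
    using lin_modulus_pos[OF f] lin_modulus_pos[OF g] by (simp add: measure_def enn2real_mult)
  then show ?thesis using unit_ball_lborel[where 'a='a] by (simp add: lin_modulus_def)
qed

lemma lin_modulus_orthogonal:
  assumes "orthogonal_transformation f"
  shows "lin_modulus f = 1"
proof -
  have "f -` ball 0 1 = ball 0 1"
    using assms by (auto simp: orthogonal_transformation_norm)
  then show ?thesis using unit_ball_lborel[where 'a='a] by (simp add: lin_modulus_def)
qed

text \<open>For a unit vector \<open>n\<close> this is the linear map that fixes the hyperplane
  orthogonal to \<open>n\<close> pointwise and sends \<open>n\<close> to \<open>e\<close>; its
  determinant is \<open>n \<bullet> e\<close>.\<close>

definition shear :: "'a::euclidean_space \<Rightarrow> 'a \<Rightarrow> 'a \<Rightarrow> 'a" where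
  "shear n e x = x + (n \<bullet> x) *\<^sub>R (e - n)"

lemma linear_shear: "linear (shear n e)"
  by (auto intro!: linearI simp: shear_def algebra_simps)

lemma bij_shear:
  assumes n: "norm n = 1" and e: "n \<bullet> e \<noteq> 0"
  shows "bij (shear n e)"
proof -
  have nn: "n \<bullet> n = 1" using n by (simp add: norm_eq_1)
  have "inj (shear n e)"
  proof (rule linear_injective_0[OF linear_shear, THEN iffD2], intro allI impI)
    fix x assume x: "shear n e x = 0"
    then have "n \<bullet> shear n e x = 0" by simp
    then have "(n \<bullet> x) * (n \<bullet> e) = 0" by (simp add: shear_def inner_simps nn algebra_simps)
    with e x show "x = 0" by (simp add: shear_def)
  qed
  then show ?thesis by (simp add: bij_def linear_injective_imp_surjective linear_shear)
qed

lemma orthogonal_transformation_reflection: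
  assumes n: "norm n = 1"
  shows "orthogonal_transformation (shear n (-n))"
  using n by (auto simp: orthogonal_transformation_def linear_shear shear_def inner_simps norm_eq_1 algebra_simps inner_commute)

text \<open>The reflection in the hyperplane normal to \<open>n\<close> conjugates the shear to its inverse.\<close>

lemma lin_modulus_shear_1:
  fixes n u :: "'a::euclidean_space"
  assumes n: "norm n = 1" and u: "n \<bullet> u = 1"
  shows "lin_modulus (shear n u) = 1"
proof -
  have nn: "n \<bullet> n = 1" using n by (simp add: norm_eq_1)
  let ?r = "shear n (-n)" and ?t = "shear n u"
  have r: "linear ?r" "bij ?r" "lin_modulus ?r = 1"
    using orthogonal_transformation_reflection[OF n]
    by (auto simp: lin_modulus_orthogonal orthogonal_transformation_bij linear_shear)
  have t: "linear ?t" "bij ?t" using u n by (auto simp: linear_shear bij_shear)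
  have "(?t \<circ> ?r) \<circ> (?t \<circ> ?r) = id"
    using u by (auto simp: fun_eq_iff shear_def inner_simps nn algebra_simps)
  then have "lin_modulus ((?t \<circ> ?r) \<circ> (?t \<circ> ?r)) = 1"
    using lin_modulus_orthogonal[OF orthogonal_transformation_id[where 'a='a]] by (simp add: id_def)
  moreover have tr: "linear (?t \<circ> ?r)" "bij (?t \<circ> ?r)" using t r by (auto simp: linear_compose bij_comp)
  ultimately have "(lin_modulus ?t)\<^sup>2 = 1"
    using t r by (simp add: lin_modulus_comp power2_eq_square)
  then show ?thesis using lin_modulus_pos[OF t] by (simp add: power2_eq_1_iff)
qed

text \<open>The map is the stretching of \<open>n\<close> by the factor
  \<open>n \<bullet> e\<close>, followed by the shear towards \<open>e / (n \<bullet> e)\<close>,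
  which has modulus 1. A rotation carries the stretching to a coordinate axis, where the diagonal
  change of variables applies.\<close>

lemma lin_modulus_shear:
  fixes n e :: "real^'n"
  assumes n: "norm n = 1" and e: "n \<bullet> e \<noteq> 0"
  shows "lin_modulus (shear n e) = 1 / \<bar>n \<bullet> e\<bar>"
proof -
  have nn: "n \<bullet> n = 1" using n by (simp add: norm_eq_1)
  let ?a = "n \<bullet> e"
  have axis: "lin_modulus (shear n (\<alpha> *\<^sub>R n)) = 1 / \<bar>\<alpha>\<bar>" if \<alpha>: "\<alpha> \<noteq> 0" for \<alpha>
  proof -
    obtain b :: "real^'n" where b: "b \<in> Basis" by (metis SOME_Basis)
    obtain Q where Q: "orthogonal_transformation Q" "Q b = n"
      using orthogonal_transformation_exists_1[of b n] b n by auto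
    have Qb: "linear Q" "bij Q" using Q by (auto simp: orthogonal_transformation_bij orthogonal_transformation_linear)
    let ?D = "shear b (\<alpha> *\<^sub>R b)"
    have D: "linear ?D" "bij ?D" using b \<alpha> by (auto simp: linear_shear bij_shear)
    have S: "linear (shear n (\<alpha> *\<^sub>R n))" "bij (shear n (\<alpha> *\<^sub>R n))"
      using n nn \<alpha> by (auto simp: linear_shear bij_shear)
    have "shear n (\<alpha> *\<^sub>R n) \<circ> Q = Q \<circ> ?D"
    proof
      fix x
      have "n \<bullet> Q x = b \<bullet> x" using Q by (metis orthogonal_transformation_def)
      then show "(shear n (\<alpha> *\<^sub>R n) \<circ> Q) x = (Q \<circ> ?D) x"
        using Q Qb by (simp add: shear_def linear_add linear_cmul linear_diff)
    qed
    then have eq: "lin_modulus (shear n (\<alpha> *\<^sub>R n)) = lin_modulus ?D"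
      using lin_modulus_comp[OF S Qb] lin_modulus_comp[OF Qb D] Q by (simp add: lin_modulus_orthogonal)
    let ?c = "\<lambda>j. if j = b then \<alpha> else 1"
    let ?B = "ball (0::real^'n) 1"
    have Dx: "?D x = 0 + (\<Sum>j\<in>Basis. (?c j * (x \<bullet> j)) *\<^sub>R j)" for x
    proof (rule euclidean_eqI)
      fix i :: "real^'n" assume i: "i \<in> Basis"
      then show "?D x \<bullet> i = (0 + (\<Sum>j\<in>Basis. (?c j * (x \<bullet> j)) *\<^sub>R j)) \<bullet> i"
        using b inner_sum_left_Basis[OF i, of "\<lambda>j. ?c j * (x \<bullet> j)"]
        by (auto simp: shear_def inner_add_left inner_diff_left inner_Basis algebra_simps inner_commute[of b])
    qed
    have "lborel = density (distr lborel borel ?D) (\<lambda>_. \<Prod>j\<in>Basis. \<bar>?c j\<bar>)"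
      unfolding Dx[abs_def] by (rule lborel_affine_euclidean) (use \<alpha> in auto)
    moreover have "(\<Prod>j\<in>Basis. \<bar>?c j\<bar>) = \<bar>\<alpha>\<bar>"
      using b by (simp add: if_distrib[of abs] prod.delta cong: if_cong)
    ultimately have lb: "lborel = density (distr lborel borel ?D) (\<lambda>_. \<bar>\<alpha>\<bar>)" by simp
    have [measurable]: "?D \<in> borel_measurable borel"
      using D by (simp add: linear_continuous_on linear_conv_bounded_linear borel_measurable_continuous_onI)
    have "emeasure lborel ?B = \<bar>\<alpha>\<bar> * emeasure lborel (?D -` ?B)"
      by (subst lb, subst emeasure_density) (auto simp: nn_integral_cmult_indicator emeasure_distr)
    then have "measure lborel ?B = \<bar>\<alpha>\<bar> * measure lborel (?D -` ?B)"
      by (simp add: measure_def enn2real_mult)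
    then show ?thesis unfolding eq
      using \<alpha> unit_ball_lborel[where 'a="real^'n"]
      by (cases "measure lborel (?D -` ?B) = 0") (simp_all add: lin_modulus_def)
  qed
  let ?s = "shear n (?a *\<^sub>R n)" and ?t = "shear n (e /\<^sub>R ?a)"
  have "shear n e = ?t \<circ> ?s"
    using e by (auto simp: fun_eq_iff shear_def inner_simps nn algebra_simps)
  moreover have "linear ?s" "bij ?s" "linear ?t" "bij ?t" using n e nn by (auto simp: linear_shear bij_shear)
  ultimately show ?thesis
    using e lin_modulus_shear_1[OF n, of "e /\<^sub>R ?a"] axis[OF e] by (simp add: lin_modulus_comp)
qed

lemma distr_lborel_shear:
  fixes n e d :: "real^'n"
  assumes n: "norm n = 1" and e: "n \<bullet> e \<noteq> 0"
  shows "distr lborel borel (\<lambda>x. d + shear n e x) = density lborel (\<lambda>_. ennreal (1 / \<bar>n \<bullet> e\<bar>))"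
proof (rule measure_eqI)
  have [measurable]: "shear n e \<in> borel_measurable borel"
    by (simp add: linear_continuous_on linear_shear linear_conv_bounded_linear[symmetric] borel_measurable_continuous_onI)
  fix A assume "A \<in> sets (distr lborel borel (\<lambda>x. d + shear n e x))"
  then have A[measurable]: "A \<in> sets borel" by simp
  have "(+) d -` A \<in> sets borel" using measurable_sets[of "(+) d" borel borel A] by simp
  then have "emeasure lborel (shear n e -` ((+) d -` A)) = ennreal (1 / \<bar>n \<bullet> e\<bar>) * emeasure lborel ((+) d -` A)"
    using lin_modulus[OF linear_shear bij_shear[OF n e]] lin_modulus_shear[OF n e] by simp
  also have "emeasure lborel ((+) d -` A) = emeasure (distr lborel borel ((+) d)) A"
    by (simp add: emeasure_distr)
  finally show "emeasure (distr lborel borel (\<lambda>x. d + shear n e x)) A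
      = emeasure (density lborel (\<lambda>_. ennreal (1 / \<bar>n \<bullet> e\<bar>))) A"
    by (simp add: emeasure_distr emeasure_density nn_integral_cmult lborel_distr_plus vimage_def)
qed simp

section \<open>Slabs over subsets of a hyperplane\<close>

text \<open>For \<open>A\<close> in the hyperplane \<open>n \<bullet> x = c\<close> and
  \<open>n \<bullet> e \<noteq> 0\<close>, this is the union of the translates of the segment from
  \<open>-e/2\<close> to \<open>e/2\<close> centred at the points of \<open>A\<close>. The
  description by the projection along \<open>e\<close>, without a quantifier over the segment, makes
  it visibly a Borel set.\<close>

definition slab :: "'a::euclidean_space \<Rightarrow> real \<Rightarrow> 'a \<Rightarrow> 'a set \<Rightarrow> 'a set" where
  "slab n c e A = {x. \<bar>n \<bullet> x - c\<bar> \<le> \<bar>n \<bullet> e\<bar> / 2 \<and> x - ((n \<bullet> x - c) / (n \<bullet> e)) *\<^sub>R e \<in> A}"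

lemma slab_borel [measurable]:
  assumes [measurable]: "A \<in> sets borel"
  shows "slab n c e A \<in> sets borel"
  unfolding slab_def by measurable

lemma mem_slab_iff:
  assumes "n \<bullet> e \<noteq> 0" and A: "A \<subseteq> {x. n \<bullet> x = c}"
  shows "x \<in> slab n c e A \<longleftrightarrow> (\<exists>s. \<bar>s\<bar> \<le> 1/2 \<and> x + s *\<^sub>R e \<in> A)"
proof
  assume x: "x \<in> slab n c e A"
  let ?s = "- ((n \<bullet> x - c) / (n \<bullet> e))"
  have "\<bar>?s\<bar> \<le> 1/2" using x assms(1) by (simp add: slab_def abs_divide divide_le_eq)
  moreover have "x + ?s *\<^sub>R e \<in> A" using x by (simp add: slab_def)
  ultimately show "\<exists>s. \<bar>s\<bar> \<le> 1/2 \<and> x + s *\<^sub>R e \<in> A" by blast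
next
  assume "\<exists>s. \<bar>s\<bar> \<le> 1/2 \<and> x + s *\<^sub>R e \<in> A"
  then obtain s where s: "\<bar>s\<bar> \<le> 1/2" "x + s *\<^sub>R e \<in> A" by blast
  then have "n \<bullet> (x + s *\<^sub>R e) = c" using A by auto
  then have d: "n \<bullet> x - c = - s * (n \<bullet> e)" by (simp add: inner_add_right)
  have "\<bar>s\<bar> * \<bar>n \<bullet> e\<bar> \<le> 1/2 * \<bar>n \<bullet> e\<bar>" using s by (intro mult_right_mono) auto
  with s assms(1) show "x \<in> slab n c e A" by (simp add: slab_def d abs_mult)
qed

lemma bounded_slab:
  assumes "bounded A" and e: "n \<bullet> e \<noteq> 0"
  shows "bounded (slab n c e A)"
proof -
  obtain R where R: "\<And>x. x \<in> A \<Longrightarrow> norm x \<le> R" using assms by (auto simp: bounded_iff)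
  have "norm x \<le> R + norm e / 2" if x: "x \<in> slab n c e A" for x
  proof -
    let ?s = "(n \<bullet> x - c) / (n \<bullet> e)"
    have "\<bar>?s\<bar> \<le> 1/2" using x e by (simp add: slab_def abs_divide divide_le_eq)
    then have "norm (?s *\<^sub>R e) \<le> norm e / 2"
      using mult_right_mono[of "\<bar>?s\<bar>" "1/2" "norm e"] by simp
    moreover have "norm (x - ?s *\<^sub>R e) \<le> R" using x R by (simp add: slab_def)
    moreover have "norm x \<le> norm (x - ?s *\<^sub>R e) + norm (?s *\<^sub>R e)"
      by (metis diff_add_cancel norm_triangle_ineq)
    ultimately show ?thesis by linarith
  qed
  then show ?thesis by (auto simp: bounded_iff)
qed

lemma integrable_continuous_bounded:
  fixes f :: "'a::euclidean_space \<Rightarrow> 'b::{banach,second_countable_topology}"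
  assumes S: "S \<in> sets borel" "bounded S" and f: "continuous_on UNIV f"
  shows "integrable lborel (\<lambda>x. indicator S x *\<^sub>R f x)"
proof -
  obtain R where "S \<subseteq> cball 0 R" using S by (metis bounded_iff mem_cball_0 subsetI)
  then have eq: "(\<lambda>x. indicator S x *\<^sub>R f x) = (\<lambda>x. indicator S x *\<^sub>R (indicator (cball 0 R) x *\<^sub>R f x))"
    by (auto simp: indicator_def fun_eq_iff)
  have "integrable lborel (\<lambda>x. indicator (cball 0 R) x *\<^sub>R f x)"
    by (rule borel_integrable_compact) (auto intro: continuous_on_subset[OF f])
  then show ?thesis using S by (subst eq) (rule integrable_mult_indicator, auto)
qed

context
  fixes n e :: "real^'n" and c :: real
  assumes n: "norm n = 1" and e: "n \<bullet> e \<noteq> 0"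
begin

text \<open>The translation by \<open>- c *\<^sub>R (e - n)\<close> makes the shear fix the
  hyperplane \<open>n \<bullet> x = c\<close> instead of the parallel one through the origin. The
  base \<open>A\<close> therefore stays in place while the normal segments are tilted to the
  direction \<open>e\<close>.\<close>

lemma mem_slab_shear:
  "- c *\<^sub>R (e - n) + shear n e x \<in> slab n c e A \<longleftrightarrow> x \<in> slab n c n A"
proof -
  have nn: "n \<bullet> n = 1" using n by (simp add: norm_eq_1)
  let ?y = "- c *\<^sub>R (e - n) + shear n e x"
  have y: "?y = x + (n \<bullet> x - c) *\<^sub>R (e - n)"
    by (simp add: shear_def scaleR_diff_left scaleR_diff_right)
  have d: "n \<bullet> ?y - c = (n \<bullet> x - c) * (n \<bullet> e)"
    unfolding y by (simp add: inner_add_right inner_diff_right nn right_diff_distrib)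
  have "?y - (n \<bullet> x - c) *\<^sub>R e = x - (n \<bullet> x - c) *\<^sub>R n"
    unfolding y by (simp add: scaleR_diff_right)
  moreover have "\<bar>n \<bullet> x - c\<bar> * \<bar>n \<bullet> e\<bar> \<le> \<bar>n \<bullet> e\<bar> / 2 \<longleftrightarrow> \<bar>n \<bullet> x - c\<bar> \<le> 1 / 2"
    using e by (auto simp: field_simps)
  moreover have "?y \<in> slab n c e A \<longleftrightarrow>
      \<bar>n \<bullet> ?y - c\<bar> \<le> \<bar>n \<bullet> e\<bar> / 2 \<and> ?y - ((n \<bullet> ?y - c) / (n \<bullet> e)) *\<^sub>R e \<in> A"
    by (simp only: slab_def mem_Collect_eq)
  moreover have "(n \<bullet> ?y - c) / (n \<bullet> e) = n \<bullet> x - c" using e by (simp only: d) simp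
  ultimately show ?thesis by (simp only: d abs_mult) (simp add: slab_def nn)
qed

lemma shear_measurable [measurable]: "shear n e \<in> borel_measurable borel"
  by (simp add: linear_continuous_on linear_shear linear_conv_bounded_linear[symmetric] borel_measurable_continuous_onI)

text \<open>Change of variables by the translated shear, which displaces a point by its signed
  height \<open>n \<bullet> x - c\<close> times \<open>e - n\<close>; the factor
  \<open>|n \<bullet> e|\<close> is the inverse of the density of the image measure.\<close>

lemma integral_slab:
  fixes f :: "real^'n \<Rightarrow> 'b::{banach,second_countable_topology}"
  assumes A[measurable]: "A \<in> sets borel" and f[measurable]: "f \<in> borel_measurable borel"
  shows "(\<integral>x. indicator (slab n c e A) x *\<^sub>R f x \<partial>lborel) =
    \<bar>n \<bullet> e\<bar> *\<^sub>R (\<integral>x. indicator (slab n c n A) x *\<^sub>R f (x + (n \<bullet> x - c) *\<^sub>R (e - n)) \<partial>lborel)"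
proof -
  let ?T = "\<lambda>x. - c *\<^sub>R (e - n) + shear n e x"
  let ?g = "\<lambda>x. indicator (slab n c e A) x *\<^sub>R f x"
  have T: "?T x = x + (n \<bullet> x - c) *\<^sub>R (e - n)" for x
    by (simp add: shear_def scaleR_diff_left scaleR_diff_right)
  have "(\<integral>x. ?g (?T x) \<partial>lborel) = (\<integral>x. ?g x \<partial>distr lborel borel ?T)"
    by (subst integral_distr) auto
  also have "\<dots> = (1 / \<bar>n \<bullet> e\<bar>) *\<^sub>R (\<integral>x. ?g x \<partial>lborel)"
  proof -
    have "(\<integral>x. ?g x \<partial>distr lborel borel ?T) = (\<integral>x. (1 / \<bar>n \<bullet> e\<bar>) *\<^sub>R ?g x \<partial>lborel)"
      unfolding distr_lborel_shear[OF n e] by (subst integral_density) auto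
    then show ?thesis by (simp only: integral_scaleR_right)
  qed
  finally have "(\<integral>x. ?g x \<partial>lborel) = \<bar>n \<bullet> e\<bar> *\<^sub>R (\<integral>x. ?g (?T x) \<partial>lborel)"
    using e by simp
  moreover have "?g (?T x) = indicator (slab n c n A) x *\<^sub>R f (x + (n \<bullet> x - c) *\<^sub>R (e - n))" for x
    using mem_slab_shear[of x A] by (simp only: indicator_def T)
  ultimately show ?thesis by simp
qed

lemma emeasure_slab:
  assumes A[measurable]: "A \<in> sets borel"
  shows "emeasure lborel (slab n c n A) = ennreal (1 / \<bar>n \<bullet> e\<bar>) * emeasure lborel (slab n c e A)"
proof -
  let ?T = "\<lambda>x. - c *\<^sub>R (e - n) + shear n e x"
  have "slab n c n A = ?T -` slab n c e A"
    using mem_slab_shear[of _ A] by auto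
  then have "emeasure lborel (slab n c n A) = emeasure (distr lborel borel ?T) (slab n c e A)"
    by (simp add: emeasure_distr)
  then show ?thesis
    unfolding distr_lborel_shear[OF n e] by (simp add: emeasure_density nn_integral_cmult)
qed

end

section \<open>The surface measure of a hyperplane and oblique slabs\<close>

context
  fixes n :: "real^'n" and c :: real
  assumes n: "norm n = 1"
begin

lemma closest_point_hyperplane:
  "closest_point {x. n \<bullet> x = c} x = x - (n \<bullet> x - c) *\<^sub>R n"
proof (rule closest_point_unique[symmetric])
  have nn: "n \<bullet> n = 1" using n by (simp add: norm_eq_1)
  show "convex {x. n \<bullet> x = c}" "closed {x. n \<bullet> x = c}"
    by (auto simp: convex_hyperplane closed_hyperplane)
  show "x - (n \<bullet> x - c) *\<^sub>R n \<in> {x. n \<bullet> x = c}" by (simp add: inner_diff_right nn)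
  show "\<forall>z\<in>{x. n \<bullet> x = c}. dist x (x - (n \<bullet> x - c) *\<^sub>R n) \<le> dist x z"
  proof
    fix z assume "z \<in> {x. n \<bullet> x = c}"
    then have "n \<bullet> x - c = n \<bullet> (x - z)" by (simp add: inner_diff_right)
    also have "\<bar>\<dots>\<bar> \<le> dist x z"
      using Cauchy_Schwarz_ineq2[of n "x - z"] n by (simp add: dist_norm)
    finally show "dist x (x - (n \<bullet> x - c) *\<^sub>R n) \<le> dist x z" using n by (simp add: dist_norm)
  qed
qed

lemma infdist_hyperplane: "infdist x {x. n \<bullet> x = c} = \<bar>n \<bullet> x - c\<bar>"
proof -
  have ne: "{x. n \<bullet> x = c} \<noteq> {}"
    using n by (auto simp: norm_eq_1 intro!: exI[of _ "c *\<^sub>R n"])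
  have "infdist x {x. n \<bullet> x = c} = setdist {x} {x. n \<bullet> x = c}"
    by (simp add: infdist_eq_setdist)
  also have "\<dots> = dist x (closest_point {x. n \<bullet> x = c} x)"
    using ne by (simp add: setdist_closest_point closed_hyperplane)
  finally show ?thesis using n by (simp add: closest_point_hyperplane dist_norm)
qed

lemma hyperplane_measure_eq:
  "hyperplane_measure {x. n \<bullet> x = c} =
    distr (restrict_space lborel {x. \<bar>n \<bullet> x - c\<bar> \<le> 1/2}) borel (\<lambda>x. x - (n \<bullet> x - c) *\<^sub>R n)"
  by (simp add: hyperplane_measure_def infdist_hyperplane closest_point_hyperplane[abs_def])

lemma emeasure_hyperplane_measure:
  assumes [measurable]: "A \<in> sets borel"
  shows "emeasure (hyperplane_measure {x. n \<bullet> x = c}) A = emeasure lborel (slab n c n A)"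
proof -
  have nn: "n \<bullet> n = 1" using n by (simp add: norm_eq_1)
  let ?S = "{x. \<bar>n \<bullet> x - c\<bar> \<le> 1/2}"
  let ?P = "\<lambda>x. x - (n \<bullet> x - c) *\<^sub>R n"
  have [measurable]: "?S \<in> sets borel" by measurable
  have m: "?P \<in> borel_measurable (restrict_space lborel ?S)"
    by (intro measurable_restrict_space1) measurable
  have "?P -` A \<inter> ?S = slab n c n A" by (auto simp: slab_def nn)
  moreover have "slab n c n A \<subseteq> ?S" by (auto simp: slab_def nn)
  moreover have "?S \<inter> space lborel \<in> sets lborel" using \<open>?S \<in> sets borel\<close> by simp
  ultimately show ?thesis unfolding hyperplane_measure_eq
    by (subst emeasure_distr[OF m], simp) (simp only: space_restrict_space space_lborel space_borel Int_UNIV_right emeasure_restrict_space)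
qed

lemma hyperplane_moment:
  assumes A[measurable]: "A \<in> sets borel"
  shows "(LINT x:A|hyperplane_measure {x. n \<bullet> x = c}. x) =
     (\<integral>x. indicator (slab n c n A) x *\<^sub>R (x - (n \<bullet> x - c) *\<^sub>R n) \<partial>lborel)"
proof -
  have nn: "n \<bullet> n = 1" using n by (simp add: norm_eq_1)
  let ?S = "{x. \<bar>n \<bullet> x - c\<bar> \<le> 1/2}"
  let ?P = "\<lambda>x. x - (n \<bullet> x - c) *\<^sub>R n"
  have [measurable]: "?S \<in> sets borel" by measurable
  have m: "?P \<in> borel_measurable (restrict_space lborel ?S)"
    by (intro measurable_restrict_space1) measurable
  have "(LINT x:A|hyperplane_measure {x. n \<bullet> x = c}. x)
     = (\<integral>x. indicator A (?P x) *\<^sub>R ?P x \<partial>restrict_space lborel ?S)"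
    unfolding hyperplane_measure_eq set_lebesgue_integral_def using m
    by (subst integral_distr) auto
  also have "\<dots> = (\<integral>x. indicator ?S x *\<^sub>R (indicator A (?P x) *\<^sub>R ?P x) \<partial>lborel)"
    by (subst integral_restrict_space) auto
  also have "\<dots> = (\<integral>x. indicator (slab n c n A) x *\<^sub>R ?P x \<partial>lborel)"
    by (intro Bochner_Integration.integral_cong) (auto simp: slab_def nn indicator_def)
  finally show ?thesis .
qed

lemma measure_slab:
  assumes e: "n \<bullet> e \<noteq> 0" and A[measurable]: "A \<in> sets borel"
  shows "measure lborel (slab n c e A) = \<bar>n \<bullet> e\<bar> * measure (hyperplane_measure {x. n \<bullet> x = c}) A"
  using e by (simp add: measure_def emeasure_hyperplane_measure emeasure_slab[OF n e] enn2real_mult)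

text \<open>After the change of variables the integrand is the projection of the point to the
  hyperplane plus its height times \<open>e\<close>. The height is odd under reflection in the
  hyperplane, so only the surface moment survives.\<close>

lemma slab_moment:
  assumes e: "n \<bullet> e \<noteq> 0" and A[measurable]: "A \<in> sets borel" and bA: "bounded A"
  shows "(\<integral>x. indicator (slab n c e A) x *\<^sub>R x \<partial>lborel) =
    \<bar>n \<bullet> e\<bar> *\<^sub>R (LINT x:A|hyperplane_measure {x. n \<bullet> x = c}. x)"
proof -
  have nn: "n \<bullet> n = 1" using n by (simp add: norm_eq_1)
  let ?I = "\<lambda>x. indicator (slab n c n A) x :: real"
  have b: "bounded (slab n c n A)" using bA by (rule bounded_slab) (simp add: nn)
  \<comment> \<open>For the direction \<open>-n\<close>, \<open>integral_slab\<close> is the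
    reflection in the hyperplane; it maps the slab to itself and negates the height.\<close>
  have "slab n c (-n) A = slab n c n A"
  proof -
    have "x + (c - n \<bullet> x) *\<^sub>R n = x - (n \<bullet> x - c) *\<^sub>R n" for x by (simp add: scaleR_diff_left)
    then show ?thesis by (simp add: slab_def nn)
  qed
  moreover have "n \<bullet> (x + (n \<bullet> x - c) *\<^sub>R (- n - n)) - c = - (n \<bullet> x - c)" for x
    by (simp only: inner_add_right inner_scaleR_right inner_diff_right inner_minus_right nn) simp
  moreover have "(\<lambda>x. n \<bullet> x - c) \<in> borel_measurable borel" by measurable
  ultimately have "(\<integral>x. ?I x *\<^sub>R (n \<bullet> x - c) \<partial>lborel) = (\<integral>x. ?I x *\<^sub>R (- (n \<bullet> x - c)) \<partial>lborel)"
    using integral_slab[OF n, of "-n" A "\<lambda>x. n \<bullet> x - c" c]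
    by (simp only: inner_minus_right nn A) simp
  also have "\<dots> = - (\<integral>x. ?I x *\<^sub>R (n \<bullet> x - c) \<partial>lborel)"
    by (simp only: scaleR_minus_right Bochner_Integration.integral_minus)
  finally have z: "(\<integral>x. ?I x *\<^sub>R (n \<bullet> x - c) \<partial>lborel) = 0" by linarith
  have i1: "integrable lborel (\<lambda>x. ?I x *\<^sub>R (x - (n \<bullet> x - c) *\<^sub>R n))"
    by (rule integrable_continuous_bounded) (auto intro!: continuous_intros b)
  have i2: "integrable lborel (\<lambda>x. ?I x *\<^sub>R (n \<bullet> x - c))"
    by (rule integrable_continuous_bounded) (auto intro!: continuous_intros b)
  have "(\<integral>x. ?I x *\<^sub>R (x + (n \<bullet> x - c) *\<^sub>R (e - n)) \<partial>lborel)
    = (\<integral>x. ?I x *\<^sub>R (x - (n \<bullet> x - c) *\<^sub>R n) + (?I x *\<^sub>R (n \<bullet> x - c)) *\<^sub>R e \<partial>lborel)"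
    by (intro Bochner_Integration.integral_cong) (auto simp: scaleR_diff_right scaleR_add_right)
  also have "\<dots> = (\<integral>x. ?I x *\<^sub>R (x - (n \<bullet> x - c) *\<^sub>R n) \<partial>lborel) + (\<integral>x. (?I x *\<^sub>R (n \<bullet> x - c)) *\<^sub>R e \<partial>lborel)"
    using i1 i2 by (intro Bochner_Integration.integral_add) auto
  also have "(\<integral>x. (?I x *\<^sub>R (n \<bullet> x - c)) *\<^sub>R e \<partial>lborel) = 0"
    using i2 z by (subst integral_scaleR_left) auto
  finally show ?thesis by (simp add: integral_slab[OF n e] hyperplane_moment)
qed

text \<open>Rounding the parameter of the crossing point to the nearest integer leaves a remainder
  of at most 1/2, the reach of the slab. Countably many translates of the slab over \<open>N\<close>
  therefore cover these lines, and the shear relates that slab to the normal slab, which is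
  null.\<close>

lemma negligible_lines_through_null_set:
  assumes e: "n \<bullet> e \<noteq> 0" and N: "N \<in> null_sets (hyperplane_measure {x. n \<bullet> x = c})"
  shows "negligible {x. \<exists>s. x + s *\<^sub>R e \<in> N \<and> n \<bullet> (x + s *\<^sub>R e) = c}"
proof -
  let ?H = "{x. n \<bullet> x = c}"
  let ?N = "N \<inter> ?H"
  have [measurable]: "N \<in> sets borel" using N by (auto simp: null_sets_def hyperplane_measure_def)
  have [measurable]: "?H \<in> sets borel" by measurable
  have "emeasure lborel (slab n c n N) = 0"
    using N emeasure_hyperplane_measure[of N] by (auto simp: null_sets_def)
  then have "ennreal (1 / \<bar>n \<bullet> e\<bar>) * emeasure lborel (slab n c e N) = 0"
    using emeasure_slab[OF n e, of N c] by simp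
  then have "emeasure lborel (slab n c e N) = 0" using e by simp
  then have "slab n c e N \<in> null_sets lborel" by (simp add: null_sets_def)
  then have neg: "negligible (slab n c e N)"
    using null_sets_completionI negligible_iff_null_sets by blast
  have sub: "{x. \<exists>s. x + s *\<^sub>R e \<in> N \<and> n \<bullet> (x + s *\<^sub>R e) = c} \<subseteq> (\<Union>k::int. (+) (- of_int k *\<^sub>R e) ` slab n c e N)"
  proof
    fix x assume "x \<in> {x. \<exists>s. x + s *\<^sub>R e \<in> N \<and> n \<bullet> (x + s *\<^sub>R e) = c}"
    then obtain s where s: "x + s *\<^sub>R e \<in> N" "n \<bullet> (x + s *\<^sub>R e) = c" by blast
    let ?k = "round s"
    have "\<bar>s - of_int ?k\<bar> \<le> 1/2" using of_int_round_abs_le[of s] by (simp add: abs_minus_commute)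
    moreover have "(x + of_int ?k *\<^sub>R e) + (s - of_int ?k) *\<^sub>R e = x + s *\<^sub>R e"
      by (simp add: scaleR_diff_left)
    ultimately have "x + of_int ?k *\<^sub>R e \<in> slab n c e ?N"
      using s by (subst mem_slab_iff[OF e]) (auto intro!: exI[of _ "s - of_int ?k"] simp: add.assoc)
    then have "x + of_int ?k *\<^sub>R e \<in> slab n c e N" by (auto simp: slab_def)
    then have "x \<in> (+) (- of_int ?k *\<^sub>R e) ` slab n c e N"
      by (intro image_eqI[of _ _ "x + of_int ?k *\<^sub>R e"]) auto
    then show "x \<in> (\<Union>k::int. (+) (- of_int k *\<^sub>R e) ` slab n c e N)" by blast
  qed
  have "negligible ((+) v ` slab n c e N)" for v by (rule negligible_translation[OF neg])
  then have "negligible (\<Union>k::int. (+) (- of_int k *\<^sub>R e) ` slab n c e N)"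
    by (intro negligible_countable_Union; blast intro: countable_image)
  then show ?thesis using sub by (rule negligible_subset)
qed

end

text \<open>Adding one direction raises the dimension by at most one, so the lines stay in a
  translate of a proper subspace.\<close>

lemma negligible_lines_through_affine:
  fixes A :: "'a::euclidean_space set"
  assumes A: "affine A" and d: "aff_dim A < int DIM('a) - 1"
  shows "negligible {x. \<exists>s. x + s *\<^sub>R e \<in> A}"
proof (cases "A = {}")
  case False
  then obtain a where a: "a \<in> A" by blast
  let ?V = "(\<lambda>x. x - a) ` A"
  let ?W = "span (insert e ?V)"
  have "int (dim ?V) = aff_dim A"
    using aff_dim_eq_dim_subtract[of a A] a by (simp add: hull_inc)
  then have "dim (insert e ?V) < DIM('a)"
    using d dim_insert[of e ?V] by (simp split: if_splits)
  then have "negligible ?W" by (intro negligible_lowdim) simp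
  then have "negligible ((+) a ` ?W)" by (rule negligible_translation)
  moreover have "{x. \<exists>s. x + s *\<^sub>R e \<in> A} \<subseteq> (+) a ` ?W"
  proof clarify
    fix x s assume "x + s *\<^sub>R e \<in> A"
    then have "x + s *\<^sub>R e - a \<in> ?W" by (auto intro: span_base)
    moreover have "s *\<^sub>R e \<in> ?W" by (auto intro: span_base span_scale)
    ultimately have "(x + s *\<^sub>R e - a) - s *\<^sub>R e \<in> ?W" by (rule span_diff)
    then show "x \<in> (+) a ` ?W" by (intro image_eqI[of _ _ "x - a"]) (auto simp: algebra_simps)
  qed
  ultimately show ?thesis by (rule negligible_subset)
qed simp

section \<open>Crossings of the boundary along a line\<close>

lemma locally_constant_real_imp_eq:
  fixes g :: "real \<Rightarrow> real"
  assumes "\<And>s. \<forall>\<^sub>F t in nhds s. g t = g s"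
  shows "g a = g b"
proof -
  have "DERIV g s :> 0" for s
  proof -
    have "DERIV (\<lambda>_. g s) s :> 0" by simp
    then show ?thesis
      by (subst DERIV_cong_ev[OF refl assms refl])
  qed
  then show ?thesis using DERIV_isconst_all by blast
qed

text \<open>In a small ball around \<open>z\<close> the frontier of \<open>K\<close> is exactly the
  hyperplane of the face. Each open half ball is connected and avoids the frontier, so it lies
  inside or outside \<open>K\<close>; one point of the normal line on each side decides
  which.\<close>

lemma half_ball:
  fixes K :: "(real^'n) set"
  assumes K: "open K" and fr: "frontier K = (\<Union>\<tau>\<in>Es. closure \<tau>)" and fin: "finite Es"
    and \<sigma>: "\<sigma> \<in> Es" "openin (top_of_set {x. n \<bullet> x = c}) \<sigma>" and n: "norm n = 1"
    and z: "z \<in> \<sigma>" "\<And>\<tau>. \<tau> \<in> Es \<Longrightarrow> \<tau> \<noteq> \<sigma> \<Longrightarrow> z \<notin> closure \<tau>"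
    and nz: "\<exists>\<epsilon>>0. \<forall>t. 0 < t \<and> t < \<epsilon> \<longrightarrow> z - t *\<^sub>R n \<in> K \<and> z + t *\<^sub>R n \<notin> K"
  obtains \<delta> where "0 < \<delta>" "\<And>y. dist z y < \<delta> \<Longrightarrow> y \<in> K \<longleftrightarrow> n \<bullet> y < c"
proof -
  have nn: "n \<bullet> n = 1" using n by (simp add: norm_eq_1)
  have \<sigma>H: "\<sigma> \<subseteq> {x. n \<bullet> x = c}" using \<sigma>(2) by (rule openin_imp_subset)
  have nzc: "n \<bullet> z = c" using z(1) \<sigma>H by auto
  let ?C = "\<Union>\<tau>\<in>Es - {\<sigma>}. closure \<tau>"
  have "closed ?C" using fin by (intro closed_UN) auto
  moreover have "z \<notin> ?C" using z(2) by auto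
  ultimately obtain d1 where d1: "0 < d1" "ball z d1 \<inter> ?C = {}"
    by (metis closed_def open_contains_ball ComplI disjoint_eq_subset_Compl)
  obtain U where U: "open U" "\<sigma> = {x. n \<bullet> x = c} \<inter> U" using \<sigma>(2) by (auto simp: openin_open)
  then obtain d2 where d2: "0 < d2" "ball z d2 \<subseteq> U" using z(1) by (meson IntD2 open_contains_ball)
  obtain \<epsilon> where \<epsilon>: "0 < \<epsilon>" "\<And>t. 0 < t \<Longrightarrow> t < \<epsilon> \<Longrightarrow> z - t *\<^sub>R n \<in> K \<and> z + t *\<^sub>R n \<notin> K"
    using nz by blast
  define \<delta> where "\<delta> = min d1 d2"
  have \<delta>: "0 < \<delta>" using d1 d2 by (simp add: \<delta>_def)
  have clos: "closure \<sigma> \<subseteq> {x. n \<bullet> x = c}"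
    using \<sigma>H by (simp add: closure_minimal closed_hyperplane)
  have frd: "frontier K \<inter> ball z \<delta> = {x. n \<bullet> x = c} \<inter> ball z \<delta>"
  proof
    show "frontier K \<inter> ball z \<delta> \<subseteq> {x. n \<bullet> x = c} \<inter> ball z \<delta>"
    proof
      fix x assume x: "x \<in> frontier K \<inter> ball z \<delta>"
      then obtain \<tau> where \<tau>: "\<tau> \<in> Es" "x \<in> closure \<tau>" using fr by auto
      have "x \<in> ball z d1" using x by (simp add: \<delta>_def)
      then have "\<tau> = \<sigma>" using d1 \<tau> by auto
      then show "x \<in> {x. n \<bullet> x = c} \<inter> ball z \<delta>" using \<tau> x clos by auto
    qed
    show "{x. n \<bullet> x = c} \<inter> ball z \<delta> \<subseteq> frontier K \<inter> ball z \<delta>"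
    proof
      fix x assume x: "x \<in> {x. n \<bullet> x = c} \<inter> ball z \<delta>"
      then have "x \<in> \<sigma>" using U(2) d2 by (auto simp: \<delta>_def)
      then show "x \<in> frontier K \<inter> ball z \<delta>"
        using x \<sigma>(1) fr closure_subset[of \<sigma>] by blast
    qed
  qed
  define t where "t = min \<epsilon> \<delta> / 2"
  have t: "0 < t" "t < \<epsilon>" "t < \<delta>" using \<epsilon> \<delta> by (auto simp: t_def min_def)
  let ?L = "ball z \<delta> \<inter> {x. n \<bullet> x < c}" and ?R = "ball z \<delta> \<inter> {x. n \<bullet> x > c}"
  have cn: "connected ?L" "connected ?R"
    by (intro convex_connected convex_Int convex_ball convex_halfspace_lt convex_halfspace_gt)+
  have dj: "?L \<inter> frontier K = {}" "?R \<inter> frontier K = {}" using frd by auto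
  have "z - t *\<^sub>R n \<in> ?L \<inter> K" using t \<epsilon> n by (auto simp: inner_diff_right nzc nn dist_norm)
  then have L: "?L \<subseteq> K" using connected_Int_frontier[OF cn(1), of K] dj by blast
  have "z + t *\<^sub>R n \<in> ?R - K" using t \<epsilon> n by (auto simp: inner_add_right nzc nn dist_norm)
  then have R: "?R \<inter> K = {}" using connected_Int_frontier[OF cn(2), of K] dj by blast
  have "y \<in> K \<longleftrightarrow> n \<bullet> y < c" if "dist z y < \<delta>" for y
  proof -
    have "y \<notin> K" if "n \<bullet> y = c"
    proof -
      have "y \<in> {x. n \<bullet> x = c} \<inter> ball z \<delta>" using that \<open>dist z y < \<delta>\<close> by simp
      then have "y \<in> frontier K" unfolding frd[symmetric] by blast
      then show ?thesis using K by (simp add: frontier_def interior_open)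
    qed
    moreover have "y \<in> K" if "n \<bullet> y < c" using L that \<open>dist z y < \<delta>\<close> by (auto dest: subsetD)
    moreover have "y \<notin> K" if "n \<bullet> y > c" using R that \<open>dist z y < \<delta>\<close> by auto
    ultimately show ?thesis by (metis linorder_less_linear)
  qed
  with \<delta> show ?thesis by (rule that)
qed

text \<open>
  Adding the signed number of the crossings already passed makes the indicator function of the cell
  locally constant along the line.
\<close>

lemma indicator_difference_on_line:
  fixes K :: "(real^'n) set" and n :: "(real^'n) set \<Rightarrow> real^'n"
  assumes K: "open K" and fr: "frontier K = (\<Union>\<tau>\<in>Es. closure \<tau>)" and fin: "finite Es"
    and op: "\<And>\<sigma>. \<sigma> \<in> Es \<Longrightarrow> openin (top_of_set {x. n \<sigma> \<bullet> x = c \<sigma>}) \<sigma>"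
    and n: "\<And>\<sigma>. \<sigma> \<in> Es \<Longrightarrow> norm (n \<sigma>) = 1"
    and ne: "\<And>\<sigma>. \<sigma> \<in> Es \<Longrightarrow> n \<sigma> \<bullet> e \<noteq> 0"
    and dj: "pairwise disjnt Es"
    and cl: "\<And>s \<sigma>. \<sigma> \<in> Es \<Longrightarrow> x + s *\<^sub>R e \<in> closure \<sigma> \<Longrightarrow> x + s *\<^sub>R e \<in> \<sigma>"
    and nz: "\<And>s \<sigma>. \<sigma> \<in> Es \<Longrightarrow> x + s *\<^sub>R e \<in> \<sigma> \<Longrightarrow>
      \<exists>\<epsilon>>0. \<forall>t. 0 < t \<and> t < \<epsilon> \<longrightarrow> x + s *\<^sub>R e - t *\<^sub>R n \<sigma> \<in> K \<and> x + s *\<^sub>R e + t *\<^sub>R n \<sigma> \<notin> K"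
    and ends: "x + (-1/2) *\<^sub>R e \<notin> frontier K" "x + (1/2) *\<^sub>R e \<notin> frontier K"
  shows "indicator K (x + (-1/2) *\<^sub>R e) - indicator K (x + (1/2) *\<^sub>R e) =
    (\<Sum>\<sigma>\<in>Es. sgn (n \<sigma> \<bullet> e) * indicator (slab (n \<sigma>) (c \<sigma>) e \<sigma>) x)"
proof -
  define p where "p \<sigma> = (c \<sigma> - n \<sigma> \<bullet> x) / (n \<sigma> \<bullet> e)" for \<sigma>
  have on: "x + s *\<^sub>R e \<in> \<sigma> \<Longrightarrow> s = p \<sigma>" if "\<sigma> \<in> Es" for s \<sigma>
    using openin_imp_subset[OF op[OF that]] ne[OF that] by (auto simp: p_def inner_add_right field_simps)
  define hit where "hit \<sigma> \<longleftrightarrow> x + p \<sigma> *\<^sub>R e \<in> \<sigma>" for \<sigma>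
  \<comment> \<open>The signed count of the crossing with \<open>\<sigma>\<close>, which by
    transversality can occur only at the parameter \<open>p \<sigma>\<close>. As \<open>K\<close> is
    open, the crossing point is outside \<open>K\<close>: an exit must be counted at
    \<open>p \<sigma>\<close> itself, an entry only after it. With these conventions the sum with
    the indicator is constant at the crossing as well.\<close>
  define h where "h \<sigma> s = (if hit \<sigma> then if n \<sigma> \<bullet> e > 0 then of_bool (p \<sigma> \<le> s) else - of_bool (p \<sigma> < s) else (0::real))" for \<sigma> s
  let ?k = "\<lambda>s. indicator K (x + s *\<^sub>R e) :: real"
  define g where "g s = ?k s + (\<Sum>\<sigma>\<in>Es. h \<sigma> s)" for s
  have "isCont (\<lambda>s. x + s *\<^sub>R e) s" for s by (intro continuous_intros)
  then have lim: "((\<lambda>t. x + t *\<^sub>R e) \<longlongrightarrow> x + s *\<^sub>R e) (nhds s)" for s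
    using tendsto_at_iff_tendsto_nhds[of "\<lambda>s. x + s *\<^sub>R e" s] by (simp add: isCont_def)
  have h_ev: "\<forall>\<^sub>F t in nhds s. h \<sigma> t = h \<sigma> s" if "s \<noteq> p \<sigma> \<or> \<not> hit \<sigma>" for s \<sigma>
  proof (cases "hit \<sigma>")
    case True
    with that have "s < p \<sigma> \<or> p \<sigma> < s" by auto
    then show ?thesis
    proof
      assume s: "s < p \<sigma>"
      then have "\<forall>\<^sub>F t in nhds s. t < p \<sigma>" using eventually_nhds_in_open[of "{..<p \<sigma>}" s] by simp
      then show ?thesis by eventually_elim (use s in \<open>auto simp: h_def\<close>)
    next
      assume s: "p \<sigma> < s"
      then have "\<forall>\<^sub>F t in nhds s. p \<sigma> < t" using eventually_nhds_in_open[of "{p \<sigma><..}" s] by simp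
      then show ?thesis by eventually_elim (use s in \<open>auto simp: h_def\<close>)
    qed
  qed (simp add: h_def)
  have "\<forall>\<^sub>F t in nhds s. g t = g s" for s
  proof (cases "x + s *\<^sub>R e \<in> frontier K")
    case False
    have "\<forall>\<^sub>F y in nhds (x + s *\<^sub>R e). indicator K y = (indicator K (x + s *\<^sub>R e) :: real)"
    proof (cases "x + s *\<^sub>R e \<in> K")
      case True
      then have "\<forall>\<^sub>F y in nhds (x + s *\<^sub>R e). y \<in> K" using K by (intro eventually_nhds_in_open)
      then show ?thesis by (rule eventually_mono) (use True in simp)
    next
      case False
      then have "x + s *\<^sub>R e \<in> - closure K" 
        using \<open>x + s *\<^sub>R e \<notin> frontier K\<close> K by (auto simp: frontier_def interior_open)
      then have "\<forall>\<^sub>F y in nhds (x + s *\<^sub>R e). y \<in> - closure K"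
        by (intro eventually_nhds_in_open) auto
      then show ?thesis
        by (rule eventually_mono) (use False closure_subset[of K] in \<open>auto simp: indicator_def\<close>)
    qed
    then have 1: "\<forall>\<^sub>F t in nhds s. ?k t = ?k s"
      by (rule eventually_compose_filterlim[OF _ lim])
    have "\<forall>\<^sub>F t in nhds s. \<forall>\<sigma>\<in>Es. h \<sigma> t = h \<sigma> s"
    proof (rule eventually_ball_finite[OF fin], intro ballI h_ev)
      fix \<sigma> assume \<sigma>: "\<sigma> \<in> Es"
      show "s \<noteq> p \<sigma> \<or> \<not> hit \<sigma>"
        using False fr \<sigma> closure_subset[of \<sigma>] by (auto simp: hit_def)
    qed
    with 1 show ?thesis by eventually_elim (simp add: g_def)
  next
    case True
    then obtain \<sigma> where \<sigma>: "\<sigma> \<in> Es" "x + s *\<^sub>R e \<in> \<sigma>" using fr cl by blast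
    then have s: "s = p \<sigma>" "hit \<sigma>" using on by (auto simp: hit_def)
    \<comment> \<open>By \<open>cl\<close>, a point in the closure of another face would belong to
      that face, against disjointness. Thus exactly one summand of \<open>g\<close> jumps here, and
      it compensates the jump of the indicator.\<close>
    have other: "x + s *\<^sub>R e \<notin> closure \<tau>" if "\<tau> \<in> Es" "\<tau> \<noteq> \<sigma>" for \<tau>
      using cl[OF that(1), of s] \<sigma> that dj by (auto simp: pairwise_def disjnt_def)
    obtain \<delta> where \<delta>: "0 < \<delta>" "\<And>y. dist (x + s *\<^sub>R e) y < \<delta> \<Longrightarrow> y \<in> K \<longleftrightarrow> n \<sigma> \<bullet> y < c \<sigma>"
      using half_ball[OF K fr fin \<sigma>(1) op[OF \<sigma>(1)] n[OF \<sigma>(1)] \<sigma>(2) other nz[OF \<sigma>]] by blast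
    have c: "c \<sigma> = n \<sigma> \<bullet> (x + s *\<^sub>R e)" using openin_imp_subset[OF op[OF \<sigma>(1)]] \<sigma>(2) by auto
    have "\<forall>\<^sub>F y in nhds (x + s *\<^sub>R e). dist (x + s *\<^sub>R e) y < \<delta>"
      using \<delta>(1) by (auto simp: eventually_nhds_metric dist_commute)
    then have "\<forall>\<^sub>F t in nhds s. dist (x + s *\<^sub>R e) (x + t *\<^sub>R e) < \<delta>"
      by (rule eventually_compose_filterlim[OF _ lim])
    then have 1: "\<forall>\<^sub>F t in nhds s. ?k t + h \<sigma> t = ?k s + h \<sigma> s"
    proof (rule eventually_mono)
      fix t assume "dist (x + s *\<^sub>R e) (x + t *\<^sub>R e) < \<delta>"
      then have "x + t *\<^sub>R e \<in> K \<longleftrightarrow> n \<sigma> \<bullet> (x + t *\<^sub>R e) < c \<sigma>" by (rule \<delta>(2))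
      also have "\<dots> \<longleftrightarrow> (t - s) * (n \<sigma> \<bullet> e) < 0"
        unfolding c by (simp add: inner_add_right left_diff_distrib)
      finally have t: "x + t *\<^sub>R e \<in> K \<longleftrightarrow> (t - s) * (n \<sigma> \<bullet> e) < 0" .
      have s0: "x + s *\<^sub>R e \<notin> K" using \<delta>(2)[of "x + s *\<^sub>R e"] \<delta>(1) c by auto
      show "?k t + h \<sigma> t = ?k s + h \<sigma> s"
      proof (cases "n \<sigma> \<bullet> e > 0")
        case True
        then have "x + t *\<^sub>R e \<in> K \<longleftrightarrow> t < s" using t by (simp add: mult_less_0_iff)
        then show ?thesis using True s s0 by (auto simp: h_def)
      next
        case False
        then have "n \<sigma> \<bullet> e < 0" using ne[OF \<sigma>(1)] by simp
        then have "x + t *\<^sub>R e \<in> K \<longleftrightarrow> s < t" using t by (simp add: mult_less_0_iff)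
        then show ?thesis using False s s0 by (auto simp: h_def)
      qed
    qed
    have "\<forall>\<^sub>F t in nhds s. \<forall>\<tau>\<in>Es - {\<sigma>}. h \<tau> t = h \<tau> s"
    proof (rule eventually_ball_finite, simp add: fin, intro ballI h_ev)
      fix \<tau> assume \<tau>: "\<tau> \<in> Es - {\<sigma>}"
      show "s \<noteq> p \<tau> \<or> \<not> hit \<tau>"
        using other[of \<tau>] \<tau> closure_subset[of \<tau>] by (auto simp: hit_def)
    qed
    with 1 show ?thesis
    proof eventually_elim
      case (elim t)
      have "g r = (?k r + h \<sigma> r) + (\<Sum>\<tau>\<in>Es - {\<sigma>}. h \<tau> r)" for r
        using sum.remove[OF fin \<sigma>(1), of "\<lambda>\<tau>. h \<tau> r"] by (simp add: g_def)
      with elim show ?case by simp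
    qed
  qed
  then have "g (-1/2) = g (1/2)" by (rule locally_constant_real_imp_eq)
  then have "?k (-1/2) - ?k (1/2) = (\<Sum>\<sigma>\<in>Es. h \<sigma> (1/2) - h \<sigma> (-1/2))"
    by (simp add: g_def sum_subtractf)
  also have "\<dots> = (\<Sum>\<sigma>\<in>Es. sgn (n \<sigma> \<bullet> e) * indicator (slab (n \<sigma>) (c \<sigma>) e \<sigma>) x)"
  proof (rule sum.cong[OF refl])
    fix \<sigma> assume \<sigma>: "\<sigma> \<in> Es"
    have "x \<in> slab (n \<sigma>) (c \<sigma>) e \<sigma> \<longleftrightarrow> \<bar>p \<sigma>\<bar> \<le> 1/2 \<and> hit \<sigma>"
      using on[OF \<sigma>] openin_imp_subset[OF op[OF \<sigma>]]
      by (subst mem_slab_iff[OF ne[OF \<sigma>]]) (auto simp: hit_def)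
    \<comment> \<open>The slab is closed in the parameter while \<open>h\<close> counts half-open
      intervals; they could differ only for a crossing at an end of the segment, and the ends avoid
      the frontier.\<close>
    moreover have "p \<sigma> \<noteq> 1/2" "p \<sigma> \<noteq> -1/2" if "hit \<sigma>"
      using that ends \<sigma> fr closure_subset[of \<sigma>] by (force simp: hit_def)+
    ultimately show "h \<sigma> (1/2) - h \<sigma> (-1/2) = sgn (n \<sigma> \<bullet> e) * indicator (slab (n \<sigma>) (c \<sigma>) e \<sigma>) x"
      using ne[OF \<sigma>] by (auto simp: h_def indicator_def sgn_if abs_le_iff)
  qed
  finally show ?thesis .
qed

section \<open>The divergence theorem on a polytopal cell\<close>

lemma negligible_imp_AE_lborel:
  fixes S :: "'a::euclidean_space set"
  assumes "negligible S"
  shows "AE x in lborel. x \<notin> S"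
proof -
  have "S \<in> null_sets (completion lborel)" using assms by (simp add: negligible_iff_null_sets)
  then have "AE x in completion lborel. x \<notin> S" by (rule AE_not_in)
  then show ?thesis by (simp add: AE_completion_iff)
qed

lemma lborel_integral_translate:
  fixes f :: "'a::euclidean_space \<Rightarrow> 'b::{banach,second_countable_topology}"
  assumes [measurable]: "f \<in> borel_measurable borel"
  shows "(\<integral>x. f (v + x) \<partial>lborel) = (\<integral>x. f x \<partial>lborel)"
proof -
  have "(\<integral>x. f (v + x) \<partial>lborel) = (\<integral>x. f x \<partial>distr lborel borel ((+) v))"
    by (subst integral_distr) auto
  then show ?thesis by (simp add: lborel_distr_plus)
qed

text \<open>A face comes with two hyperplanes, the one in which it is relatively open and the one
  orthogonal to its normal. The first is the affine hull of the face, because the face is non-empty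
  and relatively open in it; it is contained in the second and has the same dimension, so they
  coincide.\<close>

lemma is_faceE:
  fixes K :: "(real^'n) set"
  assumes "is_face K \<sigma>"
  obtains c where "norm (outward_normal K \<sigma>) = 1"
    "affine hull \<sigma> = {x. outward_normal K \<sigma> \<bullet> x = c}"
    "openin (top_of_set {x. outward_normal K \<sigma> \<bullet> x = c}) \<sigma>"
    "AE x in hyperplane_measure {x. outward_normal K \<sigma> \<bullet> x = c}. x \<in> \<sigma> \<longrightarrow>
        (\<exists>\<epsilon>>0. \<forall>t. 0 < t \<and> t < \<epsilon> \<longrightarrow> x - t *\<^sub>R outward_normal K \<sigma> \<in> K \<and> x + t *\<^sub>R outward_normal K \<sigma> \<notin> K)"
proof -
  let ?n = "outward_normal K \<sigma>"
  have "is_outward_normal K \<sigma> ?n"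
    using assms unfolding is_face_def outward_normal_def by (metis someI_ex)
  then have n: "norm ?n = 1" and perp: "\<And>x y. x \<in> \<sigma> \<Longrightarrow> y \<in> \<sigma> \<Longrightarrow> ?n \<bullet> (x - y) = 0"
    and ae: "AE x in surface_measure \<sigma>. x \<in> \<sigma> \<longrightarrow>
        (\<exists>\<epsilon>>0. \<forall>t. 0 < t \<and> t < \<epsilon> \<longrightarrow> x - t *\<^sub>R ?n \<in> K \<and> x + t *\<^sub>R ?n \<notin> K)"
    by (auto simp: is_outward_normal_def)
  obtain y where y: "y \<in> \<sigma>" using assms by (auto simp: is_face_def)
  obtain a b where ab: "a \<noteq> 0" "openin (top_of_set {x. a \<bullet> x = b}) \<sigma>"
    using assms by (auto simp: is_face_def)
  let ?H = "{x. ?n \<bullet> x = ?n \<bullet> y}"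
  have "affine hull \<sigma> = affine hull {x. a \<bullet> x = b}"
    using ab(2) y by (intro affine_hull_openin) (auto simp: affine_hull_eq[THEN iffD2] affine_hyperplane)
  then have hull: "affine hull \<sigma> = {x. a \<bullet> x = b}"
    by (simp add: affine_hull_eq[THEN iffD2] affine_hyperplane)
  have "\<sigma> \<subseteq> ?H" using perp[OF _ y] by (auto simp: inner_diff_right)
  then have sub: "affine hull \<sigma> \<subseteq> ?H" by (intro hull_minimal) (auto simp: affine_hyperplane)
  have "?n \<noteq> 0" using n by auto
  then have "aff_dim {x. a \<bullet> x = b} = aff_dim ?H" using ab(1) by (simp add: aff_dim_hyperplane)
  then have eq: "{x. a \<bullet> x = b} = ?H"
    using sub y unfolding hull
    by (intro affine_dim_equal) (auto simp: affine_hyperplane hull[symmetric] intro: hull_inc)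
  have sm: "surface_measure \<sigma> = hyperplane_measure ?H" by (simp add: surface_measure_def hull eq)
  show ?thesis
    by (rule that[OF n hull[unfolded eq] ab(2)[unfolded eq] ae[unfolded sm]])
qed

definition face_offset :: "(real^'n) set \<Rightarrow> (real^'n) set \<Rightarrow> real" where
  "face_offset K \<sigma> = (SOME c. affine hull \<sigma> = {x. outward_normal K \<sigma> \<bullet> x = c})"

context
  fixes K \<sigma> :: "(real^'n) set"
  assumes face: "is_face K \<sigma>"
begin

abbreviation (input) "normal \<equiv> outward_normal K \<sigma>"
abbreviation (input) "offset \<equiv> face_offset K \<sigma>"

lemma norm_outward_normal: "norm normal = 1"
  using face by (rule is_faceE)

lemma affine_hull_face: "affine hull \<sigma> = {x. normal \<bullet> x = offset}"
  unfolding face_offset_def by (rule someI_ex) (use is_faceE[OF face] in blast)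

lemma face_offset_unique: "affine hull \<sigma> = {x. normal \<bullet> x = c} \<Longrightarrow> c = offset"
proof -
  assume "affine hull \<sigma> = {x. normal \<bullet> x = c}"
  moreover obtain y where "y \<in> affine hull \<sigma>" using face hull_inc[of _ \<sigma>] by (fastforce simp: is_face_def)
  ultimately show ?thesis using affine_hull_face by auto
qed

lemma openin_face: "openin (top_of_set {x. normal \<bullet> x = offset}) \<sigma>"
proof (rule is_faceE[OF face])
  fix c assume hull: "affine hull \<sigma> = {x. normal \<bullet> x = c}" and op: "openin (top_of_set {x. normal \<bullet> x = c}) \<sigma>"
  have "c = offset" using hull by (rule face_offset_unique)
  then show ?thesis using op by (simp only:)
qed

lemma face_subset_hyperplane: "\<sigma> \<subseteq> {x. normal \<bullet> x = offset}"
  using openin_face by (rule openin_imp_subset)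

lemma AE_face_sides:
  "AE x in hyperplane_measure {x. normal \<bullet> x = offset}. x \<in> \<sigma> \<longrightarrow>
     (\<exists>\<epsilon>>0. \<forall>t. 0 < t \<and> t < \<epsilon> \<longrightarrow> x - t *\<^sub>R normal \<in> K \<and> x + t *\<^sub>R normal \<notin> K)"
proof (rule is_faceE[OF face])
  fix c assume hull: "affine hull \<sigma> = {x. normal \<bullet> x = c}"
    and ae: "AE x in hyperplane_measure {x. normal \<bullet> x = c}. x \<in> \<sigma> \<longrightarrow>
      (\<exists>\<epsilon>>0. \<forall>t. 0 < t \<and> t < \<epsilon> \<longrightarrow> x - t *\<^sub>R normal \<in> K \<and> x + t *\<^sub>R normal \<notin> K)"
  have "c = offset" using hull by (rule face_offset_unique)
  then show ?thesis using ae by (simp only:)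
qed

lemma surface_measure_face: "surface_measure \<sigma> = hyperplane_measure {x. normal \<bullet> x = offset}"
  by (simp add: surface_measure_def affine_hull_face)

lemma face_open_part:
  obtains U where "open U" "\<And>x. x \<in> \<sigma> \<longleftrightarrow> normal \<bullet> x = offset \<and> x \<in> U"
  using openin_face unfolding openin_open by blast

lemma face_borel [measurable]: "\<sigma> \<in> sets borel"
proof -
  obtain U where U: "open U" "\<And>x. x \<in> \<sigma> \<longleftrightarrow> normal \<bullet> x = offset \<and> x \<in> U"
    using face_open_part by blast
  have "{x. normal \<bullet> x = offset} \<inter> U \<in> sets borel"
    by (intro sets.Int borel_closed closed_hyperplane borel_open U(1))
  also have "{x. normal \<bullet> x = offset} \<inter> U = \<sigma>" using U(2) by blast
  finally show ?thesis .
qed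

lemma bounded_face: "bounded \<sigma>"
  using face by (simp add: is_face_def polytopal_def)

lemma closure_face_subset: "closure \<sigma> \<subseteq> {x. normal \<bullet> x = offset}"
  using face_subset_hyperplane by (simp add: closure_minimal closed_hyperplane)

text \<open>A relatively open set is its own relative interior, so the closure adds only the
  relative frontier, which polytopality confines to finitely many affine sets of codimension at
  least two.\<close>

lemma closure_face_affine:
  obtains \<A> where "finite \<A>" "\<And>A. A \<in> \<A> \<Longrightarrow> affine A \<and> aff_dim A < int DIM(real^'n) - 1"
    "closure \<sigma> \<subseteq> \<sigma> \<union> \<Union>\<A>"
proof -
  obtain \<A> where A: "finite \<A>" "\<And>A. A \<in> \<A> \<Longrightarrow> affine A \<and> aff_dim A < aff_dim \<sigma>" "rel_frontier \<sigma> \<subseteq> \<Union>\<A>"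
    and ro: "rel_open \<sigma>"
    using face unfolding is_face_def polytopal_def by blast
  have "normal \<noteq> 0" using norm_outward_normal by auto
  then have "aff_dim \<sigma> = int DIM(real^'n) - 1"
    using aff_dim_affine_hull[of \<sigma>] by (simp add: affine_hull_face aff_dim_hyperplane del: aff_dim_affine_hull)
  moreover have "closure \<sigma> \<subseteq> \<sigma> \<union> \<Union>\<A>"
    using A(3) ro by (auto simp: rel_frontier_def rel_open_def)
  ultimately show ?thesis using A(1,2) by (intro that) auto
qed

text \<open>The normal slab contains a non-empty open set, namely the points of height below 1/2
  that project into the open set cutting out the face. Finiteness has to be shown too, since
  \<open>measure\<close> is 0 on sets of infinite measure.\<close>

lemma face_area_pos: "0 < face_area \<sigma>"
proof -
  have n1: "normal \<bullet> normal = 1" using norm_outward_normal by (simp add: norm_eq_1)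
  let ?S = "slab normal offset normal \<sigma>"
  obtain U where U: "open U" "\<And>x. x \<in> \<sigma> \<longleftrightarrow> normal \<bullet> x = offset \<and> x \<in> U"
    using face_open_part by blast
  let ?P = "\<lambda>x. x - (normal \<bullet> x - offset) *\<^sub>R normal"
  let ?O = "{x. \<bar>normal \<bullet> x - offset\<bar> < 1/2} \<inter> ?P -` U"
  have op: "open ?O"
    by (intro open_Int open_Collect_less open_vimage U continuous_intros)
  obtain y where y: "y \<in> \<sigma>" using face by (auto simp: is_face_def)
  then have "y \<in> ?O" using U(2)[of y] by simp
  then have "\<not> negligible ?O" using open_not_negligible[OF op] by blast
  moreover have "?O \<subseteq> ?S"
  proof
    fix x assume x: "x \<in> ?O"
    have "?P x \<in> {x. normal \<bullet> x = offset}" by (simp add: inner_diff_right n1)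
    then have "?P x \<in> \<sigma>" using x U(2)[of "?P x"] by simp
    then show "x \<in> ?S" using x by (simp add: slab_def n1)
  qed
  ultimately have "\<not> negligible ?S" by (meson negligible_subset)
  then have "?S \<notin> null_sets lborel" using null_sets_completionI negligible_iff_null_sets by blast
  then have "emeasure lborel ?S \<noteq> 0" by (simp add: null_sets_def)
  moreover have "emeasure lborel ?S \<noteq> \<infinity>"
    using emeasure_bounded_finite[of ?S] bounded_slab[OF bounded_face, of normal normal offset] n1 by simp
  ultimately have "measure lborel ?S \<noteq> 0"
    by (metis emeasure_eq_ennreal_measure ennreal_0 infinity_ennreal_def)
  then have "measure lborel ?S > 0" by (simp add: zero_less_measure_iff)
  then show ?thesis
    using measure_slab[OF norm_outward_normal, of normal \<sigma> offset] n1
    by (simp add: face_area_def surface_measure_face)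
qed

lemma face_center_eq: "face_area \<sigma> *\<^sub>R face_center \<sigma> = (LINT x:\<sigma>|surface_measure \<sigma>. x)"
  using face_area_pos by (simp add: face_center_def)

end

context
  fixes K :: "(real^'n) set" and Es :: "(real^'n) set set"
  assumes K: "open K" "bounded K" and fr: "frontier K = (\<Union>\<sigma>\<in>Es. closure \<sigma>)" and fin: "finite Es"
    and faces: "\<And>\<sigma>. \<sigma> \<in> Es \<Longrightarrow> is_face K \<sigma>" and dj: "pairwise disjnt Es"
begin

text \<open>Three kinds of lines are discarded, each sweeping out a null set: those with an end of
  the segment on the frontier, those meeting the closure of a face outside the face, and those
  through a point of a face at which its normal fails to point outward.\<close>

lemma AE_indicator_difference:
  assumes e: "\<And>\<sigma>. \<sigma> \<in> Es \<Longrightarrow> outward_normal K \<sigma> \<bullet> e \<noteq> 0"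
  shows "AE x in lborel. indicator K (x + (-1/2) *\<^sub>R e) - indicator K (x + (1/2) *\<^sub>R e) =
    (\<Sum>\<sigma>\<in>Es. sgn (outward_normal K \<sigma> \<bullet> e) * indicator (slab (outward_normal K \<sigma>) (face_offset K \<sigma>) e \<sigma>) x :: real)"
proof -
  let ?n = "outward_normal K" and ?c = "face_offset K"
  let ?side = "\<lambda>\<sigma> x. \<exists>\<epsilon>>0. \<forall>t. 0 < t \<and> t < \<epsilon> \<longrightarrow> x - t *\<^sub>R ?n \<sigma> \<in> K \<and> x + t *\<^sub>R ?n \<sigma> \<notin> K"
  have frn: "negligible (frontier K)"
    unfolding fr
  proof (intro negligible_Union ballI; clarsimp simp: fin)
    fix \<sigma> assume \<sigma>: "\<sigma> \<in> Es"
    have "?n \<sigma> \<noteq> 0" using norm_outward_normal[OF faces[OF \<sigma>]] by auto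
    then have "negligible {x. ?n \<sigma> \<bullet> x = ?c \<sigma>}" by (simp add: negligible_hyperplane)
    then show "negligible (closure \<sigma>)"
      using closure_face_subset[OF faces[OF \<sigma>]] by (rule negligible_subset)
  qed
  have ends: "AE x in lborel. x + v \<notin> frontier K" for v
  proof -
    have "negligible ((+) (-v) ` frontier K)" by (rule negligible_translation[OF frn])
    then have "AE x in lborel. x \<notin> (+) (-v) ` frontier K" by (rule negligible_imp_AE_lborel)
    then show ?thesis
    proof eventually_elim
      case (elim x)
      moreover have "x \<in> (+) (-v) ` frontier K" if "x + v \<in> frontier K"
        using that by (intro image_eqI[of _ _ "x + v"]) simp_all
      ultimately show ?case by blast
    qed
  qed
  have cl: "AE x in lborel. \<forall>\<sigma>\<in>Es. \<forall>s. x + s *\<^sub>R e \<in> closure \<sigma> \<longrightarrow> x + s *\<^sub>R e \<in> \<sigma>"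
  proof (rule AE_finite_allI[OF fin])
    fix \<sigma> assume \<sigma>: "\<sigma> \<in> Es"
    obtain \<A> where A: "finite \<A>" "\<And>A. A \<in> \<A> \<Longrightarrow> affine A \<and> aff_dim A < int DIM(real^'n) - 1"
      "closure \<sigma> \<subseteq> \<sigma> \<union> \<Union>\<A>" using closure_face_affine[OF faces[OF \<sigma>]] by blast
    have "AE x in lborel. \<forall>A\<in>\<A>. x \<notin> {x. \<exists>s. x + s *\<^sub>R e \<in> A}"
      by (intro AE_finite_allI A(1) negligible_imp_AE_lborel negligible_lines_through_affine) (use A(2) in auto)
    then show "AE x in lborel. \<forall>s. x + s *\<^sub>R e \<in> closure \<sigma> \<longrightarrow> x + s *\<^sub>R e \<in> \<sigma>"
    proof eventually_elim
      case (elim x)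
      show ?case
      proof (intro allI impI)
        fix s assume "x + s *\<^sub>R e \<in> closure \<sigma>"
        then have "x + s *\<^sub>R e \<in> \<sigma> \<union> \<Union>\<A>" by (rule subsetD[OF A(3)])
        moreover have "x + s *\<^sub>R e \<notin> \<Union>\<A>" using elim by auto
        ultimately show "x + s *\<^sub>R e \<in> \<sigma>" by simp
      qed
    qed
  qed
  have sides: "AE x in lborel. \<forall>\<sigma>\<in>Es. \<forall>s. x + s *\<^sub>R e \<in> \<sigma> \<longrightarrow> ?side \<sigma> (x + s *\<^sub>R e)"
  proof (rule AE_finite_allI[OF fin])
    fix \<sigma> assume \<sigma>: "\<sigma> \<in> Es"
    let ?H = "{x. ?n \<sigma> \<bullet> x = ?c \<sigma>}"
    obtain N where N: "N \<in> null_sets (hyperplane_measure ?H)" "{x. \<not> (x \<in> \<sigma> \<longrightarrow> ?side \<sigma> x)} \<subseteq> N"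
    proof (rule AE_E[OF AE_face_sides[OF faces[OF \<sigma>]]])
      fix N assume "{x \<in> space (hyperplane_measure ?H). \<not> (x \<in> \<sigma> \<longrightarrow> ?side \<sigma> x)} \<subseteq> N"
        "emeasure (hyperplane_measure ?H) N = 0" "N \<in> sets (hyperplane_measure ?H)"
      moreover have "space (hyperplane_measure ?H) = UNIV" by (simp add: hyperplane_measure_def)
      ultimately show thesis by (intro that[of N]) (simp_all add: null_sets_def)
    qed
    have "AE x in lborel. x \<notin> {x. \<exists>s. x + s *\<^sub>R e \<in> N \<and> ?n \<sigma> \<bullet> (x + s *\<^sub>R e) = ?c \<sigma>}"
      by (rule negligible_imp_AE_lborel[OF negligible_lines_through_null_set[OF norm_outward_normal[OF faces[OF \<sigma>]] e[OF \<sigma>] N(1)]])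
    then show "AE x in lborel. \<forall>s. x + s *\<^sub>R e \<in> \<sigma> \<longrightarrow> ?side \<sigma> (x + s *\<^sub>R e)"
    proof eventually_elim
      case (elim x)
      show ?case
      proof (intro allI impI)
        fix s assume s: "x + s *\<^sub>R e \<in> \<sigma>"
        then have "?n \<sigma> \<bullet> (x + s *\<^sub>R e) = ?c \<sigma>" using face_subset_hyperplane[OF faces[OF \<sigma>]] by blast
        then have "x + s *\<^sub>R e \<notin> N" using elim by auto
        then have "x + s *\<^sub>R e \<notin> {x. \<not> (x \<in> \<sigma> \<longrightarrow> ?side \<sigma> x)}" using N(2) by (rule contra_subsetD[rotated])
        then have "x + s *\<^sub>R e \<in> \<sigma> \<longrightarrow> ?side \<sigma> (x + s *\<^sub>R e)" by (simp only: mem_Collect_eq not_not)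
        then show "?side \<sigma> (x + s *\<^sub>R e)" using s by (rule mp)
      qed
    qed
  qed
  from ends[of "(-1/2) *\<^sub>R e"] ends[of "(1/2) *\<^sub>R e"] cl sides show ?thesis
  proof eventually_elim
    case (elim x)
    show ?case
    proof (rule indicator_difference_on_line[OF K(1) fr fin openin_face[OF faces] norm_outward_normal[OF faces] e dj])
      show "x + s *\<^sub>R e \<in> \<sigma>" if "\<sigma> \<in> Es" "x + s *\<^sub>R e \<in> closure \<sigma>" for s \<sigma>
        by (rule elim(3)[THEN bspec, OF that(1), THEN spec, THEN mp, OF that(2)])
      show "?side \<sigma> (x + s *\<^sub>R e)" if "\<sigma> \<in> Es" "x + s *\<^sub>R e \<in> \<sigma>" for s \<sigma>
        by (rule elim(4)[THEN bspec, OF that(1), THEN spec, THEN mp, OF that(2)])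
      show "x + (-1/2) *\<^sub>R e \<notin> frontier K" "x + (1/2) *\<^sub>R e \<notin> frontier K"
        by (rule elim(1), rule elim(2))
    qed
  qed
qed

text \<open>Translating the integration variable moves the shifts from \<open>f\<close> to the
  indicator of \<open>K\<close>, and almost everywhere the difference of the shifted indicators is a
  signed sum of indicators of slabs.\<close>

lemma integral_divergence:
  fixes f :: "real^'n \<Rightarrow> 'b::euclidean_space"
  assumes e: "\<And>\<sigma>. \<sigma> \<in> Es \<Longrightarrow> outward_normal K \<sigma> \<bullet> e \<noteq> 0" and f: "continuous_on UNIV f"
  shows "(\<integral>x. indicator K x *\<^sub>R (f (x + (1/2) *\<^sub>R e) - f (x - (1/2) *\<^sub>R e)) \<partial>lborel) =
    (\<Sum>\<sigma>\<in>Es. sgn (outward_normal K \<sigma> \<bullet> e) *\<^sub>R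
       (\<integral>x. indicator (slab (outward_normal K \<sigma>) (face_offset K \<sigma>) e \<sigma>) x *\<^sub>R f x \<partial>lborel))"
proof -
  let ?sl = "\<lambda>\<sigma>. slab (outward_normal K \<sigma>) (face_offset K \<sigma>) e \<sigma>"
  let ?h = "(1/2) *\<^sub>R e"
  note f[THEN borel_measurable_continuous_onI, measurable]
  have [measurable]: "K \<in> sets borel" using K by simp
  have slb: "?sl \<sigma> \<in> sets borel" "bounded (?sl \<sigma>)" if "\<sigma> \<in> Es" for \<sigma>
    using that face_borel[OF faces] bounded_face[OF faces] e by (auto intro: slab_borel bounded_slab)
  have intK: "integrable lborel (\<lambda>x. indicator K x *\<^sub>R g x)" if "continuous_on UNIV g" for g :: "real^'n \<Rightarrow> 'b"
    using that K by (intro integrable_continuous_bounded) auto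
  have cp: "continuous_on UNIV (\<lambda>x. f (x + v))" for v
    by (intro continuous_on_compose2[OF f] continuous_intros) auto
  have shift: "(\<integral>x. indicator K x *\<^sub>R f (x + v) \<partial>lborel) = (\<integral>x. indicator K (x - v) *\<^sub>R f x \<partial>lborel)" for v
    using lborel_integral_translate[of "\<lambda>x. indicator K (x - v) *\<^sub>R f x" v] by (simp add: add.commute)
  have intK': "integrable lborel (\<lambda>x. indicator K (x - v) *\<^sub>R f x)" for v
  proof -
    have "(\<lambda>x. indicator K (x - v) *\<^sub>R f x) = (\<lambda>x. indicator ((+) v ` K) x *\<^sub>R f x)"
      by (auto simp: fun_eq_iff indicator_def image_iff algebra_simps)
    moreover have "bounded ((+) v ` K)" "open ((+) v ` K)"
      using K by (auto simp: bounded_translation open_translation)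
    ultimately show ?thesis using f by (auto intro: integrable_continuous_bounded)
  qed
  have "(\<integral>x. indicator K x *\<^sub>R (f (x + ?h) - f (x - ?h)) \<partial>lborel)
     = (\<integral>x. indicator K x *\<^sub>R f (x + ?h) - indicator K x *\<^sub>R f (x + (- ?h)) \<partial>lborel)"
    by (simp add: scaleR_diff_right)
  also have "\<dots> = (\<integral>x. indicator K x *\<^sub>R f (x + ?h) \<partial>lborel) - (\<integral>x. indicator K x *\<^sub>R f (x + (- ?h)) \<partial>lborel)"
    by (rule Bochner_Integration.integral_diff) (rule intK[OF cp])+
  also have "\<dots> = (\<integral>x. indicator K (x - ?h) *\<^sub>R f x - indicator K (x - (- ?h)) *\<^sub>R f x \<partial>lborel)"
    unfolding shift by (rule Bochner_Integration.integral_diff[symmetric]) (rule intK')+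
  also have "\<dots> = (\<integral>x. (\<Sum>\<sigma>\<in>Es. sgn (outward_normal K \<sigma> \<bullet> e) *\<^sub>R (indicator (?sl \<sigma>) x *\<^sub>R f x)) \<partial>lborel)"
  proof (rule integral_cong_AE)
    show "AE x in lborel. indicator K (x - ?h) *\<^sub>R f x - indicator K (x - (- ?h)) *\<^sub>R f x
       = (\<Sum>\<sigma>\<in>Es. sgn (outward_normal K \<sigma> \<bullet> e) *\<^sub>R (indicator (?sl \<sigma>) x *\<^sub>R f x))"
    proof -
      have "AE x in lborel. indicator K (x + (-1/2) *\<^sub>R e) - indicator K (x + (1/2) *\<^sub>R e) =
        (\<Sum>\<sigma>\<in>Es. sgn (outward_normal K \<sigma> \<bullet> e) * indicator (?sl \<sigma>) x :: real)"
        by (rule AE_indicator_difference[OF e])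
      then show ?thesis
      proof eventually_elim
        case (elim x)
        have "indicator K (x - ?h) *\<^sub>R f x - indicator K (x - (- ?h)) *\<^sub>R f x
            = (indicator K (x + (-1/2) *\<^sub>R e) - indicator K (x + (1/2) *\<^sub>R e) :: real) *\<^sub>R f x"
          by (simp add: scaleR_diff_left)
        also have "\<dots> = (\<Sum>\<sigma>\<in>Es. sgn (outward_normal K \<sigma> \<bullet> e) *\<^sub>R (indicator (?sl \<sigma>) x *\<^sub>R f x))"
          unfolding elim by (simp add: scaleR_sum_left)
        finally show ?case .
      qed
    qed
    show "(\<lambda>x. \<Sum>\<sigma>\<in>Es. sgn (outward_normal K \<sigma> \<bullet> e) *\<^sub>R (indicator (?sl \<sigma>) x *\<^sub>R f x)) \<in> borel_measurable lborel"
      using slb(1) by (intro borel_measurable_sum borel_measurable_scaleR borel_measurable_indicator) auto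
  qed measurable
  also have "\<dots> = (\<Sum>\<sigma>\<in>Es. sgn (outward_normal K \<sigma> \<bullet> e) *\<^sub>R (\<integral>x. indicator (?sl \<sigma>) x *\<^sub>R f x \<partial>lborel))"
  proof -
    have "integrable lborel (\<lambda>x. sgn (outward_normal K \<sigma> \<bullet> e) *\<^sub>R (indicator (?sl \<sigma>) x *\<^sub>R f x))" if "\<sigma> \<in> Es" for \<sigma>
      by (intro integrable_scaleR_right integrable_continuous_bounded slb that f)
    then have "(\<integral>x. (\<Sum>\<sigma>\<in>Es. sgn (outward_normal K \<sigma> \<bullet> e) *\<^sub>R (indicator (?sl \<sigma>) x *\<^sub>R f x)) \<partial>lborel)
        = (\<Sum>\<sigma>\<in>Es. \<integral>x. sgn (outward_normal K \<sigma> \<bullet> e) *\<^sub>R (indicator (?sl \<sigma>) x *\<^sub>R f x) \<partial>lborel)"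
      by (rule Bochner_Integration.integral_sum)
    also have "\<dots> = (\<Sum>\<sigma>\<in>Es. sgn (outward_normal K \<sigma> \<bullet> e) *\<^sub>R (\<integral>x. indicator (?sl \<sigma>) x *\<^sub>R f x \<partial>lborel))"
      by (simp only: integral_scaleR_right)
    finally show ?thesis .
  qed
  finally show ?thesis .
qed

text \<open>The two parts are \<open>integral_divergence\<close> for a constant and for the
  identity. The factor \<open>|n \<bullet> e|\<close> of the slab and the sign of the crossing
  combine to \<open>n \<bullet> e\<close>.\<close>

lemma gauss_generic:
  assumes e: "\<And>\<sigma>. \<sigma> \<in> Es \<Longrightarrow> outward_normal K \<sigma> \<bullet> e \<noteq> 0"
  shows "(\<Sum>\<sigma>\<in>Es. (outward_normal K \<sigma> \<bullet> e) * face_area \<sigma>) = 0" (is ?thesis1)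
    and "(\<Sum>\<sigma>\<in>Es. (outward_normal K \<sigma> \<bullet> e) *\<^sub>R face_area \<sigma> *\<^sub>R face_center \<sigma>) = volume K *\<^sub>R e" (is ?thesis2)
proof -
  have mK: "measure lborel K = volume K" using K by (simp add: volume_def measure_completion)
  have "sgn (outward_normal K \<sigma> \<bullet> e) *\<^sub>R (\<integral>x. indicator (slab (outward_normal K \<sigma>) (face_offset K \<sigma>) e \<sigma>) x *\<^sub>R (1::real) \<partial>lborel)
      = (outward_normal K \<sigma> \<bullet> e) * face_area \<sigma>" if \<sigma>: "\<sigma> \<in> Es" for \<sigma>
    using measure_slab[OF norm_outward_normal[OF faces[OF \<sigma>]] e[OF \<sigma>] face_borel[OF faces[OF \<sigma>]]]
    by (simp add: face_area_def surface_measure_face[OF faces[OF \<sigma>]] sgn_mult_abs flip: mult.assoc)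
  then show ?thesis1
    using integral_divergence[OF e, of "\<lambda>_. 1::real"] by simp
  have "sgn (outward_normal K \<sigma> \<bullet> e) *\<^sub>R (\<integral>x. indicator (slab (outward_normal K \<sigma>) (face_offset K \<sigma>) e \<sigma>) x *\<^sub>R x \<partial>lborel)
      = (outward_normal K \<sigma> \<bullet> e) *\<^sub>R face_area \<sigma> *\<^sub>R face_center \<sigma>" if \<sigma>: "\<sigma> \<in> Es" for \<sigma>
    unfolding slab_moment[OF norm_outward_normal[OF faces[OF \<sigma>]] e[OF \<sigma>] face_borel[OF faces[OF \<sigma>]] bounded_face[OF faces[OF \<sigma>]]]
    by (simp only: face_center_eq[OF faces[OF \<sigma>]] surface_measure_face[OF faces[OF \<sigma>]] scaleR_scaleR sgn_mult_abs)
  then have "(\<Sum>\<sigma>\<in>Es. (outward_normal K \<sigma> \<bullet> e) *\<^sub>R face_area \<sigma> *\<^sub>R face_center \<sigma>)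
      = (\<integral>x. indicator K x *\<^sub>R ((x + (1/2) *\<^sub>R e) - (x - (1/2) *\<^sub>R e)) \<partial>lborel)"
    using integral_divergence[OF e continuous_on_id] by simp
  also have "(\<lambda>x. (x + (1/2) *\<^sub>R e) - (x - (1/2) *\<^sub>R e)) = (\<lambda>x::real^'n. e)"
    by (simp add: fun_eq_iff flip: scaleR_add_left)
  also have "(\<integral>x. indicator K x *\<^sub>R e \<partial>lborel) = measure lborel K *\<^sub>R e"
    using K emeasure_bounded_finite[of K] by (subst integral_scaleR_left) auto
  finally show ?thesis2 using mK by simp
qed

text \<open>The directions tangent to some face form a finite union of hyperplanes. Such a set is
  null, so it has empty interior and the transversal directions are dense.\<close>

lemma closed_contains_generic:
  assumes "closed S" and "\<And>e. (\<And>\<sigma>. \<sigma> \<in> Es \<Longrightarrow> outward_normal K \<sigma> \<bullet> e \<noteq> 0) \<Longrightarrow> e \<in> S"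
  shows "e \<in> S"
proof -
  let ?B = "\<Union>\<sigma>\<in>Es. {e. outward_normal K \<sigma> \<bullet> e = 0}"
  have "negligible ?B"
  proof (intro negligible_Union ballI; clarsimp simp: fin)
    fix \<sigma> assume "\<sigma> \<in> Es"
    then have "outward_normal K \<sigma> \<noteq> 0" using norm_outward_normal[OF faces] by force
    then show "negligible {e. outward_normal K \<sigma> \<bullet> e = 0}" by (simp add: negligible_hyperplane)
  qed
  then have "negligible (interior ?B)" using interior_subset by (rule negligible_subset)
  then have "interior ?B = {}" using open_not_negligible[OF open_interior] by blast
  moreover have "closure (- ?B) = - interior ?B" by (rule closure_complement)
  ultimately have "closure (- ?B) = UNIV" by (simp only: Compl_empty_eq)
  moreover have "- ?B \<subseteq> S" using assms(2) by auto
  then have "closure (- ?B) \<subseteq> S" using assms(1) by (rule closure_minimal)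
  ultimately show ?thesis by blast
qed

text \<open>Both generic identities are closed conditions on the direction. The first one cancels
  the contribution of the base point \<open>y\<close>.\<close>

lemma cell_gauss:
  "(\<Sum>\<sigma>\<in>Es. (outward_normal K \<sigma> \<bullet> \<xi>) * ((face_area \<sigma> *\<^sub>R (face_center \<sigma> - y)) \<bullet> \<eta>)) = volume K * (\<xi> \<bullet> \<eta>)"
proof -
  have "\<xi> \<in> {e. (\<Sum>\<sigma>\<in>Es. (outward_normal K \<sigma> \<bullet> e) * face_area \<sigma>) = 0}"
    by (rule closed_contains_generic, intro closed_Collect_eq continuous_intros)
       (use gauss_generic(1) in blast)
  then have 0: "(\<Sum>\<sigma>\<in>Es. (outward_normal K \<sigma> \<bullet> \<xi>) * face_area \<sigma>) = 0" by simp
  have "\<xi> \<in> {e. (\<Sum>\<sigma>\<in>Es. (outward_normal K \<sigma> \<bullet> e) *\<^sub>R face_area \<sigma> *\<^sub>R face_center \<sigma>) = volume K *\<^sub>R e}"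
    by (rule closed_contains_generic, intro closed_Collect_eq continuous_intros)
       (use gauss_generic(2) in blast)
  then have 1: "(\<Sum>\<sigma>\<in>Es. (outward_normal K \<sigma> \<bullet> \<xi>) *\<^sub>R face_area \<sigma> *\<^sub>R face_center \<sigma>) = volume K *\<^sub>R \<xi>" by simp
  have "(\<Sum>\<sigma>\<in>Es. (outward_normal K \<sigma> \<bullet> \<xi>) * ((face_area \<sigma> *\<^sub>R (face_center \<sigma> - y)) \<bullet> \<eta>))
      = (\<Sum>\<sigma>\<in>Es. (outward_normal K \<sigma> \<bullet> \<xi>) *\<^sub>R face_area \<sigma> *\<^sub>R face_center \<sigma>) \<bullet> \<eta>
        - (\<Sum>\<sigma>\<in>Es. (outward_normal K \<sigma> \<bullet> \<xi>) * face_area \<sigma>) * (y \<bullet> \<eta>)"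
    by (simp add: inner_sum_left sum_distrib_right inner_diff_left right_diff_distrib sum_subtractf mult.assoc)
  then show ?thesis unfolding 0 1 by simp
qed

lemma volume_pos:
  assumes "K \<noteq> {}"
  shows "0 < volume K"
proof -
  have "\<not> negligible K" using open_not_negligible[OF K(1) assms] .
  moreover have "K \<in> lmeasurable" using K by (simp add: lmeasurable_open)
  ultimately have "measure lebesgue K \<noteq> 0" by (simp add: negligible_iff_measure)
  then show ?thesis by (simp add: volume_def zero_less_measure_iff)
qed

end

section \<open>The mean diffusion tensor\<close>

context
  fixes \<Omega> K :: "(real^'n) set" and \<Lambda> :: "real^'n \<Rightarrow> real^'n^'n"
  assumes \<Omega>: "open \<Omega>" and \<Lambda>: "diffusion_tensor \<Omega> \<Lambda>"
    and K: "open K" "bounded K" "K \<subseteq> \<Omega>" and vol: "0 < volume K"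
begin

lemma integrable_tensor: "integrable lebesgue (\<lambda>x. indicator K x *\<^sub>R \<Lambda> x)"
proof -
  have sets: "\<Omega> \<in> sets lebesgue" "K \<in> sets lebesgue" using \<Omega> K by auto
  obtain B where B: "\<And>x. x \<in> \<Omega> \<Longrightarrow> norm (\<Lambda> x) \<le> B"
    using \<Lambda> by (auto simp: diffusion_tensor_def bounded_iff)
  have "(\<lambda>x. indicator \<Omega> x *\<^sub>R \<Lambda> x) \<in> borel_measurable lebesgue"
    using \<Lambda> sets borel_measurable_restrict_space_iff[of \<Omega> lebesgue \<Lambda>] by (simp add: diffusion_tensor_def)
  then have "(\<lambda>x. indicator K x *\<^sub>R (indicator \<Omega> x *\<^sub>R \<Lambda> x)) \<in> borel_measurable lebesgue"
    by (rule borel_measurable_scaleR[OF borel_measurable_indicator[OF sets(2)]])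
  also have "(\<lambda>x. indicator K x *\<^sub>R (indicator \<Omega> x *\<^sub>R \<Lambda> x)) = (\<lambda>x. indicator K x *\<^sub>R \<Lambda> x)"
    using K by (auto simp: fun_eq_iff indicator_def)
  finally have m: "(\<lambda>x. indicator K x *\<^sub>R \<Lambda> x) \<in> borel_measurable lebesgue" .
  show ?thesis
  proof (rule integrableI_bounded_set[of K])
    have "K \<in> lmeasurable" using K by (simp add: lmeasurable_open)
    then show "emeasure lebesgue K < \<infinity>" by (simp only: fmeasurable_def mem_Collect_eq infinity_ennreal_def)
    show "AE x\<in>K in lebesgue. norm (indicator K x *\<^sub>R \<Lambda> x) \<le> B"
      using B K by (intro AE_I2) auto
  qed (use sets m in auto)
qed

text \<open>With the form inside the integral, symmetry and ellipticity can be used pointwise and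
  then integrated over the cell.\<close>

lemma cell_mean_inner:
  "(cell_mean \<Lambda> K *v \<xi>) \<bullet> \<eta> = (\<integral>x. indicator K x * ((\<Lambda> x *v \<xi>) \<bullet> \<eta>) \<partial>lebesgue) / volume K"
proof -
  have "linear (\<lambda>A::real^'n^'n. (A *v \<xi>) \<bullet> \<eta>)"
    by (rule linearI) (simp_all add: matrix_vector_mult_add_rdistrib inner_add_left scaleR_matrix_vector_assoc[symmetric])
  then have bl: "bounded_linear (\<lambda>A::real^'n^'n. (A *v \<xi>) \<bullet> \<eta>)" by (simp add: linear_conv_bounded_linear)
  have "(\<integral>x. ((indicator K x *\<^sub>R \<Lambda> x) *v \<xi>) \<bullet> \<eta> \<partial>lebesgue)
      = ((\<integral>x. indicator K x *\<^sub>R \<Lambda> x \<partial>lebesgue) *v \<xi>) \<bullet> \<eta>"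
    by (rule integral_bounded_linear[OF bl integrable_tensor])
  then show ?thesis
    by (simp add: cell_mean_def set_lebesgue_integral_def scaleR_matrix_vector_assoc[symmetric])
qed

lemma cell_mean_sym: "(cell_mean \<Lambda> K *v \<xi>) \<bullet> \<eta> = \<xi> \<bullet> (cell_mean \<Lambda> K *v \<eta>)"
proof -
  have "(\<Lambda> x *v \<xi>) \<bullet> \<eta> = (\<Lambda> x *v \<eta>) \<bullet> \<xi>" if "x \<in> K" for x
  proof -
    have "transpose (\<Lambda> x) = \<Lambda> x" using \<Lambda> K that by (auto simp: diffusion_tensor_def)
    then have "\<Lambda> x *v \<xi> = \<xi> v* \<Lambda> x" using vector_transpose_matrix[of \<xi> "\<Lambda> x"] by simp
    then have "(\<Lambda> x *v \<xi>) \<bullet> \<eta> = \<xi> \<bullet> (\<Lambda> x *v \<eta>)" by (simp only: dot_lmul_matrix)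
    then show ?thesis by (simp add: inner_commute)
  qed
  then have "indicator K x * ((\<Lambda> x *v \<xi>) \<bullet> \<eta>) = indicator K x * ((\<Lambda> x *v \<eta>) \<bullet> \<xi>)" for x
    by (simp add: indicator_def)
  then have "(cell_mean \<Lambda> K *v \<xi>) \<bullet> \<eta> = (cell_mean \<Lambda> K *v \<eta>) \<bullet> \<xi>"
    unfolding cell_mean_inner by (simp only:)
  then show ?thesis by (simp add: inner_commute)
qed

lemma cell_mean_pos:
  assumes "\<xi> \<noteq> 0"
  shows "0 < (cell_mean \<Lambda> K *v \<xi>) \<bullet> \<xi>"
proof -
  obtain \<zeta> where z: "\<zeta> > 0" and ae: "AE x in lebesgue_on \<Omega>. \<forall>\<xi>. (\<Lambda> x *v \<xi>) \<bullet> \<xi> \<ge> \<zeta> * (norm \<xi>)\<^sup>2"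
    using \<Lambda> by (auto simp: diffusion_tensor_def)
  have "AE x in lebesgue. x \<in> \<Omega> \<longrightarrow> (\<forall>\<xi>. (\<Lambda> x *v \<xi>) \<bullet> \<xi> \<ge> \<zeta> * (norm \<xi>)\<^sup>2)"
    using ae \<Omega> by (simp add: AE_restrict_space_iff)
  then have le: "AE x in lebesgue. indicator K x * (\<zeta> * (norm \<xi>)\<^sup>2) \<le> indicator K x * ((\<Lambda> x *v \<xi>) \<bullet> \<xi>)"
    by eventually_elim (use K in \<open>auto simp: indicator_def\<close>)
  have lm: "K \<in> lmeasurable" using K by (simp add: lmeasurable_open)
  have bl: "bounded_linear (\<lambda>A::real^'n^'n. (A *v \<xi>) \<bullet> \<xi>)"
    unfolding linear_conv_bounded_linear[symmetric]
    by (rule linearI) (simp_all add: matrix_vector_mult_add_rdistrib inner_add_left scaleR_matrix_vector_assoc[symmetric])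
  have "integrable lebesgue (\<lambda>x. ((indicator K x *\<^sub>R \<Lambda> x) *v \<xi>) \<bullet> \<xi>)"
    by (rule integrable_bounded_linear[OF bl integrable_tensor])
  then have i: "integrable lebesgue (\<lambda>x. indicator K x * ((\<Lambda> x *v \<xi>) \<bullet> \<xi>))"
    by (simp add: scaleR_matrix_vector_assoc[symmetric])
  have j: "integrable lebesgue (\<lambda>x. indicator K x * (\<zeta> * (norm \<xi>)\<^sup>2))"
    using lm by (intro integrable_mult_left integrable_real_indicator) (auto simp: fmeasurable_def)
  have "(\<integral>x. indicator K x * (\<zeta> * (norm \<xi>)\<^sup>2) \<partial>lebesgue) \<le> (\<integral>x. indicator K x * ((\<Lambda> x *v \<xi>) \<bullet> \<xi>) \<partial>lebesgue)"
    by (rule integral_mono_AE[OF j i le])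
  then have "\<zeta> * (norm \<xi>)\<^sup>2 * volume K \<le> (cell_mean \<Lambda> K *v \<xi>) \<bullet> \<xi> * volume K"
    using lm vol by (simp add: cell_mean_inner volume_def mult.commute)
  moreover have "0 < \<zeta> * (norm \<xi>)\<^sup>2 * volume K" using z assms vol by simp
  ultimately have "0 < (cell_mean \<Lambda> K *v \<xi>) \<bullet> \<xi> * volume K" by linarith
  then show ?thesis using vol by (rule zero_less_mult_pos2)
qed

lemma invertible_cell_mean: "invertible (cell_mean \<Lambda> K)"
proof -
  have "\<forall>x. cell_mean \<Lambda> K *v x = 0 \<longrightarrow> x = 0" using cell_mean_pos by force
  then show ?thesis by (simp add: invertible_left_inverse matrix_left_invertible_ker)
qed

end

section \<open>Local matrices\<close>

definition bil :: "'i set \<Rightarrow> ('i \<Rightarrow> 'i \<Rightarrow> real) \<Rightarrow> ('i \<Rightarrow> real) \<Rightarrow> ('i \<Rightarrow> real) \<Rightarrow> real" where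
  "bil I A u w = (\<Sum>i\<in>I. \<Sum>j\<in>I. u i * A i j * w j)"

definition mv :: "'j set \<Rightarrow> ('i \<Rightarrow> 'j \<Rightarrow> real) \<Rightarrow> ('j \<Rightarrow> real) \<Rightarrow> 'i \<Rightarrow> real" where
  "mv J A u i = (\<Sum>j\<in>J. A i j * u j)"

text \<open>The congruence \<open>P^T A P\<close>.\<close>

definition congr :: "'j set \<Rightarrow> ('j \<Rightarrow> 'i \<Rightarrow> real) \<Rightarrow> ('j \<Rightarrow> 'j \<Rightarrow> real) \<Rightarrow> 'i \<Rightarrow> 'i \<Rightarrow> real" where
  "congr J P A i k = (\<Sum>j\<in>J. \<Sum>l\<in>J. P j i * A j l * P l k)"

text \<open>The vector \<open>R^T u\<close>, where \<open>R\<close> is the matrix with rows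
  \<open>R i\<close>.\<close>

definition comb :: "'i set \<Rightarrow> ('i \<Rightarrow> 'v::real_vector) \<Rightarrow> ('i \<Rightarrow> real) \<Rightarrow> 'v" where
  "comb I R u = (\<Sum>i\<in>I. u i *\<^sub>R R i)"

lemma bil_mv: "bil I A u w = (\<Sum>i\<in>I. u i * mv I A w i)"
  by (simp add: bil_def mv_def sum_distrib_left mult.assoc)

lemma bil_cong:
  assumes "\<And>i. i \<in> I \<Longrightarrow> u i = u' i" "\<And>i. i \<in> I \<Longrightarrow> w i = w' i"
    "\<And>i j. i \<in> I \<Longrightarrow> j \<in> I \<Longrightarrow> A i j = A' i j"
  shows "bil I A u w = bil I A' u' w'"
  unfolding bil_def using assms by (intro sum.cong) auto

lemma bil_add_matrix: "bil I (\<lambda>i j. A i j + B i j) u w = bil I A u w + bil I B u w"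
  by (simp add: bil_def sum.distrib algebra_simps)

lemma bil_diff_left: "bil I A (\<lambda>i. u i - v i) w = bil I A u w - bil I A v w"
  by (simp add: bil_def sum_subtractf algebra_simps)

lemma bil_diff_right: "bil I A w (\<lambda>i. u i - v i) = bil I A w u - bil I A w v"
  by (simp add: bil_def sum_subtractf algebra_simps)

lemma bil_cmult_left: "bil I A (\<lambda>i. c * u i) w = c * bil I A u w"
  by (simp add: bil_def sum_distrib_left mult_ac)

lemma bil_cmult_right: "bil I A w (\<lambda>i. c * u i) = c * bil I A w u"
  by (simp add: bil_def sum_distrib_left mult_ac)

lemma bil_sym:
  assumes "\<And>i j. i \<in> I \<Longrightarrow> j \<in> I \<Longrightarrow> A i j = A j i"
  shows "bil I A u w = bil I A w u"
proof -
  have "bil I A u w = (\<Sum>j\<in>I. \<Sum>i\<in>I. u i * A i j * w j)" unfolding bil_def by (rule sum.swap)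
  also have "\<dots> = bil I A w u" unfolding bil_def using assms by (intro sum.cong) auto
  finally show ?thesis .
qed

lemma bil_basis:
  assumes "finite I" "i \<in> I" "j \<in> I"
  shows "bil I A (\<lambda>k. of_bool (k = i)) (\<lambda>k. of_bool (k = j)) = A i j"
proof -
  have "(\<Sum>l\<in>I. of_bool (k = i) * A k l * of_bool (l = j)) = of_bool (k = i) * A k j" for k
    using assms by (simp add: of_bool_def if_distrib[of "\<lambda>x. _ * x"] sum.delta cong: if_cong)
  then show ?thesis
    using assms by (simp add: bil_def of_bool_def if_distrib[of "\<lambda>x. x * _"] sum.delta cong: if_cong)
qed

lemma bil_basis_left:
  assumes "finite I" "i \<in> I"
  shows "bil I A (\<lambda>k. of_bool (k = i)) w = mv I A w i"
  using assms by (simp add: bil_mv of_bool_def if_distrib[of "\<lambda>x. x * _"] sum.delta cong: if_cong)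

lemma bil_congr: "bil I (congr J P A) u w = bil J A (mv I P u) (mv I P w)"
proof -
  let ?F = "\<lambda>i k j l. u i * (P j i * A j l * P l k) * w k"
  have "bil I (congr J P A) u w = (\<Sum>i\<in>I. \<Sum>k\<in>I. \<Sum>j\<in>J. \<Sum>l\<in>J. ?F i k j l)"
    by (simp add: bil_def congr_def sum_distrib_left sum_distrib_right)
  also have "\<dots> = (\<Sum>i\<in>I. \<Sum>j\<in>J. \<Sum>k\<in>I. \<Sum>l\<in>J. ?F i k j l)"
    by (intro sum.cong refl sum.swap)
  also have "\<dots> = (\<Sum>j\<in>J. \<Sum>i\<in>I. \<Sum>k\<in>I. \<Sum>l\<in>J. ?F i k j l)" by (rule sum.swap)
  also have "\<dots> = (\<Sum>j\<in>J. \<Sum>i\<in>I. \<Sum>l\<in>J. \<Sum>k\<in>I. ?F i k j l)"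
    by (intro sum.cong refl sum.swap)
  also have "\<dots> = (\<Sum>j\<in>J. \<Sum>l\<in>J. \<Sum>i\<in>I. \<Sum>k\<in>I. ?F i k j l)"
    by (intro sum.cong refl sum.swap)
  also have "\<dots> = bil J A (mv I P u) (mv I P w)"
  proof -
    have "mv I P u j * A j l * mv I P w l = (\<Sum>i\<in>I. \<Sum>k\<in>I. ?F i k j l)" for j l
    proof -
      have "mv I P u j * A j l * mv I P w l = (mv I P u j * mv I P w l) * A j l" by simp
      also have "\<dots> = (\<Sum>i\<in>I. \<Sum>k\<in>I. ?F i k j l)"
        unfolding mv_def sum_product unfolding sum_distrib_right by (intro sum.cong refl) (simp add: mult_ac)
      finally show ?thesis .
    qed
    then show ?thesis by (simp add: bil_def)
  qed
  finally show ?thesis .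
qed

lemma congr_sym:
  assumes "\<And>i j. i \<in> J \<Longrightarrow> j \<in> J \<Longrightarrow> A i j = A j i"
  shows "congr J P A i k = congr J P A k i"
  using bil_sym[OF assms, where u="\<lambda>j. P j i" and w="\<lambda>j. P j k"] unfolding bil_def congr_def by simp

lemma comb_inner: "comb I R u \<bullet> \<eta> = (\<Sum>i\<in>I. u i * (R i \<bullet> \<eta>))"
  by (simp add: comb_def inner_sum_left)

lemma sym_posdef_alt:
  "sym_posdef I A \<longleftrightarrow> (\<forall>i\<in>I. \<forall>j\<in>I. A i j = A j i) \<and>
    (\<forall>w. (\<exists>i\<in>I. w i \<noteq> 0) \<longrightarrow> 0 < bil I A w w)"
  by (simp add: sym_posdef_def bil_def)

lemma sym_posdef_nonneg:
  assumes "sym_posdef I A"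
  shows "0 \<le> bil I A w w"
proof (cases "\<exists>i\<in>I. w i \<noteq> 0")
  case True
  then show ?thesis using assms by (auto simp: sym_posdef_alt less_imp_le)
next
  case False
  then have "bil I A w w = 0" by (simp add: bil_def)
  then show ?thesis by simp
qed

lemma sym_posdef_cong:
  assumes "\<And>i j. i \<in> I \<Longrightarrow> j \<in> I \<Longrightarrow> A i j = B i j"
  shows "sym_posdef I A \<longleftrightarrow> sym_posdef I B"
proof -
  have "bil I A w w = bil I B w w" for w using assms by (intro bil_cong) auto
  then show ?thesis using assms by (simp add: sym_posdef_alt)
qed

text \<open>Gaussian elimination: the Schur complement of a diagonal entry is again positive definite.\<close>

lemma sym_posdef_solve:
  assumes "finite I" "sym_posdef I A"
  shows "\<exists>u. \<forall>i\<in>I. mv I A u i = y i"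
  using assms
proof (induction I arbitrary: A y rule: finite_induct)
  case (insert k I)
  have sym: "A i j = A j i" if "i \<in> insert k I" "j \<in> insert k I" for i j
    using insert.prems that by (auto simp: sym_posdef_def)
  have pos: "0 < bil (insert k I) A w w" if "\<exists>i\<in>insert k I. w i \<noteq> 0" for w
    using insert.prems that by (auto simp: sym_posdef_alt)
  have "0 < bil (insert k I) A (\<lambda>i. of_bool (i = k)) (\<lambda>i. of_bool (i = k))" by (rule pos) auto
  then have a: "0 < A k k" using insert.hyps by (subst (asm) bil_basis) auto
  define S where "S i j = A i j - A i k * A k j / A k k" for i j
  have "sym_posdef I S"
    unfolding sym_posdef_alt
  proof (intro conjI ballI allI impI)
    show "S i j = S j i" if "i \<in> I" "j \<in> I" for i j
      using that sym[of i j] sym[of i k] sym[of k j] by (simp add: S_def)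
    fix w :: "_ \<Rightarrow> real" assume w: "\<exists>i\<in>I. w i \<noteq> 0"
    define d where "d = (\<Sum>j\<in>I. A k j * w j)"
    \<comment> \<open>This value at \<open>k\<close> minimizes the quadratic form over that
      coordinate; the minimum is the form of the Schur complement at \<open>w\<close>.\<close>
    define v where "v i = (if i = k then - d / A k k else w i)" for i
    have vI: "(\<Sum>i\<in>I. f i (v i)) = (\<Sum>i\<in>I. f i (w i))" for f :: "_ \<Rightarrow> _ \<Rightarrow> real"
      using insert.hyps by (intro sum.cong) (auto simp: v_def)
    have d2: "(\<Sum>i\<in>I. w i * A i k) = d"
      using sym by (auto simp: d_def mult.commute intro!: sum.cong)
    have "bil (insert k I) A v v = (v k * A k k * v k + (\<Sum>j\<in>I. v k * A k j * v j))
        + (\<Sum>i\<in>I. v i * A i k * v k + (\<Sum>j\<in>I. v i * A i j * v j))"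
      using insert.hyps by (simp add: bil_def)
    also have "(\<Sum>j\<in>I. v k * A k j * v j) = v k * d"
      by (simp only: vI[of "\<lambda>j x. v k * (A k j * x)"] d_def sum_distrib_left mult.assoc)
    also have "(\<Sum>i\<in>I. v i * A i k * v k + (\<Sum>j\<in>I. v i * A i j * v j)) = d * v k + bil I A w w"
    proof -
      have "(\<Sum>i\<in>I. v i * A i k * v k) = d * v k"
        by (simp only: vI[of "\<lambda>i x. x * A i k * v k"] d2[symmetric] sum_distrib_right)
      moreover have "(\<Sum>i\<in>I. \<Sum>j\<in>I. v i * A i j * v j) = bil I A w w"
        using insert.hyps unfolding bil_def by (intro sum.cong) (auto simp: v_def)
      ultimately show ?thesis by (simp add: sum.distrib)
    qed
    also have "v k * A k k * v k + v k * d + (d * v k + bil I A w w) = bil I A w w - d * d / A k k"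
      using a by (simp add: v_def field_simps)
    also have "\<dots> = bil I S w w"
    proof -
      have "bil I S w w = bil I A w w - (\<Sum>i\<in>I. \<Sum>j\<in>I. (w i * A i k) * (A k j * w j) / A k k)"
        by (simp add: bil_def S_def algebra_simps sum_subtractf)
      also have "(\<Sum>i\<in>I. \<Sum>j\<in>I. (w i * A i k) * (A k j * w j) / A k k) = d * d / A k k"
        unfolding sum_divide_distrib[symmetric] sum_product[symmetric] by (simp only: d2 d_def)
      finally show ?thesis by simp
    qed
    finally have "bil I S w w = bil (insert k I) A v v" by simp
    moreover have "\<exists>i\<in>insert k I. v i \<noteq> 0" using w insert.hyps by (auto simp: v_def)
    ultimately show "0 < bil I S w w" using pos by simp
  qed
  then obtain u where u: "mv I S u i = y i - A i k * y k / A k k" if "i \<in> I" for i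
    using insert.IH[of S "\<lambda>i. y i - A i k * y k / A k k"] by blast
  define d where "d = (\<Sum>j\<in>I. A k j * u j)"
  \<comment> \<open>Back substitution: the equation of the pivot row determines the entry at
    \<open>k\<close>.\<close>
  define v where "v i = (if i = k then (y k - d) / A k k else u i)" for i
  have vI: "(\<Sum>j\<in>I. A i j * v j) = (\<Sum>j\<in>I. A i j * u j)" for i
    using insert.hyps by (intro sum.cong) (auto simp: v_def)
  have mvv: "mv (insert k I) A v i = A i k * (y k - d) / A k k + (\<Sum>j\<in>I. A i j * u j)" for i
    using insert.hyps by (simp add: mv_def vI) (simp add: v_def)
  have "mv (insert k I) A v i = y i" if "i \<in> insert k I" for i
  proof (cases "i = k")
    case True
    then show ?thesis using a by (simp add: mvv d_def)
  next
    case False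
    with that have i: "i \<in> I" by simp
    have "mv I S u i = (\<Sum>j\<in>I. A i j * u j) - A i k * d / A k k"
      by (simp add: mv_def S_def d_def left_diff_distrib sum_subtractf sum_distrib_left sum_divide_distrib mult.assoc)
    then show ?thesis using u[OF i] by (simp add: mvv right_diff_distrib diff_divide_distrib)
  qed
  then show ?case by blast
qed simp

text \<open>The columns of \<open>W\<close> solve the systems with unit right-hand sides, so
  \<open>W\<close> is a right inverse. It is symmetric because \<open>W i k\<close> is the form
  \<open>A\<close> evaluated at two of these columns, and symmetry makes it a left inverse as
  well.\<close>

lemma sym_posdef_inverse:
  assumes fin: "finite I" and A: "sym_posdef I A"
  obtains W where "sym_posdef I W"
    "\<And>u i. i \<in> I \<Longrightarrow> mv I A (mv I W u) i = u i"
    "\<And>u i. i \<in> I \<Longrightarrow> mv I W (mv I A u) i = u i"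
proof -
  have "\<forall>k. \<exists>u. \<forall>i\<in>I. mv I A u i = of_bool (i = k)"
    by (intro allI sym_posdef_solve[OF fin A])
  then obtain Z where Z: "\<And>k i. i \<in> I \<Longrightarrow> mv I A (Z k) i = of_bool (i = k)" by metis
  define W where "W i k = Z k i" for i k
  have symA: "A i j = A j i" if "i \<in> I" "j \<in> I" for i j using A that by (auto simp: sym_posdef_def)
  have AW: "mv I A (mv I W u) i = u i" if i: "i \<in> I" for u i
  proof -
    have "mv I A (mv I W u) i = (\<Sum>j\<in>I. \<Sum>k\<in>I. A i j * (Z k j * u k))"
      by (simp add: mv_def W_def sum_distrib_left)
    also have "\<dots> = (\<Sum>k\<in>I. \<Sum>j\<in>I. A i j * (Z k j * u k))" by (rule sum.swap)
    also have "\<dots> = (\<Sum>k\<in>I. mv I A (Z k) i * u k)"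
      by (simp add: mv_def sum_distrib_right mult.assoc)
    also have "\<dots> = u i"
      using fin i by (simp add: Z of_bool_def if_distrib[of "\<lambda>x. x * _"] sum.delta' cong: if_cong)
    finally show ?thesis .
  qed
  have symW: "W i k = W k i" if "i \<in> I" "k \<in> I" for i k
  proof -
    have "bil I A (Z k) (Z i) = W i k" "bil I A (Z i) (Z k) = W k i"
      using fin that by (auto simp: bil_mv Z W_def of_bool_def if_distrib[of "\<lambda>x. _ * x"] sum.delta cong: if_cong)
    moreover have "bil I A (Z k) (Z i) = bil I A (Z i) (Z k)" by (rule bil_sym[OF symA])
    ultimately show ?thesis by simp
  qed
  have spW: "sym_posdef I W"
    unfolding sym_posdef_alt
  proof (intro conjI ballI allI impI)
    fix w :: "_ \<Rightarrow> real" assume w: "\<exists>i\<in>I. w i \<noteq> 0"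
    have "bil I W w w = (\<Sum>i\<in>I. mv I A (mv I W w) i * mv I W w i)"
      by (simp add: bil_mv AW)
    also have "\<dots> = bil I A (mv I W w) (mv I W w)" by (simp add: bil_mv mult.commute)
    also have "\<exists>i\<in>I. mv I W w i \<noteq> 0"
    proof (rule ccontr)
      assume "\<not> ?thesis"
      then have "mv I A (mv I W w) i = 0" for i by (simp add: mv_def[of I A])
      moreover obtain i where "i \<in> I" "w i \<noteq> 0" using w by blast
      ultimately show False using AW[of i w] by simp
    qed
    then have "0 < bil I A (mv I W w) (mv I W w)" using A by (simp add: sym_posdef_alt)
    finally show "0 < bil I W w w" .
  qed (use symW in auto)
  have WA: "mv I W (mv I A u) i = u i" if "i \<in> I" for u i
  proof -
    have "mv I W (mv I A u) i = (\<Sum>k\<in>I. Z i k * mv I A u k)"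
      using symW that by (auto simp: mv_def[of I W] W_def intro!: sum.cong)
    also have "\<dots> = bil I A (Z i) u" by (simp add: bil_mv)
    also have "\<dots> = bil I A u (Z i)" by (rule bil_sym[OF symA])
    also have "\<dots> = u i" using fin that by (simp add: bil_mv Z of_bool_def if_distrib[of "\<lambda>x. _ * x"] sum.delta cong: if_cong)
    finally show ?thesis .
  qed
  show ?thesis by (rule that[OF spW AW WA])
qed

section \<open>Positive definite matrices consistent with a dual pair of vector families\<close>

locale consistent_pair =
  fixes I :: "'i set" and N R :: "'i \<Rightarrow> 'v::euclidean_space" and V :: real and L :: "'v \<Rightarrow> 'v"
  assumes fin: "finite I" and V_pos: "0 < V"
    and gauss: "\<And>\<xi> \<eta>. (\<Sum>i\<in>I. (N i \<bullet> \<xi>) * (R i \<bullet> \<eta>)) = V * (\<xi> \<bullet> \<eta>)"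
    and L_linear: "linear L" and L_sym: "\<And>x y. L x \<bullet> y = x \<bullet> L y"
    and L_pos: "\<And>x. x \<noteq> 0 \<Longrightarrow> 0 < L x \<bullet> x"
begin

text \<open>The relation \<open>M N = R L\<close>. On a cell \<open>L\<close> is the inverse mean
  tensor; after exchanging \<open>N\<close> and \<open>R\<close> it is the mean tensor. For affine
  \<open>p\<close>, with fluxes \<open>-\<Lambda>\<nabla>p \<bullet> n\<close> and with
  \<open>p K\<close>, \<open>p \<sigma>\<close> the values at the cell point and the face centre, it
  says that the local relation between fluxes and pressure differences is exact.\<close>

definition admissible :: "('i \<Rightarrow> 'i \<Rightarrow> real) \<Rightarrow> bool" where
  "admissible M \<longleftrightarrow> sym_posdef I M \<and> (\<forall>\<eta>. \<forall>i\<in>I. mv I M (\<lambda>j. N j \<bullet> \<eta>) i = R i \<bullet> L \<eta>)"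

text \<open>The matrix \<open>R L R^T / V\<close>. Every admissible matrix pairs with the vectors in
  the image of \<open>N\<close> exactly as this one does.\<close>

definition rank_part :: "'i \<Rightarrow> 'i \<Rightarrow> real" where
  "rank_part i j = L (R i) \<bullet> R j / V"

text \<open>The matrix \<open>P = I - N R^T / V\<close>: the projection onto the kernel of
  \<open>R^T\<close> along the image of \<open>N\<close>.\<close>

definition proj :: "('i \<Rightarrow> real) \<Rightarrow> 'i \<Rightarrow> real" where
  "proj u i = u i - N i \<bullet> comb I R u / V"

text \<open>The common shape of the local form of the Mixed method and, with \<open>N\<close> and
  \<open>R\<close> exchanged, of the Hybrid method.\<close>

definition stab_form :: "('i \<Rightarrow> 'i \<Rightarrow> real) \<Rightarrow> ('i \<Rightarrow> real) \<Rightarrow> ('i \<Rightarrow> real) \<Rightarrow> real" where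
  "stab_form B u w = L (comb I R u) \<bullet> comb I R w / V + bil I B (proj u) (proj w)"

lemma comb_R_N: "comb I R (\<lambda>i. N i \<bullet> \<xi>) = V *\<^sub>R \<xi>"
  by (rule vector_eq_rdot[THEN iffD1], intro allI) (simp add: comb_inner gauss)

lemma comb_N_R: "comb I N (\<lambda>i. R i \<bullet> \<xi>) = V *\<^sub>R \<xi>"
proof (rule vector_eq_rdot[THEN iffD1], intro allI)
  fix \<eta> show "comb I N (\<lambda>i. R i \<bullet> \<xi>) \<bullet> \<eta> = V *\<^sub>R \<xi> \<bullet> \<eta>"
    using gauss[of \<eta> \<xi>] by (simp add: comb_inner mult.commute[of "R _ \<bullet> _"] inner_commute[of \<xi>])
qed

lemma proj_N: "proj (\<lambda>i. N i \<bullet> \<xi>) i = 0"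
  using V_pos by (simp add: proj_def comb_R_N)

lemma bil_rank_part: "bil I rank_part u w = L (comb I R u) \<bullet> comb I R w / V"
proof -
  have "L (comb I R u) = (\<Sum>i\<in>I. u i *\<^sub>R L (R i))"
    by (simp add: comb_def linear_sum[OF L_linear] linear_cmul[OF L_linear])
  then have "L (comb I R u) \<bullet> comb I R w = (\<Sum>i\<in>I. u i * (L (R i) \<bullet> comb I R w))"
    by (simp add: inner_sum_left)
  also have "\<dots> = (\<Sum>i\<in>I. \<Sum>j\<in>I. u i * (L (R i) \<bullet> R j) * w j)"
    by (simp add: comb_def inner_sum_right sum_distrib_left mult_ac)
  finally show ?thesis by (simp add: bil_def rank_part_def sum_divide_distrib)
qed

lemma rank_part_sym: "rank_part i j = rank_part j i"
  using L_sym[of "R i" "R j"] by (simp add: rank_part_def inner_commute)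

lemma rank_part_N: "bil I rank_part u (\<lambda>i. N i \<bullet> \<eta>) = comb I R u \<bullet> L \<eta>"
  using V_pos by (simp add: bil_rank_part comb_R_N L_sym linear_cmul[OF L_linear])

lemma admissible_bil_N:
  assumes "admissible M"
  shows "bil I M u (\<lambda>i. N i \<bullet> \<eta>) = comb I R u \<bullet> L \<eta>"
  using assms by (simp add: bil_mv admissible_def comb_inner)

text \<open>Off the kernel of \<open>R^T\<close> the rank part is already positive, and on this
  kernel positivity comes from \<open>Y\<close>. Since \<open>Y\<close> annihilates the image of
  \<open>N\<close>, the consistency relation is that of the rank part.\<close>

lemma admissibleI:
  assumes sym: "\<And>i j. i \<in> I \<Longrightarrow> j \<in> I \<Longrightarrow> Y i j = Y j i"
    and nonneg: "\<And>w. 0 \<le> bil I Y w w"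
    and pos: "\<And>w. comb I R w = 0 \<Longrightarrow> \<exists>i\<in>I. w i \<noteq> 0 \<Longrightarrow> 0 < bil I Y w w"
    and N: "\<And>u \<eta>. bil I Y u (\<lambda>i. N i \<bullet> \<eta>) = 0"
  shows "admissible (\<lambda>i j. rank_part i j + Y i j)"
  unfolding admissible_def sym_posdef_alt
proof (intro conjI ballI allI impI)
  fix i j assume "i \<in> I" "j \<in> I"
  then show "rank_part i j + Y i j = rank_part j i + Y j i" using sym rank_part_sym[of i j] by simp
next
  fix w :: "'i \<Rightarrow> real" assume w: "\<exists>i\<in>I. w i \<noteq> 0"
  show "0 < bil I (\<lambda>i j. rank_part i j + Y i j) w w"
  proof (cases "comb I R w = 0")
    case True
    then show ?thesis using pos[OF True w] by (simp add: bil_add_matrix bil_rank_part)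
  next
    case False
    then have "0 < L (comb I R w) \<bullet> comb I R w / V" using L_pos V_pos by simp
    then show ?thesis using nonneg[of w] by (simp add: bil_add_matrix bil_rank_part)
  qed
next
  fix \<eta> i assume i: "i \<in> I"
  have "mv I (\<lambda>i j. rank_part i j + Y i j) (\<lambda>j. N j \<bullet> \<eta>) i
      = bil I (\<lambda>i j. rank_part i j + Y i j) (\<lambda>k. of_bool (k = i)) (\<lambda>j. N j \<bullet> \<eta>)"
    using fin i by (simp add: bil_basis_left)
  also have "\<dots> = comb I R (\<lambda>k. of_bool (k = i)) \<bullet> L \<eta>"
    by (simp add: bil_add_matrix rank_part_N N)
  also have "comb I R (\<lambda>k. of_bool (k = i)) = R i"
    using fin i by (simp add: comb_def of_bool_def if_distrib[of "\<lambda>x. x *\<^sub>R _"] sum.delta cong: if_cong)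
  finally show "mv I (\<lambda>i j. rank_part i j + Y i j) (\<lambda>j. N j \<bullet> \<eta>) i = R i \<bullet> L \<eta>" .
qed

definition proj_matrix :: "'i \<Rightarrow> 'i \<Rightarrow> real" where
  "proj_matrix i j = of_bool (i = j) - N i \<bullet> R j / V"

lemma mv_proj_matrix:
  assumes "i \<in> I"
  shows "mv I proj_matrix u i = proj u i"
proof -
  have "mv I proj_matrix u i = (\<Sum>j\<in>I. of_bool (i = j) * u j) - (\<Sum>j\<in>I. N i \<bullet> R j / V * u j)"
    by (simp add: mv_def proj_matrix_def left_diff_distrib sum_subtractf)
  also have "(\<Sum>j\<in>I. of_bool (i = j) * u j) = u i"
    using fin assms by (simp add: of_bool_def if_distrib[of "\<lambda>x. x * _"] sum.delta' cong: if_cong)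
  also have "(\<Sum>j\<in>I. N i \<bullet> R j / V * u j) = N i \<bullet> comb I R u / V"
    by (simp add: comb_def inner_sum_right sum_divide_distrib mult.commute)
  finally show ?thesis by (simp add: proj_def)
qed

lemma bil_congr_proj: "bil I (congr I proj_matrix B) u w = bil I B (proj u) (proj w)"
  unfolding bil_congr by (intro bil_cong) (auto simp: mv_proj_matrix)

text \<open>The matrix is \<open>rank_part\<close> plus \<open>P^T B P\<close>. On the kernel of
  \<open>R^T\<close> the projection acts as the identity, so the positivity of \<open>B\<close> is
  preserved there.\<close>

lemma stab_form_admissible:
  assumes B: "sym_posdef I B"
  obtains M where "admissible M" "\<And>u w. stab_form B u w = bil I M u w"
proof
  let ?Y = "congr I proj_matrix B"
  show "admissible (\<lambda>i j. rank_part i j + ?Y i j)"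
  proof (rule admissibleI)
    show "?Y i j = ?Y j i" for i j using B by (intro congr_sym) (auto simp: sym_posdef_def)
    show "0 \<le> bil I ?Y w w" for w by (simp add: bil_congr_proj sym_posdef_nonneg[OF B])
    show "0 < bil I ?Y w w" if "comb I R w = 0" "\<exists>i\<in>I. w i \<noteq> 0" for w
      using B that by (simp add: bil_congr_proj sym_posdef_alt proj_def)
    show "bil I ?Y u (\<lambda>i. N i \<bullet> \<eta>) = 0" for u \<eta>
      unfolding bil_congr_proj by (simp add: bil_def proj_N)
  qed
  show "stab_form B u w = bil I (\<lambda>i j. rank_part i j + ?Y i j) u w" for u w
    by (simp add: stab_form_def bil_add_matrix bil_rank_part bil_congr_proj)
qed

text \<open>Admissibility evaluates every term of the form of \<open>M\<close> at
  \<open>proj u\<close> and \<open>proj w\<close> in which the image of \<open>N\<close> occurs. The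
  two mixed terms each subtract the rank part and the last one adds it back once, so exactly one
  rank part is missing.\<close>

lemma admissible_stab_form:
  assumes M: "admissible M"
  shows "stab_form M u w = bil I M u w"
proof -
  have sym: "bil I M u w = bil I M w u" for u w
    using M by (intro bil_sym) (auto simp: admissible_def sym_posdef_def)
  have p: "proj u = (\<lambda>i. u i - (1 / V) * (N i \<bullet> comb I R u))" for u by (auto simp: proj_def)
  have "bil I M (proj u) (proj w) = bil I M u w - comb I R u \<bullet> L (comb I R w) / V
     - comb I R w \<bullet> L (comb I R u) / V + (1 / V) * (1 / V) * (V * (comb I R u \<bullet> L (comb I R w)))"
    unfolding p bil_diff_left bil_diff_right bil_cmult_left bil_cmult_right
    by (simp add: admissible_bil_N[OF M] sym[of "\<lambda>i. N i \<bullet> _" w] comb_R_N)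
  then show ?thesis
    using V_pos by (simp add: stab_form_def L_sym inner_commute)
qed

lemma admissible_decomposition:
  assumes M: "admissible M" and ij: "i \<in> I" "j \<in> I"
  shows "M i j = rank_part i j + congr I proj_matrix M i j"
  using admissible_stab_form[OF M, of "\<lambda>k. of_bool (k = i)" "\<lambda>k. of_bool (k = j)"] fin ij
  by (simp add: stab_form_def bil_congr_proj[symmetric] bil_rank_part[symmetric] bil_basis)

lemma admissible_factor:
  assumes C: "mat_im I J C = {v \<in> extensional I. comb I N v = 0}" and fJ: "finite J"
    and U: "sym_posdef J U"
  shows "admissible (\<lambda>i j. rank_part i j + congr J (\<lambda>l k. C k l) U i j)"
proof (rule admissibleI)
  let ?Y = "congr J (\<lambda>l k. C k l) U"
  have col: "comb I N (\<lambda>k. C k l) = 0" if "l \<in> J" for l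
  proof -
    have "(\<lambda>i\<in>I. \<Sum>j\<in>J. C i j * of_bool (j = l)) \<in> mat_im I J C"
      unfolding mat_im_def mem_Collect_eq by (rule exI[of _ "\<lambda>j. of_bool (j = l)"]) simp
    then have "comb I N (\<lambda>i\<in>I. \<Sum>j\<in>J. C i j * of_bool (j = l)) = 0" using C by blast
    moreover have "(\<Sum>j\<in>J. C i j * of_bool (j = l)) = C i l" for i
      using that fJ by (simp add: of_bool_def if_distrib[of "\<lambda>x. _ * x"] sum.delta cong: if_cong)
    ultimately show ?thesis by (simp add: comb_def)
  qed
  show "?Y i j = ?Y j i" for i j using U by (intro congr_sym) (auto simp: sym_posdef_def)
  show "0 \<le> bil I ?Y w w" for w by (simp add: bil_congr sym_posdef_nonneg[OF U])
  show "bil I ?Y u (\<lambda>i. N i \<bullet> \<eta>) = 0" for u \<eta>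
  proof -
    have "mv I (\<lambda>l k. C k l) (\<lambda>i. N i \<bullet> \<eta>) l = comb I N (\<lambda>k. C k l) \<bullet> \<eta>" for l
      by (simp add: mv_def comb_inner)
    then have "mv I (\<lambda>l k. C k l) (\<lambda>i. N i \<bullet> \<eta>) l = 0" if "l \<in> J" for l using col that by simp
    then show ?thesis unfolding bil_congr by (simp add: bil_def)
  qed
  show "0 < bil I ?Y w w" if w: "comb I R w = 0" "\<exists>i\<in>I. w i \<noteq> 0" for w
  proof (rule ccontr)
    assume "\<not> 0 < bil I ?Y w w"
    then have orth: "mv I (\<lambda>l k. C k l) w l = 0" if "l \<in> J" for l
      using U that unfolding bil_congr sym_posdef_alt by blast
    \<comment> \<open>The oblique projection of \<open>w\<close> onto the kernel of
      \<open>N^T\<close> along the image of \<open>R\<close>. As an element of the image of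
      \<open>C\<close>, \<open>v\<close> is orthogonal to \<open>w\<close>; but
      \<open>R^T w = 0\<close> makes this inner product equal to the squared norm of
      \<open>w\<close>.\<close>
    define v where "v = (\<lambda>i\<in>I. w i - R i \<bullet> comb I N w / V)"
    have "comb I N v = comb I N w - (1 / V) *\<^sub>R comb I N (\<lambda>i. R i \<bullet> comb I N w)"
      by (simp add: v_def comb_def scaleR_diff_left sum_subtractf scaleR_sum_right)
    then have "comb I N v = 0" using V_pos by (simp add: comb_N_R)
    then have "v \<in> mat_im I J C" unfolding C by (simp add: v_def)
    then obtain z where z: "v = (\<lambda>i\<in>I. \<Sum>j\<in>J. C i j * z j)" by (auto simp: mat_im_def)
    have "(\<Sum>i\<in>I. w i * v i) = (\<Sum>i\<in>I. \<Sum>j\<in>J. C i j * w i * z j)"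
      by (simp add: z sum_distrib_left mult_ac)
    also have "\<dots> = (\<Sum>j\<in>J. \<Sum>i\<in>I. C i j * w i * z j)" by (rule sum.swap)
    also have "\<dots> = (\<Sum>j\<in>J. mv I (\<lambda>l k. C k l) w j * z j)" by (simp add: mv_def sum_distrib_right)
    also have "\<dots> = 0" by (simp add: orth)
    finally have "(\<Sum>i\<in>I. w i * v i) = 0" .
    moreover have "(\<Sum>i\<in>I. w i * v i) = (\<Sum>i\<in>I. w i * w i) - comb I R w \<bullet> comb I N w / V"
      by (simp add: v_def right_diff_distrib sum_subtractf comb_inner sum_divide_distrib)
    ultimately have "(\<Sum>i\<in>I. w i * w i) = 0" using w by simp
    then show False using w fin by (simp add: sum_nonneg_eq_0_iff)
  qed
qed

lemma eq_0_if_N_orthogonal: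
  assumes "\<And>i. i \<in> I \<Longrightarrow> N i \<bullet> \<xi> = 0"
  shows "\<xi> = 0"
  using gauss[of \<xi> \<xi>] assms V_pos by simp

text \<open>
  Faces whose vectors form a basis are eliminated; the remaining coordinates parametrize the kernel,
  and in these coordinates the factor \<open>U\<close> is a submatrix of the matrix to be factorized.
\<close>

lemma admissible_imp_factor:
  assumes M: "admissible M"
  obtains C U where "mat_im I {..<card I - DIM('v)} C = {v \<in> extensional I. comb I N v = 0}"
    "sym_posdef {..<card I - DIM('v)} U"
    "\<And>i j. i \<in> I \<Longrightarrow> j \<in> I \<Longrightarrow> M i j = rank_part i j + congr {..<card I - DIM('v)} (\<lambda>l k. C k l) U i j"
proof -
  let ?m = "card I - DIM('v)"
  obtain Bs where Bs: "Bs \<subseteq> N ` I" "independent Bs" "N ` I \<subseteq> span Bs"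
    using maximal_independent_subset[of "N ` I"] by blast
  \<comment> \<open>By \<open>R^T N = V I\<close> the matrix \<open>N\<close> is injective, so its
    rows span the whole space and a basis can be selected among them.\<close>
  have spanBs: "span Bs = UNIV"
  proof (rule ccontr)
    assume "span Bs \<noteq> UNIV"
    then obtain a where a: "a \<noteq> 0" "\<And>x. x \<in> span Bs \<Longrightarrow> a \<bullet> x = 0"
      using span_not_UNIV_orthogonal[of Bs] by blast
    have "N i \<bullet> a = 0" if "i \<in> I" for i using a(2)[of "N i"] Bs(3) that by (auto simp: inner_commute)
    then show False using eq_0_if_N_orthogonal a(1) by blast
  qed
  obtain J0 where J0: "J0 \<subseteq> I" "inj_on N J0" "Bs = N ` J0"
    using Bs(1) unfolding subset_image_inj by blast
  have fJ0: "finite J0" using J0 fin by (blast intro: finite_subset)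
  have cJ0: "card J0 = DIM('v)"
    using dim_eq_card[of Bs UNIV] Bs(2) spanBs J0 by (simp add: card_image)
  define J' where "J' = I - J0"
  have I: "I = J0 \<union> J'" "J0 \<inter> J' = {}" using J0 by (auto simp: J'_def)
  have fJ': "finite J'" using fin by (simp add: J'_def)
  \<comment> \<open>The subtraction of natural numbers is not truncated, as the basis is indexed by
    a subset of \<open>I\<close>.\<close>
  have "card J' = ?m" using J0 fJ0 cJ0 by (simp add: J'_def card_Diff_subset)
  then obtain h where h: "bij_betw h {..<?m} J'"
    using fJ' by (metis bij_betw_iff_card card_lessThan finite_lessThan)
  have hJ: "h l \<in> J'" if "l < ?m" for l using h that by (auto simp: bij_betw_def)
  have sumJ': "(\<Sum>l<?m. f (h l)) = (\<Sum>i\<in>J'. f i)" for f :: "'i \<Rightarrow> real"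
    by (rule sum.reindex_bij_betw[OF h])
  have sumJ'2: "(\<Sum>l<?m. \<Sum>k<?m. f (h l) (h k)) = (\<Sum>i\<in>J'. \<Sum>j\<in>J'. f i j)" for f :: "'i \<Rightarrow> 'i \<Rightarrow> real"
  proof -
    have "(\<Sum>k<?m. f (h l) (h k)) = (\<Sum>j\<in>J'. f (h l) j)" for l by (rule sumJ')
    then show ?thesis using sumJ'[of "\<lambda>i. \<Sum>j\<in>J'. f i j"] by simp
  qed
  have sumI: "(\<Sum>i\<in>I. f i) = (\<Sum>i\<in>J0. f i) + (\<Sum>i\<in>J'. f i)" for f :: "'i \<Rightarrow> 'z::comm_monoid_add"
    using I fJ0 fJ' by (metis sum.union_disjoint)
  have "\<exists>\<beta>. N i = (\<Sum>k\<in>J0. \<beta> k *\<^sub>R N k)" for i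
  proof -
    have "N i \<in> span (N ` J0)" using spanBs J0(3) by simp
    then obtain u where "N i = (\<Sum>v\<in>N ` J0. u v *\<^sub>R v)" using fJ0 by (auto simp: span_finite)
    then have "N i = (\<Sum>k\<in>J0. u (N k) *\<^sub>R N k)" using J0(2) by (simp add: sum.reindex)
    then show ?thesis by (rule exI[of _ "\<lambda>k. u (N k)"])
  qed
  then obtain \<beta> where \<beta>: "\<And>i. N i = (\<Sum>k\<in>J0. \<beta> i k *\<^sub>R N k)" by metis
  \<comment> \<open>For \<open>j\<close> in \<open>J'\<close>, column \<open>j\<close> is the kernel
    vector with free coordinate 1 at \<open>j\<close> and 0 at the other elements of
    \<open>J'\<close>; its entries on \<open>J0\<close> cancel \<open>N j\<close> expressed in the
    basis.\<close>
  define D where "D i j = (if i \<in> J0 then - \<beta> j i else of_bool (i = j))" for i j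
  define C where "C i l = D i (h l)" for i l
  have DN: "comb I N (\<lambda>i. D i j) = 0" if "j \<in> J'" for j
  proof -
    have "comb I N (\<lambda>i. D i j) = (\<Sum>i\<in>J0. - (\<beta> j i *\<^sub>R N i)) + (\<Sum>i\<in>J'. of_bool (i = j) *\<^sub>R N i)"
      unfolding comb_def sumI using I by (intro arg_cong2[of _ _ _ _ "(+)"] sum.cong) (auto simp: D_def)
    also have "(\<Sum>i\<in>J'. of_bool (i = j) *\<^sub>R N i) = N j"
      using that fJ' by (simp add: of_bool_def if_distrib[of "\<lambda>x. x *\<^sub>R _"] sum.delta cong: if_cong)
    finally show ?thesis using \<beta>[of j] by (simp add: sum_negf)
  qed
  have indep0: "d i = 0" if "(\<Sum>k\<in>J0. d k *\<^sub>R N k) = 0" "i \<in> J0" for d i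
  proof -
    let ?u = "\<lambda>v. d (the_inv_into J0 N v)"
    have "(\<Sum>v\<in>Bs. ?u v *\<^sub>R v) = (\<Sum>k\<in>J0. d k *\<^sub>R N k)"
      unfolding J0(3) using J0(2) by (simp add: sum.reindex the_inv_into_f_f)
    then have "?u (N i) = 0"
      using Bs(2) that J0(3) fJ0 independentD[of Bs Bs ?u "N i"] by auto
    then show ?thesis using J0(2) that(2) by (simp add: the_inv_into_f_f)
  qed
  \<comment> \<open>A vector in the kernel of \<open>N^T\<close> is determined by its coordinates in
    \<open>J'\<close>: the difference \<open>d\<close> vanishes there, and then on \<open>J0\<close>
    by independence of the basis rows.\<close>
  have ker: "v i = (\<Sum>j\<in>J'. D i j * v j)" if v: "comb I N v = 0" and i: "i \<in> I" for v i
  proof -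
    define d where "d i = v i - (\<Sum>j\<in>J'. D i j * v j)" for i
    have d': "d i = 0" if "i \<in> J'" for i
    proof -
      have "i \<notin> J0" using that I by blast
      then show ?thesis using that fJ' by (auto simp: d_def D_def of_bool_def if_distrib[of "\<lambda>x. x * _"] sum.delta sum.delta' cong: if_cong)
    qed
    have "comb I N d = comb I N v - (\<Sum>i\<in>I. \<Sum>j\<in>J'. (D i j * v j) *\<^sub>R N i)"
      by (simp add: comb_def d_def scaleR_diff_left sum_subtractf scaleR_sum_left)
    also have "(\<Sum>i\<in>I. \<Sum>j\<in>J'. (D i j * v j) *\<^sub>R N i) = (\<Sum>j\<in>J'. \<Sum>i\<in>I. (D i j * v j) *\<^sub>R N i)"
      by (rule sum.swap)
    also have "\<dots> = (\<Sum>j\<in>J'. v j *\<^sub>R comb I N (\<lambda>i. D i j))"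
      by (simp add: comb_def scaleR_sum_right mult.commute)
    also have "\<dots> = 0" by (simp add: DN)
    finally have "(\<Sum>k\<in>J0. d k *\<^sub>R N k) = 0" using v d' by (simp add: comb_def sumI)
    then have "d i = 0" using i I d' indep0 by blast
    then show ?thesis by (simp add: d_def)
  qed
  have im: "mat_im I {..<?m} C = {v \<in> extensional I. comb I N v = 0}"
  proof (intro set_eqI iffI)
    fix v assume "v \<in> mat_im I {..<?m} C"
    then obtain w where w: "v = (\<lambda>i\<in>I. \<Sum>l<?m. C i l * w l)" by (auto simp: mat_im_def)
    have "comb I N v = (\<Sum>i\<in>I. \<Sum>l<?m. (C i l * w l) *\<^sub>R N i)"
      by (simp add: w comb_def scaleR_sum_left)
    also have "\<dots> = (\<Sum>l<?m. \<Sum>i\<in>I. (C i l * w l) *\<^sub>R N i)" by (rule sum.swap)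
    also have "\<dots> = (\<Sum>l<?m. w l *\<^sub>R comb I N (\<lambda>i. D i (h l)))"
      by (simp add: comb_def C_def scaleR_sum_right mult.commute)
    also have "\<dots> = 0" using hJ by (simp add: DN)
    finally show "v \<in> {v \<in> extensional I. comb I N v = 0}" by (simp add: w)
  next
    fix v assume v: "v \<in> {v \<in> extensional I. comb I N v = 0}"
    have "v = (\<lambda>i\<in>I. \<Sum>l<?m. C i l * v (h l))"
    proof
      fix i show "v i = (\<lambda>i\<in>I. \<Sum>l<?m. C i l * v (h l)) i"
      proof (cases "i \<in> I")
        case True
        then show ?thesis using ker[of v i] v sumJ'[of "\<lambda>j. D i j * v j"] by (simp add: C_def)
      qed (use v in \<open>simp add: extensional_def\<close>)
    qed
    then show "v \<in> mat_im I {..<?m} C" unfolding mat_im_def mem_Collect_eq by (intro exI[of _ "\<lambda>l. v (h l)"]) auto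
  qed
  define Y where "Y = congr I proj_matrix M"
  define U where "U l k = Y (h l) (h k)" for l k
  have Ysym: "Y i j = Y j i" for i j
    unfolding Y_def using M by (intro congr_sym) (auto simp: admissible_def sym_posdef_def)
  have Yker: "comb I N (\<lambda>i. Y i j) = 0" if j: "j \<in> I" for j
  proof (rule vector_eq_rdot[THEN iffD1], intro allI)
    fix \<eta>
    have "comb I N (\<lambda>i. Y i j) \<bullet> \<eta> = mv I Y (\<lambda>i. N i \<bullet> \<eta>) j"
      by (simp add: comb_inner mv_def Ysym[of j])
    also have "\<dots> = bil I M (proj (\<lambda>k. of_bool (k = j))) (proj (\<lambda>i. N i \<bullet> \<eta>))"
      using fin j by (simp add: bil_basis_left[symmetric] bil_congr_proj Y_def)
    also have "\<dots> = 0" by (simp add: proj_N bil_def)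
    finally show "comb I N (\<lambda>i. Y i j) \<bullet> \<eta> = 0 \<bullet> \<eta>" by simp
  qed
  \<comment> \<open>By \<open>P N = 0\<close> the rows and columns of the symmetric matrix
    \<open>Y\<close> lie in the kernel of \<open>N^T\<close>. Reconstructing both from their
    coordinates in \<open>J'\<close> writes \<open>Y\<close> as its block on \<open>J'\<close>
    multiplied by \<open>D\<close> from the left and \<open>D^T\<close> from the right.\<close>
  have Yfac: "Y i j = congr {..<?m} (\<lambda>l k. C k l) U i j" if ij: "i \<in> I" "j \<in> I" for i j
  proof -
    have "Y i j = (\<Sum>k\<in>J'. D i k * Y k j)" by (rule ker[OF Yker]) (use ij in auto)
    also have "\<dots> = (\<Sum>k\<in>J'. D i k * (\<Sum>l\<in>J'. D j l * Y l k))"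
    proof (rule sum.cong[OF refl])
      fix k assume "k \<in> J'"
      then have "Y j k = (\<Sum>l\<in>J'. D j l * Y l k)" using I ij by (intro ker[OF Yker]) auto
      then show "D i k * Y k j = D i k * (\<Sum>l\<in>J'. D j l * Y l k)" using Ysym[of k j] by simp
    qed
    also have "\<dots> = (\<Sum>k\<in>J'. \<Sum>l\<in>J'. D i k * Y k l * D j l)"
      by (simp add: sum_distrib_left mult_ac) (simp add: Ysym)
    also have "\<dots> = congr {..<?m} (\<lambda>l k. C k l) U i j"
      using sumJ'2[of "\<lambda>k l. D i k * Y k l * D j l"] by (simp add: congr_def C_def U_def)
    finally show ?thesis .
  qed
  have "sym_posdef {..<?m} U"
    unfolding sym_posdef_alt
  proof (intro conjI ballI allI impI)
    show "U l k = U k l" for l k by (simp add: U_def Ysym)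
    fix w :: "nat \<Rightarrow> real" assume w: "\<exists>l\<in>{..<?m}. w l \<noteq> 0"
    \<comment> \<open>Extension of \<open>w\<close> by zero to the basis indices, which turns the
      form of the submatrix into that of \<open>Y\<close>.\<close>
    define z where "z i = (if i \<in> J' then w (the_inv_into {..<?m} h i) else 0)" for i
    have zh: "z (h l) = w l" if "l < ?m" for l
      using h hJ that by (auto simp: z_def bij_betw_def the_inv_into_f_f)
    have "bil {..<?m} U w w = (\<Sum>l<?m. \<Sum>k<?m. z (h l) * Y (h l) (h k) * z (h k))"
      by (simp add: bil_def U_def zh)
    also have "\<dots> = (\<Sum>i\<in>J'. \<Sum>j\<in>J'. z i * Y i j * z j)"
      by (rule sumJ'2)
    also have "\<dots> = bil I Y z z"
    proof -
      have "z i = 0" if "i \<in> J0" for i using I that by (auto simp: z_def)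
      then show ?thesis by (simp add: bil_def sumI)
    qed
    also have "\<dots> = bil I M (proj z) (proj z)" unfolding Y_def by (rule bil_congr_proj)
    also have "\<exists>i\<in>I. proj z i \<noteq> 0"
    proof (rule ccontr)
      assume "\<not> ?thesis"
      \<comment> \<open>A vector killed by the projection is in the image of \<open>N\<close>. As
        \<open>z\<close> vanishes on \<open>J0\<close>, its preimage is orthogonal to a basis, hence
        zero, and so is \<open>z\<close>.\<close>
      then have p0: "z i = N i \<bullet> comb I R z / V" if "i \<in> I" for i using that by (simp add: proj_def)
      have "N i \<bullet> comb I R z = 0" if "i \<in> J0" for i
      proof -
        have "i \<in> I" "i \<notin> J'" using that I by blast+
        then show ?thesis using p0[of i] V_pos by (simp add: z_def)
      qed
      then have "comb I R z \<bullet> b = 0" if "b \<in> Bs" for b using that J0(3) by (auto simp: inner_commute)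
      then have "comb I R z = 0"
        using orthogonal_to_span[of "comb I R z" Bs "comb I R z"] spanBs by (simp add: orthogonal_def)
      then have "z i = 0" if "i \<in> I" for i using p0 that by simp
      then have "w l = 0" if "l < ?m" for l using zh[OF that] hJ[OF that] I by auto
      then show False using w by auto
    qed
    then have "0 < bil I M (proj z) (proj z)" using M by (simp add: admissible_def sym_posdef_alt)
    finally show "0 < bil {..<?m} U w w" .
  qed
  moreover have "M i j = rank_part i j + congr {..<?m} (\<lambda>l k. C k l) U i j" if "i \<in> I" "j \<in> I" for i j
    using admissible_decomposition[OF M that] Yfac[OF that] by (simp add: Y_def)
  ultimately show ?thesis by (rule that[OF im])
qed

end

text \<open>Transposing \<open>R^T N = V I\<close> exchanges the two families. Positivity makes
  \<open>L\<close> injective, so linearity, symmetry and positivity can be pulled back to the right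
  inverse \<open>L'\<close>.\<close>

lemma consistent_pair_dual:
  assumes "consistent_pair I N R V L" and L': "\<And>x. L (L' x) = x"
  shows "consistent_pair I R N V L'"
proof -
  interpret consistent_pair I N R V L by fact
  have inj: "x = y" if "L x = L y" for x y
  proof (rule ccontr)
    assume "x \<noteq> y"
    then have "0 < L (x - y) \<bullet> (x - y)" by (intro L_pos) simp
    then show False using that by (simp add: linear_diff[OF L_linear])
  qed
  show ?thesis
  proof (rule consistent_pair.intro)
    show "(\<Sum>i\<in>I. (R i \<bullet> \<xi>) * (N i \<bullet> \<eta>)) = V * (\<xi> \<bullet> \<eta>)" for \<xi> \<eta>
      using gauss[of \<eta> \<xi>] by (simp add: mult.commute inner_commute)
    show "linear L'"
      by (rule linearI; rule inj) (simp_all add: L' linear_add[OF L_linear] linear_cmul[OF L_linear])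
    show "L' x \<bullet> y = x \<bullet> L' y" for x y
      using L_sym[of "L' x" "L' y"] by (simp add: L')
    show "0 < L' x \<bullet> x" if "x \<noteq> 0" for x
    proof -
      have "L' x \<noteq> 0" using L'[of x] that linear_0[OF L_linear] by auto
      then show ?thesis using L_pos[of "L' x"] by (simp add: L' inner_commute)
    qed
  qed (use fin V_pos in auto)
qed

text \<open>Multiplying \<open>M N = R L\<close> by \<open>W\<close> on the left and by
  \<open>L'\<close> on the right gives \<open>W R = N L'\<close>, the consistency relation of the
  exchanged pair.\<close>

lemma admissible_inverse:
  assumes cp: "consistent_pair I N R V L" and L': "\<And>x. L (L' x) = x"
    and M: "consistent_pair.admissible I N R L M"
  obtains W where "consistent_pair.admissible I R N L' W"
    "\<And>u i. i \<in> I \<Longrightarrow> mv I M (mv I W u) i = u i"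
    "\<And>u i. i \<in> I \<Longrightarrow> mv I W (mv I M u) i = u i"
proof -
  interpret consistent_pair I N R V L by fact
  interpret dual: consistent_pair I R N V L' using consistent_pair_dual[OF cp L'] .
  obtain W where W: "sym_posdef I W" "\<And>u i. i \<in> I \<Longrightarrow> mv I M (mv I W u) i = u i"
    "\<And>u i. i \<in> I \<Longrightarrow> mv I W (mv I M u) i = u i"
    using sym_posdef_inverse[OF fin] M unfolding admissible_def by blast
  have "mv I W (\<lambda>j. R j \<bullet> \<eta>) i = N i \<bullet> L' \<eta>" if i: "i \<in> I" for \<eta> i
  proof -
    have "mv I W (\<lambda>j. R j \<bullet> \<eta>) i = mv I W (mv I M (\<lambda>j. N j \<bullet> L' \<eta>)) i"
      unfolding mv_def[of I W] using M by (intro sum.cong) (auto simp: admissible_def L')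
    then show ?thesis using W(3)[OF i] by simp
  qed
  then have "dual.admissible W" using W(1) by (simp add: dual.admissible_def)
  then show ?thesis using W(2,3) by (rule that)
qed

section \<open>Matrix form of the schemes\<close>

text \<open>The normal form through which every comparison passes. Pressure differences are weighted
  by areas, because then the consistency relation has \<open>R\<close> on its right-hand
  side.\<close>

definition matrix_scheme ::
  "'n pset \<Rightarrow> 'n pset set \<Rightarrow> ('n::finite pset \<Rightarrow> 'n pset set) \<Rightarrow>
   ('n pset \<Rightarrow> 'n pset \<Rightarrow> 'n pset \<Rightarrow> real) \<Rightarrow> (real^'n \<Rightarrow> real) \<Rightarrow> ('n hyb \<times> 'n fluxes) set" where
  "matrix_scheme \<Omega> M E A f =
     {((p, ps), F). (p, ps) \<in> hybrid_space \<Omega> M E \<and> F \<in> flux_space \<Omega> M E \<and>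
        (\<forall>K\<in>M. (\<Sum>\<sigma>\<in>E K. face_area \<sigma> * F K \<sigma>) = (LINT y:K|lebesgue. f y) \<and>
           (\<forall>\<sigma>\<in>E K. mv (E K) (A K) (F K) \<sigma> = face_area \<sigma> * (p K - ps \<sigma>)))}"

lemma matrix_scheme_cong:
  assumes "\<And>K \<sigma> \<tau>. K \<in> M \<Longrightarrow> \<sigma> \<in> E K \<Longrightarrow> \<tau> \<in> E K \<Longrightarrow> A K \<sigma> \<tau> = A' K \<sigma> \<tau>"
  shows "matrix_scheme \<Omega> M E A f = matrix_scheme \<Omega> M E A' f"
proof -
  have "mv (E K) (A K) u \<sigma> = mv (E K) (A' K) u \<sigma>" if "K \<in> M" "\<sigma> \<in> E K" for K u \<sigma>
    unfolding mv_def using assms that by (intro sum.cong) auto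
  then show ?thesis unfolding matrix_scheme_def by (intro Collect_cong) auto
qed

lemma sum_eq_all_iff:
  fixes a b :: "'i \<Rightarrow> real"
  assumes fin: "finite I"
  shows "(\<forall>w. (\<Sum>i\<in>I. w i * a i) = (\<Sum>i\<in>I. w i * b i)) \<longleftrightarrow> (\<forall>i\<in>I. a i = b i)"
proof
  assume *: "\<forall>w. (\<Sum>i\<in>I. w i * a i) = (\<Sum>i\<in>I. w i * b i)"
  show "\<forall>i\<in>I. a i = b i"
  proof
    fix i assume "i \<in> I"
    then show "a i = b i"
      using *[rule_format, of "\<lambda>k. of_bool (k = i)"] fin
      by (simp add: of_bool_def if_distrib[of "\<lambda>x. x * _"] sum.delta cong: if_cong)
  qed
qed auto

text \<open>Only one cell and its local unknowns are involved, so the matrices can be chosen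
  independently on each cell; likewise for \<open>hybrid_represents\<close>.\<close>

definition mixed_represents ::
  "(real^'n \<Rightarrow> real^'n^'n) \<Rightarrow> ('n::finite pset \<Rightarrow> 'n pset set) \<Rightarrow> ('n pset \<Rightarrow> real^'n) \<Rightarrow>
   ('n pset \<Rightarrow> 'n pset \<Rightarrow> 'n pset \<Rightarrow> real) \<Rightarrow> 'n pset \<Rightarrow> ('n pset \<Rightarrow> 'n pset \<Rightarrow> real) \<Rightarrow> bool" where
  "mixed_represents \<Lambda> E x B K A \<longleftrightarrow> (\<forall>F p ps.
    (\<forall>G. mixed_form E \<Lambda> x B K F G = (\<Sum>\<sigma>\<in>E K. (p - ps \<sigma>) * face_area \<sigma> * G \<sigma>)) \<longleftrightarrow>
    (\<forall>\<sigma>\<in>E K. mv (E K) A F \<sigma> = face_area \<sigma> * (p - ps \<sigma>)))"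

definition hybrid_represents ::
  "(real^'n \<Rightarrow> real^'n^'n) \<Rightarrow> ('n::finite pset \<Rightarrow> 'n pset set) \<Rightarrow> ('n pset \<Rightarrow> real^'n) \<Rightarrow>
   ('n pset \<Rightarrow> 'n pset \<Rightarrow> real) \<Rightarrow> 'n pset \<Rightarrow> ('n pset \<Rightarrow> 'n pset \<Rightarrow> real) \<Rightarrow> bool" where
  "hybrid_represents \<Lambda> E x B K A \<longleftrightarrow> (\<forall>F p ps.
    (\<forall>q qs. (\<Sum>\<sigma>\<in>E K. face_area \<sigma> * F \<sigma> * (q - qs \<sigma>)) =
        volume K * ((cell_mean \<Lambda> K *v hybrid_grad E K p ps) \<bullet> hybrid_grad E K q qs) +
        (\<Sum>\<sigma>\<in>E K. \<Sum>\<tau>\<in>E K. hybrid_stab E x K q qs \<sigma> * B \<sigma> \<tau> * hybrid_stab E x K p ps \<tau>)) \<longleftrightarrow>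
    (\<forall>\<sigma>\<in>E K. mv (E K) A F \<sigma> = face_area \<sigma> * (p - ps \<sigma>)))"

section \<open>The local forms of the three methods on one cell\<close>

locale mesh_cell =
  fixes \<Omega> K :: "(real^'n) set" and \<Lambda> :: "real^'n \<Rightarrow> real^'n^'n"
    and E :: "(real^'n) set \<Rightarrow> (real^'n) set set" and x :: "(real^'n) set \<Rightarrow> real^'n"
  assumes \<Omega>: "open \<Omega>" and \<Lambda>: "diffusion_tensor \<Omega> \<Lambda>"
    and K: "K \<noteq> {}" "open K" "bounded K" "K \<subseteq> \<Omega>"
    and fr: "(\<Union>\<sigma>\<in>E K. closure \<sigma>) = frontier K" and finE: "finite (E K)"
    and faces: "\<And>\<sigma>. \<sigma> \<in> E K \<Longrightarrow> is_face K \<sigma>" and dj: "pairwise disjnt (E K)"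
begin

abbreviation "N \<equiv> outward_normal K"
abbreviation "R \<equiv> \<lambda>\<sigma>. face_area \<sigma> *\<^sub>R (face_center \<sigma> - x K)"
abbreviation "T \<equiv> cell_mean \<Lambda> K"
abbreviation "L \<equiv> \<lambda>v. matrix_inv T *v v"
abbreviation "\<Lambda>m \<equiv> \<lambda>v. T *v v"

lemma vol: "0 < volume K"
  using volume_pos[OF K(2,3) fr[symmetric] finE faces dj K(1)] .

lemma inv: "T ** matrix_inv T = mat 1" "matrix_inv T ** T = mat 1"
proof -
  have "invertible T" by (rule invertible_cell_mean[OF \<Omega> \<Lambda> K(2-4) vol])
  then have "T ** matrix_inv T = mat 1 \<and> matrix_inv T ** T = mat 1"
    unfolding invertible_def matrix_inv_def by (rule someI_ex)
  then show "T ** matrix_inv T = mat 1" "matrix_inv T ** T = mat 1" by auto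
qed

lemma TL: "T *v (matrix_inv T *v v) = v" and LT: "matrix_inv T *v (T *v v) = v"
  by (simp_all add: matrix_vector_mul_assoc inv)

lemma area: "\<sigma> \<in> E K \<Longrightarrow> 0 < face_area \<sigma>"
  using faces by (rule face_area_pos)

text \<open>The pair with \<open>R\<close> and \<open>N\<close> exchanged is established first
  because its operator is the mean tensor itself, whose symmetry and positivity are known; duality
  then supplies the pair with the inverse tensor.\<close>

sublocale dual: consistent_pair "E K" R N "volume K" \<Lambda>m
proof (rule consistent_pair.intro)
  show "(\<Sum>\<sigma>\<in>E K. (R \<sigma> \<bullet> \<xi>) * (N \<sigma> \<bullet> \<eta>)) = volume K * (\<xi> \<bullet> \<eta>)" for \<xi> \<eta>
    using cell_gauss[OF K(2,3) fr[symmetric] finE faces dj, of \<eta> "x K" \<xi>]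
    by (simp add: mult.commute inner_commute)
  show "(T *v a) \<bullet> b = a \<bullet> (T *v b)" for a b by (rule cell_mean_sym[OF \<Omega> \<Lambda> K(2-4) vol])
  show "0 < (T *v a) \<bullet> a" if "a \<noteq> 0" for a by (rule cell_mean_pos[OF \<Omega> \<Lambda> K(2-4) vol that])
qed (rule finE vol matrix_vector_mul_linear)+

sublocale consistent_pair "E K" N R "volume K" L
  by (rule consistent_pair_dual[OF dual.consistent_pair_axioms TL])

lemma mixed_v_eq: "mixed_v E \<Lambda> x K u = - (1 / volume K) *\<^sub>R L (comb (E K) R u)"
  unfolding mixed_v_def
proof (rule the_equality)
  have c: "(\<Sum>\<sigma>\<in>E K. (face_area \<sigma> * u \<sigma>) *\<^sub>R (face_center \<sigma> - x K)) = comb (E K) R u"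
    by (simp add: comb_def mult.commute)
  show "volume K *\<^sub>R (T *v (- (1 / volume K) *\<^sub>R L (comb (E K) R u))) =
      - (\<Sum>\<sigma>\<in>E K. (face_area \<sigma> * u \<sigma>) *\<^sub>R (face_center \<sigma> - x K))"
    using vol unfolding c by (simp add: linear_cmul[OF dual.L_linear] linear_neg[OF dual.L_linear] TL)
  fix v assume "volume K *\<^sub>R (T *v v) = - (\<Sum>\<sigma>\<in>E K. (face_area \<sigma> * u \<sigma>) *\<^sub>R (face_center \<sigma> - x K))"
  then have "L (volume K *\<^sub>R (T *v v)) = L (- comb (E K) R u)" unfolding c by simp
  then have "volume K *\<^sub>R v = - L (comb (E K) R u)"
    by (simp add: linear_cmul[OF L_linear] linear_neg[OF L_linear] LT)
  then have "(1 / volume K) *\<^sub>R (volume K *\<^sub>R v) = (1 / volume K) *\<^sub>R (- L (comb (E K) R u))" by simp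
  then show "v = - (1 / volume K) *\<^sub>R L (comb (E K) R u)" using vol by simp
qed

text \<open>The tensor cancels the inverse contained in \<open>mixed_v\<close>, which leaves
  \<open>N R^T u / |K|\<close> with a minus sign.\<close>

lemma mixed_T_eq: "mixed_T E \<Lambda> x K u \<sigma> = proj u \<sigma>"
  by (simp add: mixed_T_def mixed_v_eq proj_def linear_cmul[OF dual.L_linear] linear_neg[OF dual.L_linear] TL inner_commute)

lemma mixed_form_eq: "mixed_form E \<Lambda> x B K u w = stab_form (B K) w u"
proof -
  have "volume K * (mixed_v E \<Lambda> x K u \<bullet> (T *v mixed_v E \<Lambda> x K w)) = L (comb (E K) R w) \<bullet> comb (E K) R u / volume K"
    using vol L_sym[of "comb (E K) R w" "comb (E K) R u"]
    by (simp add: mixed_v_eq linear_cmul[OF dual.L_linear] linear_neg[OF dual.L_linear] TL inner_commute)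
  then show ?thesis by (simp add: mixed_form_def stab_form_def mixed_T_eq bil_def)
qed

lemma mixed_representsI:
  assumes "\<And>u w. stab_form (B K) u w = bil (E K) A u w"
  shows "mixed_represents \<Lambda> E x B K A"
  unfolding mixed_represents_def
proof (intro allI)
  fix F p ps
  show "(\<forall>G. mixed_form E \<Lambda> x B K F G = (\<Sum>\<sigma>\<in>E K. (p - ps \<sigma>) * face_area \<sigma> * G \<sigma>)) \<longleftrightarrow>
    (\<forall>\<sigma>\<in>E K. mv (E K) A F \<sigma> = face_area \<sigma> * (p - ps \<sigma>))"
  proof -
  have "(\<Sum>\<sigma>\<in>E K. (p - ps \<sigma>) * face_area \<sigma> * G \<sigma>) = (\<Sum>\<sigma>\<in>E K. G \<sigma> * (face_area \<sigma> * (p - ps \<sigma>)))" for G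
    by (simp add: mult_ac)
  then show ?thesis
    using sum_eq_all_iff[OF finE, of "mv (E K) A F" "\<lambda>\<sigma>. face_area \<sigma> * (p - ps \<sigma>)"]
    by (simp add: mixed_form_eq assms bil_mv)
qed
qed

lemma ex_mixed_matrix:
  assumes "sym_posdef (E K) (B K)"
  shows "\<exists>A. admissible A \<and> mixed_represents \<Lambda> E x B K A"
proof -
  obtain A where A: "admissible A" "\<And>u w. stab_form (B K) u w = bil (E K) A u w"
    using stab_form_admissible[OF assms] by blast
  show ?thesis using A(1) mixed_representsI[of B A, OF A(2)] by blast
qed

text \<open>The Hybrid parameter acts on plain pressure differences; this is the same form in the
  area-weighted differences of the matrix scheme.\<close>

definition hybrid_weight :: "((real^'n) set \<Rightarrow> (real^'n) set \<Rightarrow> real) \<Rightarrow> (real^'n) set \<Rightarrow> (real^'n) set \<Rightarrow> real" where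
  "hybrid_weight B \<sigma> \<tau> = B \<sigma> \<tau> / (face_area \<sigma> * face_area \<tau>)"

lemma sym_posdef_hybrid_weight:
  assumes "sym_posdef (E K) B"
  shows "sym_posdef (E K) (hybrid_weight B)"
  unfolding sym_posdef_alt
proof (intro conjI ballI allI impI)
  show "hybrid_weight B \<sigma> \<tau> = hybrid_weight B \<tau> \<sigma>" if "\<sigma> \<in> E K" "\<tau> \<in> E K" for \<sigma> \<tau>
    using assms that by (auto simp: sym_posdef_def hybrid_weight_def mult.commute)
  fix w :: "(real^'n) set \<Rightarrow> real" assume "\<exists>i\<in>E K. w i \<noteq> 0"
  then have "\<exists>i\<in>E K. w i / face_area i \<noteq> 0" using area by force
  then have "0 < bil (E K) B (\<lambda>i. w i / face_area i) (\<lambda>i. w i / face_area i)"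
    using assms by (simp add: sym_posdef_alt)
  also have "\<dots> = bil (E K) (hybrid_weight B) w w" by (simp add: bil_def hybrid_weight_def)
  finally show "0 < bil (E K) (hybrid_weight B) w w" .
qed

text \<open>In the area-weighted differences \<open>u\<close> the discrete gradient is
  \<open>- N^T u / |K|\<close> and the stabilization is minus the dual projection of
  \<open>u\<close> divided by the area. Both signs cancel, since each operator occurs twice.\<close>

lemma hybrid_form_eq:
  fixes p q :: real and ps qs :: "(real^'n) set \<Rightarrow> real"
  defines "u \<equiv> \<lambda>\<sigma>. face_area \<sigma> * (p - ps \<sigma>)" and "w \<equiv> \<lambda>\<sigma>. face_area \<sigma> * (q - qs \<sigma>)"
  shows "volume K * ((T *v hybrid_grad E K p ps) \<bullet> hybrid_grad E K q qs) +
      (\<Sum>\<sigma>\<in>E K. \<Sum>\<tau>\<in>E K. hybrid_stab E x K q qs \<sigma> * B \<sigma> \<tau> * hybrid_stab E x K p ps \<tau>)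
    = dual.stab_form (hybrid_weight B) w u"
proof -
  have grad: "hybrid_grad E K r rs = - (1 / volume K) *\<^sub>R comb (E K) N (\<lambda>\<sigma>. face_area \<sigma> * (r - rs \<sigma>))" for r rs
  proof -
    have "comb (E K) N (\<lambda>\<sigma>. face_area \<sigma> * (r - rs \<sigma>)) = - (\<Sum>\<sigma>\<in>E K. (face_area \<sigma> * (rs \<sigma> - r)) *\<^sub>R N \<sigma>)"
      unfolding comb_def sum_negf[symmetric] by (intro sum.cong refl) (simp flip: scaleR_minus_left add: right_diff_distrib)
    then show ?thesis by (simp add: hybrid_grad_def)
  qed
  have stab: "hybrid_stab E x K r rs \<sigma> = - (dual.proj (\<lambda>\<sigma>. face_area \<sigma> * (r - rs \<sigma>)) \<sigma> / face_area \<sigma>)"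
    if \<sigma>: "\<sigma> \<in> E K" for r rs \<sigma>
  proof -
    have "face_area \<sigma> \<noteq> 0" using area[OF \<sigma>] by simp
    then show ?thesis
      by (simp add: hybrid_stab_def grad dual.proj_def inner_commute diff_divide_distrib)
  qed
  have "volume K * ((T *v hybrid_grad E K p ps) \<bullet> hybrid_grad E K q qs) = (T *v comb (E K) N u) \<bullet> comb (E K) N w / volume K"
    using vol unfolding grad u_def[symmetric] w_def[symmetric]
    by (simp add: linear_cmul[OF dual.L_linear] linear_neg[OF dual.L_linear])
  also have "(T *v comb (E K) N u) \<bullet> comb (E K) N w = (T *v comb (E K) N w) \<bullet> comb (E K) N u"
    using dual.L_sym[of "comb (E K) N u" "comb (E K) N w"] by (simp add: inner_commute)
  finally have 1: "volume K * ((T *v hybrid_grad E K p ps) \<bullet> hybrid_grad E K q qs) = (T *v comb (E K) N w) \<bullet> comb (E K) N u / volume K" .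
  have 2: "(\<Sum>\<sigma>\<in>E K. \<Sum>\<tau>\<in>E K. hybrid_stab E x K q qs \<sigma> * B \<sigma> \<tau> * hybrid_stab E x K p ps \<tau>)
     = bil (E K) (hybrid_weight B) (dual.proj w) (dual.proj u)"
    unfolding bil_def by (intro sum.cong refl) (simp add: stab hybrid_weight_def u_def w_def)
  show ?thesis by (simp add: 1 2 dual.stab_form_def)
qed

text \<open>Areas are positive, so the weighted test differences exhaust all vectors on
  \<open>E K\<close>. The Hybrid relation therefore reads \<open>F = W u\<close>, and inverting
  \<open>W\<close> gives the matrix relation.\<close>

lemma hybrid_representsI:
  assumes W: "\<And>u w. dual.stab_form (hybrid_weight B) u w = bil (E K) W u w"
    and AW: "\<And>u \<sigma>. \<sigma> \<in> E K \<Longrightarrow> mv (E K) A (mv (E K) W u) \<sigma> = u \<sigma>"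
    and WA: "\<And>u \<sigma>. \<sigma> \<in> E K \<Longrightarrow> mv (E K) W (mv (E K) A u) \<sigma> = u \<sigma>"
  shows "hybrid_represents \<Lambda> E x B K A"
  unfolding hybrid_represents_def
proof (intro allI)
  fix F p ps
  show "(\<forall>q qs. (\<Sum>\<sigma>\<in>E K. face_area \<sigma> * F \<sigma> * (q - qs \<sigma>)) =
        volume K * ((T *v hybrid_grad E K p ps) \<bullet> hybrid_grad E K q qs) +
        (\<Sum>\<sigma>\<in>E K. \<Sum>\<tau>\<in>E K. hybrid_stab E x K q qs \<sigma> * B \<sigma> \<tau> * hybrid_stab E x K p ps \<tau>)) \<longleftrightarrow>
    (\<forall>\<sigma>\<in>E K. mv (E K) A F \<sigma> = face_area \<sigma> * (p - ps \<sigma>))" (is "?lhs \<longleftrightarrow> ?rhs")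
  proof -
  let ?u = "\<lambda>\<sigma>. face_area \<sigma> * (p - ps \<sigma>)"
  have "?lhs \<longleftrightarrow> (\<forall>(q::real) qs. (\<Sum>\<sigma>\<in>E K. (face_area \<sigma> * (q - qs \<sigma>)) * F \<sigma>)
      = (\<Sum>\<sigma>\<in>E K. (face_area \<sigma> * (q - qs \<sigma>)) * mv (E K) W ?u \<sigma>))"
    unfolding hybrid_form_eq W bil_mv by (simp add: mult_ac)
  also have "\<dots> \<longleftrightarrow> (\<forall>w. (\<Sum>\<sigma>\<in>E K. w \<sigma> * F \<sigma>) = (\<Sum>\<sigma>\<in>E K. w \<sigma> * mv (E K) W ?u \<sigma>))" (is "?l \<longleftrightarrow> ?r")
  proof
    assume l: ?l
    show ?r
    proof
      fix w
      \<comment> \<open>The test values 0 in the cell and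
        \<open>- w \<sigma> / face_area \<sigma>\<close> on the faces realize an arbitrary
        \<open>w\<close>.\<close>
      have "(\<Sum>\<sigma>\<in>E K. (face_area \<sigma> * (0 - (- w \<sigma> / face_area \<sigma>))) * a \<sigma>) = (\<Sum>\<sigma>\<in>E K. w \<sigma> * a \<sigma>)" for a
        using area by (intro sum.cong refl) force
      then show "(\<Sum>\<sigma>\<in>E K. w \<sigma> * F \<sigma>) = (\<Sum>\<sigma>\<in>E K. w \<sigma> * mv (E K) W ?u \<sigma>)"
        using l[rule_format, of 0 "\<lambda>\<sigma>. - w \<sigma> / face_area \<sigma>"] by simp
    qed
  next
    assume r: ?r
    show ?l
    proof (intro allI)
      fix q :: real and qs
      show "(\<Sum>\<sigma>\<in>E K. (face_area \<sigma> * (q - qs \<sigma>)) * F \<sigma>)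
          = (\<Sum>\<sigma>\<in>E K. (face_area \<sigma> * (q - qs \<sigma>)) * mv (E K) W ?u \<sigma>)"
        by (rule r[THEN spec])
    qed
  qed
  also have "\<dots> \<longleftrightarrow> (\<forall>\<sigma>\<in>E K. F \<sigma> = mv (E K) W ?u \<sigma>)" by (rule sum_eq_all_iff[OF finE])
  also have "\<dots> \<longleftrightarrow> ?rhs"
  proof
    assume "\<forall>\<sigma>\<in>E K. F \<sigma> = mv (E K) W ?u \<sigma>"
    then have "mv (E K) A F = mv (E K) A (mv (E K) W ?u)" by (auto simp: mv_def[of _ A] fun_eq_iff intro!: sum.cong)
    then show ?rhs using AW by simp
  next
    assume r: ?rhs
    have "mv (E K) W (mv (E K) A F) = mv (E K) W ?u"
      unfolding mv_def[of _ W] fun_eq_iff using r by (intro allI sum.cong) auto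
    then show "\<forall>\<sigma>\<in>E K. F \<sigma> = mv (E K) W ?u \<sigma>" using WA by metis
  qed
  finally show ?thesis .
qed
qed

lemma ex_hybrid_matrix:
  assumes "sym_posdef (E K) B"
  shows "\<exists>A. admissible A \<and> hybrid_represents \<Lambda> E x B K A"
proof -
  obtain W where W: "dual.admissible W" "\<And>u w. dual.stab_form (hybrid_weight B) u w = bil (E K) W u w"
    using dual.stab_form_admissible[OF sym_posdef_hybrid_weight[OF assms]] by blast
  obtain A where A: "admissible A" "\<And>u \<sigma>. \<sigma> \<in> E K \<Longrightarrow> mv (E K) W (mv (E K) A u) \<sigma> = u \<sigma>"
    "\<And>u \<sigma>. \<sigma> \<in> E K \<Longrightarrow> mv (E K) A (mv (E K) W u) \<sigma> = u \<sigma>"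
    using admissible_inverse[OF dual.consistent_pair_axioms TL W(1)] by blast
  show ?thesis using A(1) hybrid_representsI[of B W A, OF W(2) A(3) A(2)] by blast
qed

text \<open>The inverse of \<open>A\<close> is admissible for the exchanged pair and thus reproduces
  itself as stabilization parameter; the area factors in \<open>B\<close> undo
  \<open>hybrid_weight\<close>.\<close>

lemma ex_hybrid_weight:
  assumes "admissible A"
  shows "\<exists>B. sym_posdef (E K) B \<and> hybrid_represents \<Lambda> E x B K A"
proof -
  obtain W where W: "dual.admissible W"
    and AW: "\<And>u \<sigma>. \<sigma> \<in> E K \<Longrightarrow> mv (E K) A (mv (E K) W u) \<sigma> = u \<sigma>"
    and WA: "\<And>u \<sigma>. \<sigma> \<in> E K \<Longrightarrow> mv (E K) W (mv (E K) A u) \<sigma> = u \<sigma>"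
    using admissible_inverse[OF consistent_pair_axioms LT assms] by blast
  define B where "B \<sigma> \<tau> = face_area \<sigma> * face_area \<tau> * W \<sigma> \<tau>" for \<sigma> \<tau>
  have BW: "hybrid_weight B \<sigma> \<tau> = W \<sigma> \<tau>" if "\<sigma> \<in> E K" "\<tau> \<in> E K" for \<sigma> \<tau>
    using area[OF that(1)] area[OF that(2)] by (simp add: hybrid_weight_def B_def)
  have "dual.stab_form (hybrid_weight B) u w = dual.stab_form W u w" for u w
    unfolding dual.stab_form_def using BW by (intro arg_cong2[of _ _ _ _ "(+)"] refl bil_cong) auto
  then have eq: "dual.stab_form (hybrid_weight B) u w = bil (E K) W u w" for u w
    by (simp add: dual.admissible_stab_form[OF W])
  have "sym_posdef (E K) B"
    unfolding sym_posdef_alt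
  proof (intro conjI ballI allI impI)
    have sp: "sym_posdef (E K) W" using W by (simp add: dual.admissible_def)
    then show "B \<sigma> \<tau> = B \<tau> \<sigma>" if "\<sigma> \<in> E K" "\<tau> \<in> E K" for \<sigma> \<tau>
      using that by (simp add: sym_posdef_def B_def mult.commute)
    fix w :: "(real^'n) set \<Rightarrow> real" assume "\<exists>i\<in>E K. w i \<noteq> 0"
    then have "\<exists>i\<in>E K. face_area i * w i \<noteq> 0" using area by force
    then have "0 < bil (E K) W (\<lambda>i. face_area i * w i) (\<lambda>i. face_area i * w i)"
      using sp by (simp add: sym_posdef_alt)
    then show "0 < bil (E K) B w w" by (simp add: bil_def B_def mult_ac)
  qed
  moreover have "hybrid_represents \<Lambda> E x B K A"
    by (rule hybrid_representsI[of B W A, OF eq AW WA])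
  ultimately show ?thesis by blast
qed

text \<open>The matrix \<open>mat_N\<close> is \<open>N \<Lambda>\<close> and the mean tensor is
  onto, so its image is that of \<open>N\<close>, whose orthogonal complement is the kernel of
  \<open>N^T\<close>.\<close>

lemma vec_orth_im_mat_N:
  "vec_orth (E K) (mat_im (E K) UNIV (mat_N \<Lambda> K)) = {v \<in> extensional (E K). comb (E K) N v = 0}"
proof -
  have Nw: "(\<Sum>j\<in>UNIV. mat_N \<Lambda> K \<sigma> j * w j) = N \<sigma> \<bullet> (T *v (\<chi> j. w j))" for \<sigma> w
    by (simp add: mat_N_def matrix_mult_sum inner_sum_right scalar_mult_eq_scaleR inner_commute mult.commute)
  have o: "(\<Sum>\<sigma>\<in>E K. v \<sigma> * (\<lambda>\<sigma>\<in>E K. \<Sum>j\<in>UNIV. mat_N \<Lambda> K \<sigma> j * w j) \<sigma>) = comb (E K) N v \<bullet> (T *v (\<chi> j. w j))" for v w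
    by (simp add: Nw comb_inner)
  have "(\<forall>w\<in>mat_im (E K) UNIV (mat_N \<Lambda> K). (\<Sum>\<sigma>\<in>E K. v \<sigma> * w \<sigma>) = 0) \<longleftrightarrow> comb (E K) N v = 0" for v
  proof
    assume a: "\<forall>w\<in>mat_im (E K) UNIV (mat_N \<Lambda> K). (\<Sum>\<sigma>\<in>E K. v \<sigma> * w \<sigma>) = 0"
    have "comb (E K) N v \<bullet> (T *v (\<chi> j. w j)) = 0" for w
      unfolding o[symmetric] by (rule a[rule_format], unfold mat_im_def mem_Collect_eq) (rule exI[of _ w], simp)
    \<comment> \<open>This \<open>w\<close> is the preimage of \<open>N^T v\<close> under the mean
      tensor, which turns the orthogonality into a vanishing norm.\<close>
    from this[of "\<lambda>j. L (comb (E K) N v) $ j"] have "comb (E K) N v \<bullet> comb (E K) N v = 0" by (simp add: TL)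
    then show "comb (E K) N v = 0" by simp
  next
    assume "comb (E K) N v = 0"
    then show "\<forall>w\<in>mat_im (E K) UNIV (mat_N \<Lambda> K). (\<Sum>\<sigma>\<in>E K. v \<sigma> * w \<sigma>) = 0"
      using o[of v] by (auto simp: mat_im_def)
  qed
  then show ?thesis by (simp add: vec_orth_def)
qed

lemma mat_M_eq:
  "mat_M E \<Lambda> x C U K \<sigma> \<tau> =
    rank_part \<sigma> \<tau> + congr {..<card (E K) - CARD('n)} (\<lambda>l k. C K k l) (U K) \<sigma> \<tau>"
proof -
  have "(\<Sum>i\<in>UNIV. \<Sum>j\<in>UNIV. mat_R (x K) \<sigma> i * matrix_inv T $ i $ j * mat_R (x K) \<tau> j) = R \<sigma> \<bullet> L (R \<tau>)"
    by (simp add: mat_R_def inner_vec_def matrix_vector_mult_def sum_distrib_left mult_ac)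
  also have "\<dots> = L (R \<sigma>) \<bullet> R \<tau>" by (rule L_sym[symmetric])
  finally show ?thesis by (simp add: mat_M_def rank_part_def congr_def)
qed

end

definition cell_admissible ::
  "(real^'n \<Rightarrow> real^'n^'n) \<Rightarrow> ('n pset \<Rightarrow> 'n pset set) \<Rightarrow> ('n::finite pset \<Rightarrow> real^'n) \<Rightarrow> 'n pset \<Rightarrow>
   ('n pset \<Rightarrow> 'n pset \<Rightarrow> real) \<Rightarrow> bool" where
  "cell_admissible \<Lambda> E x K = consistent_pair.admissible (E K) (outward_normal K)
     (\<lambda>\<sigma>. face_area \<sigma> *\<^sub>R (face_center \<sigma> - x K)) (\<lambda>v. matrix_inv (cell_mean \<Lambda> K) *v v)"

lemma mixed_scheme_eq:
  assumes "\<And>K. K \<in> M \<Longrightarrow> mixed_represents \<Lambda> E x B K (A K)"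
  shows "mixed_scheme \<Omega> M E \<Lambda> x B = matrix_scheme \<Omega> M E A"
proof -
  have "(\<forall>G. mixed_form E \<Lambda> x B K F G = (\<Sum>\<sigma>\<in>E K. (p - ps \<sigma>) * face_area \<sigma> * G \<sigma>)) \<longleftrightarrow>
    (\<forall>\<sigma>\<in>E K. mv (E K) (A K) F \<sigma> = face_area \<sigma> * (p - ps \<sigma>))" if "K \<in> M" for K F p ps
    by (rule assms[OF that, unfolded mixed_represents_def, THEN spec, THEN spec, THEN spec])
  then show ?thesis
    unfolding mixed_scheme_def matrix_scheme_def fun_eq_iff by (simp cong: ball_cong)
qed

lemma hybrid_scheme_eq:
  assumes "\<And>K. K \<in> M \<Longrightarrow> hybrid_represents \<Lambda> E x (B K) K (A K)"
  shows "hybrid_scheme \<Omega> M E \<Lambda> x B = matrix_scheme \<Omega> M E A"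
proof -
  have "(\<forall>q qs. (\<Sum>\<sigma>\<in>E K. face_area \<sigma> * F \<sigma> * (q - qs \<sigma>)) =
        volume K * ((cell_mean \<Lambda> K *v hybrid_grad E K p ps) \<bullet> hybrid_grad E K q qs) +
        (\<Sum>\<sigma>\<in>E K. \<Sum>\<tau>\<in>E K. hybrid_stab E x K q qs \<sigma> * B K \<sigma> \<tau> * hybrid_stab E x K p ps \<tau>)) \<longleftrightarrow>
    (\<forall>\<sigma>\<in>E K. mv (E K) (A K) F \<sigma> = face_area \<sigma> * (p - ps \<sigma>))" if "K \<in> M" for K F p ps
    by (rule assms[OF that, unfolded hybrid_represents_def, THEN spec, THEN spec, THEN spec])
  then show ?thesis
    unfolding hybrid_scheme_def matrix_scheme_def fun_eq_iff by (simp cong: ball_cong)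
qed

section \<open>The schemes on the whole mesh\<close>

context
  fixes \<Omega> :: "(real^'n) set" and \<Lambda> :: "real^'n \<Rightarrow> real^'n^'n"
    and M :: "(real^'n) set set" and E :: "(real^'n) set \<Rightarrow> (real^'n) set set"
  assumes \<Omega>: "open \<Omega>" and \<Lambda>: "diffusion_tensor \<Omega> \<Lambda>" and mesh: "polytopal_mesh \<Omega> M E"
begin

lemma mesh_cell:
  assumes K: "K \<in> M"
  shows "mesh_cell \<Omega> K \<Lambda> E"
proof (rule mesh_cell.intro)
  have cell: "K \<noteq> {} \<and> open K \<and> polytopal K \<and> K \<subseteq> \<Omega>"
    using mesh K by (simp add: polytopal_mesh_def)
  then show "K \<noteq> {}" "open K" "bounded K" "K \<subseteq> \<Omega>" by (auto simp: polytopal_def)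
  have E: "finite (E K) \<and> (\<forall>\<sigma>\<in>E K. is_face K \<sigma>) \<and> pairwise disjnt (E K) \<and>
      (\<Union>\<sigma>\<in>E K. closure \<sigma>) = frontier K"
    using mesh K by (simp add: polytopal_mesh_def)
  then show "finite (E K)" "pairwise disjnt (E K)" "(\<Union>\<sigma>\<in>E K. closure \<sigma>) = frontier K"
    by auto
  show "is_face K \<sigma>" if "\<sigma> \<in> E K" for \<sigma> using E that by auto
qed (rule \<Omega> \<Lambda>)+

lemma finite_mesh: "finite M" "K \<in> M \<Longrightarrow> finite (E K)"
  using mesh by (auto simp: polytopal_mesh_def)

lemma mixed_to_matrix:
  assumes "point_matrix_params M E x B"
  shows "\<exists>A. (\<forall>K\<in>M. x K \<in> K \<and> cell_admissible \<Lambda> E x K (A K)) \<and>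
    mixed_scheme \<Omega> M E \<Lambda> x B = matrix_scheme \<Omega> M E A"
proof -
  have "\<forall>K\<in>M. \<exists>A. cell_admissible \<Lambda> E x K A \<and> mixed_represents \<Lambda> E x B K A"
  proof
    fix K assume KM: "K \<in> M"
    interpret mesh_cell \<Omega> K \<Lambda> E x using mesh_cell[OF KM] .
    have "sym_posdef (E K) (B K)" using assms KM by (simp add: point_matrix_params_def)
    then show "\<exists>A. cell_admissible \<Lambda> E x K A \<and> mixed_represents \<Lambda> E x B K A"
      unfolding cell_admissible_def by (rule ex_mixed_matrix)
  qed
  then have "\<exists>A. \<forall>K\<in>M. cell_admissible \<Lambda> E x K (A K) \<and> mixed_represents \<Lambda> E x B K (A K)"
    by (rule bchoice)
  then obtain A where A: "\<And>K. K \<in> M \<Longrightarrow> cell_admissible \<Lambda> E x K (A K)"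
    "\<And>K. K \<in> M \<Longrightarrow> mixed_represents \<Lambda> E x B K (A K)" by blast
  have "mixed_scheme \<Omega> M E \<Lambda> x B = matrix_scheme \<Omega> M E A" using A(2) by (rule mixed_scheme_eq)
  then show ?thesis using assms A(1) by (auto simp: point_matrix_params_def)
qed

lemma hybrid_to_matrix:
  assumes "point_matrix_params M E x B"
  shows "\<exists>A. (\<forall>K\<in>M. x K \<in> K \<and> cell_admissible \<Lambda> E x K (A K)) \<and>
    hybrid_scheme \<Omega> M E \<Lambda> x B = matrix_scheme \<Omega> M E A"
proof -
  have "\<forall>K\<in>M. \<exists>A. cell_admissible \<Lambda> E x K A \<and> hybrid_represents \<Lambda> E x (B K) K A"
  proof
    fix K assume KM: "K \<in> M"
    interpret mesh_cell \<Omega> K \<Lambda> E x using mesh_cell[OF KM] .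
    have "sym_posdef (E K) (B K)" using assms KM by (simp add: point_matrix_params_def)
    then show "\<exists>A. cell_admissible \<Lambda> E x K A \<and> hybrid_represents \<Lambda> E x (B K) K A"
      unfolding cell_admissible_def by (rule ex_hybrid_matrix)
  qed
  then have "\<exists>A. \<forall>K\<in>M. cell_admissible \<Lambda> E x K (A K) \<and> hybrid_represents \<Lambda> E x (B K) K (A K)"
    by (rule bchoice)
  then obtain A where A: "\<And>K. K \<in> M \<Longrightarrow> cell_admissible \<Lambda> E x K (A K)"
    "\<And>K. K \<in> M \<Longrightarrow> hybrid_represents \<Lambda> E x (B K) K (A K)" by blast
  have "hybrid_scheme \<Omega> M E \<Lambda> x B = matrix_scheme \<Omega> M E A" using A(2) by (rule hybrid_scheme_eq)
  then show ?thesis using assms A(1) by (auto simp: point_matrix_params_def)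
qed

lemma matrix_to_mixed:
  assumes A: "\<And>K. K \<in> M \<Longrightarrow> x K \<in> K \<and> cell_admissible \<Lambda> E x K (A K)"
  shows "\<exists>x' B. point_matrix_params M E x' B \<and> mixed_scheme \<Omega> M E \<Lambda> x' B = matrix_scheme \<Omega> M E A"
proof (intro exI[of _ x] exI[of _ A] conjI)
  show "point_matrix_params M E x A"
    unfolding point_matrix_params_def
  proof
    fix K assume KM: "K \<in> M"
    interpret mesh_cell \<Omega> K \<Lambda> E x using mesh_cell[OF KM] .
    show "x K \<in> K \<and> sym_posdef (E K) (A K)"
      using A[OF KM] by (simp add: cell_admissible_def admissible_def)
  qed
  show "mixed_scheme \<Omega> M E \<Lambda> x A = matrix_scheme \<Omega> M E A"
  proof (rule mixed_scheme_eq)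
    fix K assume KM: "K \<in> M"
    interpret mesh_cell \<Omega> K \<Lambda> E x using mesh_cell[OF KM] .
    have "admissible (A K)" using A[OF KM] by (simp add: cell_admissible_def)
    then show "mixed_represents \<Lambda> E x A K (A K)"
      by (intro mixed_representsI admissible_stab_form)
  qed
qed

lemma matrix_to_hybrid:
  assumes A: "\<And>K. K \<in> M \<Longrightarrow> x K \<in> K \<and> cell_admissible \<Lambda> E x K (A K)"
  shows "\<exists>x' B. point_matrix_params M E x' B \<and> hybrid_scheme \<Omega> M E \<Lambda> x' B = matrix_scheme \<Omega> M E A"
proof -
  have "\<forall>K\<in>M. \<exists>B. sym_posdef (E K) B \<and> hybrid_represents \<Lambda> E x B K (A K)"
  proof
    fix K assume KM: "K \<in> M"
    show "\<exists>B. sym_posdef (E K) B \<and> hybrid_represents \<Lambda> E x B K (A K)"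
    proof -
      interpret mesh_cell \<Omega> K \<Lambda> E x using mesh_cell[OF KM] .
      have "admissible (A K)" using A[OF KM] by (simp add: cell_admissible_def)
      then show ?thesis by (rule ex_hybrid_weight)
    qed
  qed
  then have "\<exists>B. \<forall>K\<in>M. sym_posdef (E K) (B K) \<and> hybrid_represents \<Lambda> E x (B K) K (A K)"
    by (rule bchoice)
  then obtain B where B: "\<And>K. K \<in> M \<Longrightarrow> sym_posdef (E K) (B K)"
    "\<And>K. K \<in> M \<Longrightarrow> hybrid_represents \<Lambda> E x (B K) K (A K)" by blast
  have "hybrid_scheme \<Omega> M E \<Lambda> x B = matrix_scheme \<Omega> M E A" using B(2) by (rule hybrid_scheme_eq)
  moreover have "point_matrix_params M E x B" using A B(1) by (simp add: point_matrix_params_def)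
  ultimately show ?thesis by blast
qed

text \<open>Flux continuity couples exactly the two sides of an interior face and leaves boundary
  faces free. A family orthogonal to the flux space is thus single-valued on interior faces and zero
  on boundary faces, which is what a family of face values in the hybrid space is.\<close>

lemma flux_space_orthogonal_iff:
  fixes h :: "'n fluxes"
  shows "(\<forall>G\<in>flux_space \<Omega> M E. (\<Sum>K\<in>M. \<Sum>\<sigma>\<in>E K. G K \<sigma> * h K \<sigma>) = 0) \<longleftrightarrow>
    (\<exists>ps. (p, ps) \<in> hybrid_space \<Omega> M E \<and> (\<forall>K\<in>M. \<forall>\<sigma>\<in>E K. h K \<sigma> = ps \<sigma>))" (is "?l \<longleftrightarrow> ?r")
proof
  have two: "\<sigma> \<subseteq> frontier \<Omega> \<or> card {K\<in>M. \<sigma> \<in> E K} = 2" if "K \<in> M" "\<sigma> \<in> E K" for K \<sigma>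
  proof -
    have "\<forall>\<sigma>\<in>\<Union>(E ` M). \<sigma> \<subseteq> frontier \<Omega> \<or> card {K\<in>M. \<sigma> \<in> E K} = 2"
      using mesh by (simp add: polytopal_mesh_def)
    moreover have "\<sigma> \<in> \<Union>(E ` M)" using that by auto
    ultimately show ?thesis by (rule bspec)
  qed
  have pair: "{K\<in>M. \<sigma> \<in> E K} = {K, L}"
    if "K \<in> M" "\<sigma> \<in> E K" "L \<in> M" "\<sigma> \<in> E L" "K \<noteq> L" "\<not> \<sigma> \<subseteq> frontier \<Omega>" for K L \<sigma>
  proof -
    have "card {K\<in>M. \<sigma> \<in> E K} = 2" using two that by blast
    moreover have "card {K, L} = 2" using that by simp
    moreover have "{K, L} \<subseteq> {K\<in>M. \<sigma> \<in> E K}" using that by auto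
    ultimately show ?thesis using finite_mesh(1) card_subset_eq[of "{K\<in>M. \<sigma> \<in> E K}" "{K, L}"] by auto
  qed
  {
    assume l: ?l
    have single: "(\<Sum>K'\<in>M. \<Sum>\<tau>\<in>E K'. of_bool (K' = K \<and> \<tau> = \<sigma>) * h K' \<tau>) = h K \<sigma>"
      if "K \<in> M" "\<sigma> \<in> E K" for K \<sigma>
    proof -
      have "(\<Sum>\<tau>\<in>E K'. of_bool (K' = K \<and> \<tau> = \<sigma>) * h K' \<tau>) = (if K' = K then h K \<sigma> else 0)" if "K' \<in> M" for K'
      proof (cases "K' = K")
        case True
        then have "(\<Sum>\<tau>\<in>E K'. of_bool (K' = K \<and> \<tau> = \<sigma>) * h K' \<tau>) = (\<Sum>\<tau>\<in>E K. if \<tau> = \<sigma> then h K \<tau> else 0)"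
          by (intro sum.cong) auto
        then show ?thesis using True \<open>\<sigma> \<in> E K\<close> finite_mesh(2)[OF \<open>K \<in> M\<close>] by simp
      qed simp
      then have "(\<Sum>K'\<in>M. \<Sum>\<tau>\<in>E K'. of_bool (K' = K \<and> \<tau> = \<sigma>) * h K' \<tau>) = (\<Sum>K'\<in>M. if K' = K then h K \<sigma> else 0)"
        by (intro sum.cong) auto
      then show ?thesis using that finite_mesh(1) by simp
    qed
    have bd: "h K \<sigma> = 0" if "K \<in> M" "\<sigma> \<in> E K" "\<sigma> \<subseteq> frontier \<Omega>" for K \<sigma>
    proof -
      \<comment> \<open>A unit flux through one boundary face meets no continuity
        constraint.\<close>
      let ?G = "\<lambda>K' \<tau>. of_bool (K' = K \<and> \<tau> = \<sigma>)"
      have "?G \<in> flux_space \<Omega> M E" using that(3) by (auto simp: flux_space_def)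
      then show ?thesis using l single[OF that(1,2)] by auto
    qed
    have int: "h K \<sigma> = h L \<sigma>" if KL: "K \<in> M" "\<sigma> \<in> E K" "L \<in> M" "\<sigma> \<in> E L" for K L \<sigma>
    proof (cases "K = L \<or> \<sigma> \<subseteq> frontier \<Omega>")
      case True
      then show ?thesis using bd KL by auto
    next
      case False
      \<comment> \<open>Opposite unit fluxes on the two sides of an interior face; pairing with
        \<open>h\<close> extracts the difference of its values there.\<close>
      let ?G = "\<lambda>K' \<tau>. of_bool (K' = K \<and> \<tau> = \<sigma>) - of_bool (K' = L \<and> \<tau> = \<sigma>) :: real"
      have "?G K' \<tau> + ?G L' \<tau> = 0"
        if "K' \<in> M" "L' \<in> M" "K' \<noteq> L'" "\<tau> \<in> E K'" "\<tau> \<in> E L'" for K' L' \<tau>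
      proof (cases "\<tau> = \<sigma>")
        case True
        then have "K' \<in> {K\<in>M. \<sigma> \<in> E K}" "L' \<in> {K\<in>M. \<sigma> \<in> E K}" using that by auto
        then have "K' \<in> {K, L}" "L' \<in> {K, L}" using pair[of K \<sigma> L] KL False by auto
        then show ?thesis using that(3) by auto
      qed simp
      then have "?G \<in> flux_space \<Omega> M E" unfolding flux_space_def by blast
      then have "(\<Sum>K'\<in>M. \<Sum>\<tau>\<in>E K'. ?G K' \<tau> * h K' \<tau>) = 0" by (rule bspec[OF l])
      then have "h K \<sigma> - h L \<sigma> = 0"
        using single[OF KL(1,2)] single[OF KL(3,4)] by (simp add: left_diff_distrib sum_subtractf)
      then show ?thesis by simp
    qed
    \<comment> \<open>By \<open>int\<close> the value is the same for every cell having
      \<open>\<sigma>\<close> as a face.\<close>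
    define ps where "ps \<sigma> = h (SOME K. K \<in> M \<and> \<sigma> \<in> E K) \<sigma>" for \<sigma>
    have ps: "h K \<sigma> = ps \<sigma>" if "K \<in> M" "\<sigma> \<in> E K" for K \<sigma>
    proof -
      have "(SOME K. K \<in> M \<and> \<sigma> \<in> E K) \<in> M \<and> \<sigma> \<in> E (SOME K. K \<in> M \<and> \<sigma> \<in> E K)"
        by (rule someI[of _ K]) (use that in simp)
      then show ?thesis unfolding ps_def using int[OF that] by blast
    qed
    have "(p, ps) \<in> hybrid_space \<Omega> M E"
      unfolding hybrid_space_def using ps bd by fastforce
    then show ?r using ps by blast
  next
    assume ?r
    then obtain ps where hyb: "(p, ps) \<in> hybrid_space \<Omega> M E" and h: "\<forall>K\<in>M. \<forall>\<sigma>\<in>E K. h K \<sigma> = ps \<sigma>"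
      by blast
    have bd: "ps \<sigma> = 0" if "K \<in> M" "\<sigma> \<in> E K" "\<sigma> \<subseteq> frontier \<Omega>" for K \<sigma>
      using hyb that by (auto simp: hybrid_space_def)
    have ps: "h K \<sigma> = ps \<sigma>" if "K \<in> M" "\<sigma> \<in> E K" for K \<sigma>
      using h that by blast
    show ?l
    proof
      fix G assume G: "G \<in> flux_space \<Omega> M E"
      let ?F = "\<Union>(E ` M)"
      \<comment> \<open>Regrouped by faces: both contributions of an interior face carry the factor
        \<open>ps \<sigma>\<close>, and their fluxes cancel.\<close>
      have "(\<Sum>K\<in>M. \<Sum>\<sigma>\<in>E K. G K \<sigma> * h K \<sigma>) = (\<Sum>K\<in>M. \<Sum>\<sigma>\<in>{\<sigma>\<in>?F. \<sigma> \<in> E K}. G K \<sigma> * ps \<sigma>)"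
        using ps by (intro sum.cong) auto
      also have "\<dots> = (\<Sum>\<sigma>\<in>?F. \<Sum>K\<in>{K\<in>M. \<sigma> \<in> E K}. G K \<sigma> * ps \<sigma>)"
        using finite_mesh by (intro sum.swap_restrict) auto
      also have "\<dots> = 0"
      proof (rule sum.neutral, rule ballI)
        fix \<sigma> assume "\<sigma> \<in> ?F"
        then obtain K where K: "K \<in> M" "\<sigma> \<in> E K" by blast
        show "(\<Sum>K\<in>{K\<in>M. \<sigma> \<in> E K}. G K \<sigma> * ps \<sigma>) = 0"
        proof (cases "\<sigma> \<subseteq> frontier \<Omega>")
          case True
          then show ?thesis using bd[OF K] by simp
        next
          case False
          then have "card {K\<in>M. \<sigma> \<in> E K} = 2" using two[OF K] by blast
          then obtain L L' where L: "{K\<in>M. \<sigma> \<in> E K} = {L, L'}" "L \<noteq> L'" by (auto simp: card_2_iff)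
          then have "L \<in> M" "L' \<in> M" "\<sigma> \<in> E L" "\<sigma> \<in> E L'" by auto
          then have "G L \<sigma> + G L' \<sigma> = 0" using G L(2) False by (auto simp: flux_space_def)
          then have "(G L \<sigma> + G L' \<sigma>) * ps \<sigma> = 0" by simp
          then show ?thesis unfolding L(1) using L(2) by (simp add: distrib_right)
        qed
      qed
      finally show "(\<Sum>K\<in>M. \<Sum>\<sigma>\<in>E K. G K \<sigma> * h K \<sigma>) = 0" .
    qed
  }
qed

text \<open>With \<open>h = p K - (M F) / |\<sigma>|\<close>, the first Mimetic equation says that
  \<open>h\<close> is orthogonal to the flux space. The resulting face values coincide with
  \<open>h\<close>, and this equality is the local matrix relation.\<close>

lemma mimetic_scheme_iff:
  assumes sym: "\<And>K. K \<in> M \<Longrightarrow> sym_posdef (E K) (mat_M E \<Lambda> x C U K)"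
  shows "(p, F) \<in> mimetic_scheme \<Omega> M E \<Lambda> x C U f \<longleftrightarrow>
    (\<exists>ps. ((p, ps), F) \<in> matrix_scheme \<Omega> M E (mat_M E \<Lambda> x C U) f)"
proof -
  let ?A = "mat_M E \<Lambda> x C U"
  have vol: "volume K \<noteq> 0" if "K \<in> M" for K using mesh_cell.vol[OF mesh_cell[OF that]] by simp
  have area: "0 < face_area \<sigma>" if "K \<in> M" "\<sigma> \<in> E K" for K \<sigma>
    using mesh_cell.area[OF mesh_cell[OF that(1)] that(2)] .
  let ?h = "\<lambda>K \<sigma>. p K - mv (E K) (?A K) (F K) \<sigma> / face_area \<sigma>"
  let ?flux = "\<lambda>G. \<lambda>K \<sigma>. face_area \<sigma> * G K \<sigma>"
  have vdiv: "volume K * q * div_h E G K = q * (\<Sum>\<sigma>\<in>E K. face_area \<sigma> * G K \<sigma>)" if "K \<in> M" for K q G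
    using vol[OF that] by (simp add: div_h_def)
  have form: "mimetic_form E \<Lambda> x C U K (F K) (G K) = (\<Sum>\<sigma>\<in>E K. G K \<sigma> * mv (E K) (?A K) (F K) \<sigma>)" if "K \<in> M" for K G
  proof -
    have "mimetic_form E \<Lambda> x C U K (F K) (G K) = bil (E K) (?A K) (F K) (G K)"
      by (simp add: mimetic_form_def bil_def)
    also have "\<dots> = bil (E K) (?A K) (G K) (F K)"
      using sym[OF that] by (intro bil_sym) (auto simp: sym_posdef_def)
    finally show ?thesis by (simp add: bil_mv)
  qed
  have lhs: "(\<Sum>K\<in>M. mimetic_form E \<Lambda> x C U K (F K) (G K)) - (\<Sum>K\<in>M. volume K * p K * div_h E G K)
      = - (\<Sum>K\<in>M. \<Sum>\<sigma>\<in>E K. ?flux G K \<sigma> * ?h K \<sigma>)" for G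
  proof -
    have "(\<Sum>K\<in>M. mimetic_form E \<Lambda> x C U K (F K) (G K)) - (\<Sum>K\<in>M. volume K * p K * div_h E G K)
        = (\<Sum>K\<in>M. (\<Sum>\<sigma>\<in>E K. G K \<sigma> * mv (E K) (?A K) (F K) \<sigma>) - p K * (\<Sum>\<sigma>\<in>E K. face_area \<sigma> * G K \<sigma>))"
      by (simp add: form vdiv sum_subtractf)
    also have "\<dots> = (\<Sum>K\<in>M. \<Sum>\<sigma>\<in>E K. - (?flux G K \<sigma> * ?h K \<sigma>))"
    proof (rule sum.cong[OF refl])
      fix K assume KM: "K \<in> M"
      have "- (?flux G K \<sigma> * ?h K \<sigma>) = G K \<sigma> * mv (E K) (?A K) (F K) \<sigma> - p K * (face_area \<sigma> * G K \<sigma>)" if "\<sigma> \<in> E K" for \<sigma>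
        using area[OF KM that] by (simp add: field_simps)
      then show "(\<Sum>\<sigma>\<in>E K. G K \<sigma> * mv (E K) (?A K) (F K) \<sigma>) - p K * (\<Sum>\<sigma>\<in>E K. face_area \<sigma> * G K \<sigma>)
          = (\<Sum>\<sigma>\<in>E K. - (?flux G K \<sigma> * ?h K \<sigma>))"
        by (simp add: sum_subtractf sum_distrib_left)
    qed
    finally show ?thesis by (simp add: sum_negf)
  qed
  \<comment> \<open>The area belongs to the face and is the same from both of its cells, so
    multiplying or dividing by it preserves the flux space.\<close>
  have scale: "(\<forall>G\<in>flux_space \<Omega> M E. (\<Sum>K\<in>M. \<Sum>\<sigma>\<in>E K. ?flux G K \<sigma> * ?h K \<sigma>) = 0) \<longleftrightarrow>
     (\<forall>G\<in>flux_space \<Omega> M E. (\<Sum>K\<in>M. \<Sum>\<sigma>\<in>E K. G K \<sigma> * ?h K \<sigma>) = 0)" (is "?l \<longleftrightarrow> ?r")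
  proof
    assume l: ?l
    show ?r
    proof
      fix G assume G: "G \<in> flux_space \<Omega> M E"
      let ?G = "\<lambda>K \<sigma>. G K \<sigma> / face_area \<sigma>"
      have "?G \<in> flux_space \<Omega> M E"
        using G unfolding flux_space_def by (simp flip: add_divide_distrib)
      then have "(\<Sum>K\<in>M. \<Sum>\<sigma>\<in>E K. ?flux ?G K \<sigma> * ?h K \<sigma>) = 0" by (rule bspec[OF l])
      moreover have "?flux ?G K \<sigma> = G K \<sigma>" if "K \<in> M" "\<sigma> \<in> E K" for K \<sigma> using area[OF that] by simp
      ultimately show "(\<Sum>K\<in>M. \<Sum>\<sigma>\<in>E K. G K \<sigma> * ?h K \<sigma>) = 0" by (simp cong: sum.cong)
    qed
  next
    assume r: ?r
    show ?l
    proof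
      fix G assume G: "G \<in> flux_space \<Omega> M E"
      have "?flux G \<in> flux_space \<Omega> M E"
        using G unfolding flux_space_def by (simp flip: distrib_left)
      then show "(\<Sum>K\<in>M. \<Sum>\<sigma>\<in>E K. ?flux G K \<sigma> * ?h K \<sigma>) = 0" using r by (rule bspec[rotated])
    qed
  qed
  have first: "(\<forall>G\<in>flux_space \<Omega> M E. (\<Sum>K\<in>M. mimetic_form E \<Lambda> x C U K (F K) (G K)) - (\<Sum>K\<in>M. volume K * p K * div_h E G K) = 0)
     \<longleftrightarrow> (\<exists>ps. (p, ps) \<in> hybrid_space \<Omega> M E \<and>
       (\<forall>K\<in>M. \<forall>\<sigma>\<in>E K. mv (E K) (?A K) (F K) \<sigma> = face_area \<sigma> * (p K - ps \<sigma>)))"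
  proof -
    have "?h K \<sigma> = ps \<sigma> \<longleftrightarrow> mv (E K) (?A K) (F K) \<sigma> = face_area \<sigma> * (p K - ps \<sigma>)" if "K \<in> M" "\<sigma> \<in> E K" for K \<sigma> and ps :: "'n vals"
      using area[OF that] by (auto simp: field_simps)
    then show ?thesis
      unfolding lhs neg_equal_0_iff_equal scale flux_space_orthogonal_iff[of ?h p] by (simp cong: ball_cong)
  qed
  have second: "(\<forall>q :: 'n vals. (\<Sum>K\<in>M. volume K * q K * div_h E F K) = (\<Sum>K\<in>M. q K * (LINT y:K|lebesgue. f y)))
     \<longleftrightarrow> (\<forall>K\<in>M. (\<Sum>\<sigma>\<in>E K. face_area \<sigma> * F K \<sigma>) = (LINT y:K|lebesgue. f y))"
    using sum_eq_all_iff[OF finite_mesh(1), of "\<lambda>K. \<Sum>\<sigma>\<in>E K. face_area \<sigma> * F K \<sigma>" "\<lambda>K. LINT y:K|lebesgue. f y"]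
    by (simp add: vdiv)
  show ?thesis
    unfolding mimetic_scheme_def matrix_scheme_def mem_Collect_eq case_prod_conv first second by blast
qed

lemma mimetic_to_matrix:
  assumes "mimetic_params M E \<Lambda> x C U"
  shows "\<exists>A. (\<forall>K\<in>M. x K \<in> K \<and> cell_admissible \<Lambda> E x K (A K)) \<and>
    (\<forall>f p F. (p, F) \<in> mimetic_scheme \<Omega> M E \<Lambda> x C U f \<longleftrightarrow> (\<exists>ps. ((p, ps), F) \<in> matrix_scheme \<Omega> M E A f))"
proof -
  have A: "x K \<in> K \<and> cell_admissible \<Lambda> E x K (mat_M E \<Lambda> x C U K) \<and> sym_posdef (E K) (mat_M E \<Lambda> x C U K)" if KM: "K \<in> M" for K
  proof -
    interpret mesh_cell \<Omega> K \<Lambda> E x using mesh_cell[OF KM] .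
    let ?J = "{..<card (E K) - CARD('n)}"
    have "mat_im (E K) ?J (C K) = {v \<in> extensional (E K). comb (E K) (outward_normal K) v = 0}" "sym_posdef ?J (U K)" "x K \<in> K"
      using assms KM by (auto simp: mimetic_params_def vec_orth_im_mat_N)
    moreover from this have "admissible (mat_M E \<Lambda> x C U K)"
      unfolding mat_M_eq[abs_def] by (intro admissible_factor) auto
    ultimately show ?thesis by (simp add: cell_admissible_def admissible_def)
  qed
  then show ?thesis
    using mimetic_scheme_iff[of x C U] by (intro exI[of _ "mat_M E \<Lambda> x C U"]) blast
qed

lemma matrix_to_mimetic:
  assumes A: "\<And>K. K \<in> M \<Longrightarrow> x K \<in> K \<and> cell_admissible \<Lambda> E x K (A K)"
  shows "\<exists>x' C U. mimetic_params M E \<Lambda> x' C U \<and>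
    (\<forall>f p F. (p, F) \<in> mimetic_scheme \<Omega> M E \<Lambda> x' C U f \<longleftrightarrow> (\<exists>ps. ((p, ps), F) \<in> matrix_scheme \<Omega> M E A f))"
proof -
  let ?J = "\<lambda>K. {..<card (E K) - CARD('n)}"
  \<comment> \<open>At \<open>K\<close>, \<open>mat_M\<close> reads only the members of
    \<open>C\<close> and \<open>U\<close> attached to \<open>K\<close>, so constant families can
    stand in until one choice over all cells is made.\<close>
  have "\<exists>C U. mat_im (E K) (?J K) C = vec_orth (E K) (mat_im (E K) UNIV (mat_N \<Lambda> K)) \<and>
      sym_posdef (?J K) U \<and>
      (\<forall>\<sigma>\<in>E K. \<forall>\<tau>\<in>E K. A K \<sigma> \<tau> = mat_M E \<Lambda> x (\<lambda>_. C) (\<lambda>_. U) K \<sigma> \<tau>)" if KM: "K \<in> M" for K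
  proof -
    interpret mesh_cell \<Omega> K \<Lambda> E x using mesh_cell[OF KM] .
    have "admissible (A K)" using A[OF KM] by (simp add: cell_admissible_def)
    then obtain C U where "mat_im (E K) (?J K) C = {v \<in> extensional (E K). comb (E K) (outward_normal K) v = 0}"
      "sym_posdef (?J K) U"
      "\<And>\<sigma> \<tau>. \<sigma> \<in> E K \<Longrightarrow> \<tau> \<in> E K \<Longrightarrow> A K \<sigma> \<tau> = rank_part \<sigma> \<tau> + congr (?J K) (\<lambda>l k. C k l) U \<sigma> \<tau>"
      by (rule admissible_imp_factor) simp
    then show ?thesis
      by (intro exI[of _ C] exI[of _ U]) (auto simp: vec_orth_im_mat_N mat_M_eq)
  qed
  then obtain C U where CU: "\<And>K. K \<in> M \<Longrightarrow> mat_im (E K) (?J K) (C K) = vec_orth (E K) (mat_im (E K) UNIV (mat_N \<Lambda> K))"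
      "\<And>K. K \<in> M \<Longrightarrow> sym_posdef (?J K) (U K)"
      "\<And>K \<sigma> \<tau>. K \<in> M \<Longrightarrow> \<sigma> \<in> E K \<Longrightarrow> \<tau> \<in> E K \<Longrightarrow> A K \<sigma> \<tau> = mat_M E \<Lambda> x (\<lambda>_. C K) (\<lambda>_. U K) K \<sigma> \<tau>"
    by metis
  have eq: "A K \<sigma> \<tau> = mat_M E \<Lambda> x C U K \<sigma> \<tau>" if "K \<in> M" "\<sigma> \<in> E K" "\<tau> \<in> E K" for K \<sigma> \<tau>
    using CU(3)[OF that] by (simp add: mat_M_def)
  have "sym_posdef (E K) (mat_M E \<Lambda> x C U K)" if KM: "K \<in> M" for K
  proof -
    interpret mesh_cell \<Omega> K \<Lambda> E x using mesh_cell[OF KM] .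
    have "sym_posdef (E K) (A K)" using A[OF KM] by (simp add: cell_admissible_def admissible_def)
    then show ?thesis using sym_posdef_cong[of "E K" "A K" "mat_M E \<Lambda> x C U K"] eq[OF KM] by blast
  qed
  note iff = mimetic_scheme_iff[OF this]
  have "matrix_scheme \<Omega> M E (mat_M E \<Lambda> x C U) f = matrix_scheme \<Omega> M E A f" for f
    by (rule matrix_scheme_cong) (simp add: eq)
  moreover have "mimetic_params M E \<Lambda> x C U"
    using A CU(1,2) by (simp add: mimetic_params_def)
  ultimately show ?thesis using iff by metis
qed

end

theorem theorem3p1:
  fixes \<Omega> :: "(real^'n) set"
    and \<Lambda> :: "real^'n \<Rightarrow> real^'n^'n"
    and M :: "(real^'n) set set"
    and E :: "(real^'n) set \<Rightarrow> (real^'n) set set"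
  assumes "open \<Omega>" and "polytopal \<Omega>"
    and "diffusion_tensor \<Omega> \<Lambda>"
    and "polytopal_mesh \<Omega> M E"
  shows
    "(\<forall>x C U. mimetic_params M E \<Lambda> x C U \<longrightarrow>
       (\<exists>x' B. point_matrix_params M E x' B \<and>
          same_scheme_mimetic \<Omega> (mimetic_scheme \<Omega> M E \<Lambda> x C U) (hybrid_scheme \<Omega> M E \<Lambda> x' B)) \<and>
       (\<exists>x' B. point_matrix_params M E x' B \<and>
          same_scheme_mimetic \<Omega> (mimetic_scheme \<Omega> M E \<Lambda> x C U) (mixed_scheme \<Omega> M E \<Lambda> x' B))) \<and>
     (\<forall>x B. point_matrix_params M E x B \<longrightarrow>
       (\<exists>x' C U. mimetic_params M E \<Lambda> x' C U \<and>
          same_scheme_mimetic \<Omega> (mimetic_scheme \<Omega> M E \<Lambda> x' C U) (hybrid_scheme \<Omega> M E \<Lambda> x B)) \<and>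
       (\<exists>x' B'. point_matrix_params M E x' B' \<and>
          same_scheme \<Omega> (mixed_scheme \<Omega> M E \<Lambda> x' B') (hybrid_scheme \<Omega> M E \<Lambda> x B))) \<and>
     (\<forall>x B. point_matrix_params M E x B \<longrightarrow>
       (\<exists>x' C U. mimetic_params M E \<Lambda> x' C U \<and>
          same_scheme_mimetic \<Omega> (mimetic_scheme \<Omega> M E \<Lambda> x' C U) (mixed_scheme \<Omega> M E \<Lambda> x B)) \<and>
       (\<exists>x' B'. point_matrix_params M E x' B' \<and>
          same_scheme \<Omega> (hybrid_scheme \<Omega> M E \<Lambda> x' B') (mixed_scheme \<Omega> M E \<Lambda> x B)))"
proof (intro conjI allI impI)
  note mesh = assms(1,3,4)
  fix x C U assume "mimetic_params M E \<Lambda> x C U"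
  then obtain A where A: "\<And>K. K \<in> M \<Longrightarrow> x K \<in> K \<and> cell_admissible \<Lambda> E x K (A K)"
    and S: "\<And>f p F. (p, F) \<in> mimetic_scheme \<Omega> M E \<Lambda> x C U f \<longleftrightarrow> (\<exists>ps. ((p, ps), F) \<in> matrix_scheme \<Omega> M E A f)"
    by (elim exE[OF mimetic_to_matrix[OF mesh]] conjE) (rule that; simp)
  show "\<exists>x' B. point_matrix_params M E x' B \<and>
      same_scheme_mimetic \<Omega> (mimetic_scheme \<Omega> M E \<Lambda> x C U) (hybrid_scheme \<Omega> M E \<Lambda> x' B)"
  proof -
    have "\<exists>x' B. point_matrix_params M E x' B \<and> hybrid_scheme \<Omega> M E \<Lambda> x' B = matrix_scheme \<Omega> M E A"
      by (rule matrix_to_hybrid[OF mesh A])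
    then obtain x' B where B: "point_matrix_params M E x' B" "hybrid_scheme \<Omega> M E \<Lambda> x' B = matrix_scheme \<Omega> M E A"
      by blast
    have "same_scheme_mimetic \<Omega> (mimetic_scheme \<Omega> M E \<Lambda> x C U) (hybrid_scheme \<Omega> M E \<Lambda> x' B)"
      by (simp add: same_scheme_mimetic_def S B(2))
    with B(1) show ?thesis by blast
  qed
  show "\<exists>x' B. point_matrix_params M E x' B \<and>
      same_scheme_mimetic \<Omega> (mimetic_scheme \<Omega> M E \<Lambda> x C U) (mixed_scheme \<Omega> M E \<Lambda> x' B)"
  proof -
    have "\<exists>x' B. point_matrix_params M E x' B \<and> mixed_scheme \<Omega> M E \<Lambda> x' B = matrix_scheme \<Omega> M E A"
      by (rule matrix_to_mixed[OF mesh A])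
    then obtain x' B where B: "point_matrix_params M E x' B" "mixed_scheme \<Omega> M E \<Lambda> x' B = matrix_scheme \<Omega> M E A"
      by blast
    have "same_scheme_mimetic \<Omega> (mimetic_scheme \<Omega> M E \<Lambda> x C U) (mixed_scheme \<Omega> M E \<Lambda> x' B)"
      by (simp add: same_scheme_mimetic_def S B(2))
    with B(1) show ?thesis by blast
  qed
next
  note mesh = assms(1,3,4)
  fix x B assume "point_matrix_params M E x B"
  then obtain A where A: "\<And>K. K \<in> M \<Longrightarrow> x K \<in> K \<and> cell_admissible \<Lambda> E x K (A K)"
    and S: "hybrid_scheme \<Omega> M E \<Lambda> x B = matrix_scheme \<Omega> M E A"
    by (elim exE[OF hybrid_to_matrix[OF mesh]] conjE) (rule that; simp)
  show "\<exists>x' C U. mimetic_params M E \<Lambda> x' C U \<and>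
      same_scheme_mimetic \<Omega> (mimetic_scheme \<Omega> M E \<Lambda> x' C U) (hybrid_scheme \<Omega> M E \<Lambda> x B)"
  proof -
    have "\<exists>x' C U. mimetic_params M E \<Lambda> x' C U \<and> (\<forall>f p F. (p, F) \<in> mimetic_scheme \<Omega> M E \<Lambda> x' C U f \<longleftrightarrow>
        (\<exists>ps. ((p, ps), F) \<in> matrix_scheme \<Omega> M E A f))"
      by (rule matrix_to_mimetic[OF mesh A])
    then obtain x' C U where C: "mimetic_params M E \<Lambda> x' C U"
      "\<And>f p F. (p, F) \<in> mimetic_scheme \<Omega> M E \<Lambda> x' C U f \<longleftrightarrow> (\<exists>ps. ((p, ps), F) \<in> matrix_scheme \<Omega> M E A f)"
      by (elim exE conjE) (rule that, assumption, elim allE)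
    have "same_scheme_mimetic \<Omega> (mimetic_scheme \<Omega> M E \<Lambda> x' C U) (hybrid_scheme \<Omega> M E \<Lambda> x B)"
      by (simp add: same_scheme_mimetic_def C(2) S)
    with C(1) show ?thesis by blast
  qed
  show "\<exists>x' B'. point_matrix_params M E x' B' \<and>
      same_scheme \<Omega> (mixed_scheme \<Omega> M E \<Lambda> x' B') (hybrid_scheme \<Omega> M E \<Lambda> x B)"
  proof -
    have "\<exists>x' B. point_matrix_params M E x' B \<and> mixed_scheme \<Omega> M E \<Lambda> x' B = matrix_scheme \<Omega> M E A"
      by (rule matrix_to_mixed[OF mesh A])
    then obtain x' B' where B': "point_matrix_params M E x' B'" "mixed_scheme \<Omega> M E \<Lambda> x' B' = matrix_scheme \<Omega> M E A"
      by blast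
    have "same_scheme \<Omega> (mixed_scheme \<Omega> M E \<Lambda> x' B') (hybrid_scheme \<Omega> M E \<Lambda> x B)"
      by (simp add: same_scheme_def S B'(2))
    with B'(1) show ?thesis by blast
  qed
next
  note mesh = assms(1,3,4)
  fix x B assume "point_matrix_params M E x B"
  then obtain A where A: "\<And>K. K \<in> M \<Longrightarrow> x K \<in> K \<and> cell_admissible \<Lambda> E x K (A K)"
    and S: "mixed_scheme \<Omega> M E \<Lambda> x B = matrix_scheme \<Omega> M E A"
    by (elim exE[OF mixed_to_matrix[OF mesh]] conjE) (rule that; simp)
  show "\<exists>x' C U. mimetic_params M E \<Lambda> x' C U \<and>
      same_scheme_mimetic \<Omega> (mimetic_scheme \<Omega> M E \<Lambda> x' C U) (mixed_scheme \<Omega> M E \<Lambda> x B)"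
  proof -
    have "\<exists>x' C U. mimetic_params M E \<Lambda> x' C U \<and> (\<forall>f p F. (p, F) \<in> mimetic_scheme \<Omega> M E \<Lambda> x' C U f \<longleftrightarrow>
        (\<exists>ps. ((p, ps), F) \<in> matrix_scheme \<Omega> M E A f))"
      by (rule matrix_to_mimetic[OF mesh A])
    then obtain x' C U where C: "mimetic_params M E \<Lambda> x' C U"
      "\<And>f p F. (p, F) \<in> mimetic_scheme \<Omega> M E \<Lambda> x' C U f \<longleftrightarrow> (\<exists>ps. ((p, ps), F) \<in> matrix_scheme \<Omega> M E A f)"
      by (elim exE conjE) (rule that, assumption, elim allE)
    have "same_scheme_mimetic \<Omega> (mimetic_scheme \<Omega> M E \<Lambda> x' C U) (mixed_scheme \<Omega> M E \<Lambda> x B)"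
      by (simp add: same_scheme_mimetic_def C(2) S)
    with C(1) show ?thesis by blast
  qed
  show "\<exists>x' B'. point_matrix_params M E x' B' \<and>
      same_scheme \<Omega> (hybrid_scheme \<Omega> M E \<Lambda> x' B') (mixed_scheme \<Omega> M E \<Lambda> x B)"
  proof -
    have "\<exists>x' B. point_matrix_params M E x' B \<and> hybrid_scheme \<Omega> M E \<Lambda> x' B = matrix_scheme \<Omega> M E A"
      by (rule matrix_to_hybrid[OF mesh A])
    then obtain x' B' where B': "point_matrix_params M E x' B'" "hybrid_scheme \<Omega> M E \<Lambda> x' B' = matrix_scheme \<Omega> M E A"
      by blast
    have "same_scheme \<Omega> (hybrid_scheme \<Omega> M E \<Lambda> x' B') (mixed_scheme \<Omega> M E \<Lambda> x B)"
      by (simp add: same_scheme_def S B'(2))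
    with B'(1) show ?thesis by blast
  qed
qed

end
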